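(* Let $X$ be an $n$-dimensional Lévy process with $X(0)=0$, $E|X(1)|<\infty$ and $R^{-1}EX(1)<0$ (coordinate-wise). Then the Markov process $W(X)$ has a unique stationary distribution $\mu$ and converges in distribution to it for every initial condition; that is, for every a.s. finite $[0,\infty)^n$-valued random vector $\eta$, $W(\eta+X)(t)$ converges in distribution to $\mu$ as $t\to\infty$.
   Context: Fix $n\ge 1$ and an $n\times n$ matrix $P=(p_{ij})$ with nonnegative entries and spectral radius strictly less than one. Put $R=I-P^t$, where $^t$ denotes transposition (so $R$ is invertible with $R^{-1}$ entrywise nonnegative). For a càdlàg (right continuous with left limits) function $Y:[0,\infty)\to\mathbb{R}^n$, the reflection map (Skorohod problem in $[0,\infty)^n$) gives the unique pair $(W(Y),L(Y))$ of $\mathbb{R}^n$-valued functions on $[0,\infty)$ with $W(Y)(t)=Y(t)+R\,L(Y)(t)$ for all $t\ge 0$ and, for each $i=1,\ldots,n$: (S1) $L_i(Y)$ is nondecreasing, nonnegative and right continuous; (S2) $W_i(Y)$ is nonnegative; (S3) $\int_{[0,\infty)}1_{\{W_i(Y)(t)>0\}}\,dL_i(Y)(t)=0$, where the measure $dL_i(Y)$ has an atom of mass $L_i(Y)(0)$ at $0$. (It is known that this pair exists and is unique.) The map is applied path by path to stochastic processes; Lévy processes have càdlàg paths. The Markov process $W(X)$ started from the initial condition $\eta\ge 0$ is $W(\eta+X)$, where $(\eta+X)(t)=\eta+X(t)$. A probability measure $\mu$ on $[0,\infty)^n$ is a stationary distribution if, for $\eta\sim\mu$ independent of $X$, $W(\eta+X)(t)\sim\mu$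 for all $t\ge 0$. *)

theory Defs
  imports "HOL-Probability.Probability"
begin

text \<open>Eigenvalues are taken over the complex numbers; the set is finite and nonempty, so
  the maximum exists.\<close>

definition matrix_spectral_radius :: "real^'n^'n \<Rightarrow> real" where
  "matrix_spectral_radius A =
     Max {cmod z | z. \<exists>v :: complex^'n. v \<noteq> 0 \<and>
       (\<chi> i j. complex_of_real (A $ i $ j)) *v v = z *s v}"

text \<open>Paths are functions on all of the reals of which only the values on
  \<open>[0,\<infinity>)\<close> matter.\<close>

definition cadlag :: "(real \<Rightarrow> 'b::topological_space) \<Rightarrow> bool" where
  "cadlag Y \<longleftrightarrow>
     (\<forall>t\<ge>0. (Y \<longlongrightarrow> Y t) (at_right t)) \<and>
     (\<forall>t>0. \<exists>l. (Y \<longlongrightarrow> l) (at_left t))"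

text \<open>A function on \<open>[0,\<infinity>)\<close> is represented by its extension by zero to the negative
  half-line. This makes the pair \<open>(W, L)\<close> literally unique, and it makes the
  Lebesgue-Stieltjes measure of \<open>L\<^sub>i\<close> have the required atom of mass \<open>L\<^sub>i(0)\<close> at \<open>0\<close>.\<close>

definition skorohod_solution ::
  "real^'n^'n \<Rightarrow> (real \<Rightarrow> real^'n) \<Rightarrow> (real \<Rightarrow> real^'n) \<Rightarrow> (real \<Rightarrow> real^'n) \<Rightarrow> bool" where
  "skorohod_solution R Y W L \<longleftrightarrow>
     (\<forall>t<0. W t = 0 \<and> L t = 0) \<and>
     (\<forall>t\<ge>0. W t = Y t + R *v L t) \<and>
     (\<forall>i. mono_on {0..} (\<lambda>t. L t $ i) \<and>
          (\<forall>t\<ge>0. 0 \<le> L t $ i) \<and>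
          (\<forall>t\<ge>0. continuous (at_right t) (\<lambda>s. L s $ i)) \<and>
          (\<forall>t\<ge>0. 0 \<le> W t $ i) \<and>
          (\<integral>\<^sup>+t\<in>{0..}. indicator {s. W s $ i > 0} t \<partial>interval_measure (\<lambda>s. L s $ i)) = 0)"

definition reflection_map ::
  "real^'n^'n \<Rightarrow> (real \<Rightarrow> real^'n) \<Rightarrow> (real \<Rightarrow> real^'n) \<times> (real \<Rightarrow> real^'n)" where
  "reflection_map R Y = (THE (W, L). skorohod_solution R Y W L)"

definition reflected :: "real^'n^'n \<Rightarrow> (real \<Rightarrow> real^'n) \<Rightarrow> real \<Rightarrow> real^'n" where
  "reflected R Y = fst (reflection_map R Y)"

locale levy_process = prob_space M for M :: "'a measure" +
  fixes X :: "real \<Rightarrow> 'a \<Rightarrow> 'b::euclidean_space"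
  assumes random_vector: "0 \<le> t \<Longrightarrow> X t \<in> borel_measurable M"
    and start_zero: "AE \<omega> in M. X 0 \<omega> = 0"
    and independent_increments:
      "\<lbrakk>0 \<le> \<tau> 0; \<And>j. j < k \<Longrightarrow> \<tau> j \<le> \<tau> (Suc j)\<rbrakk> \<Longrightarrow>
         indep_vars (\<lambda>_. borel) (\<lambda>(j::nat) \<omega>. X (\<tau> (Suc j)) \<omega> - X (\<tau> j) \<omega>) {..<k}"
    and stationary_increments:
      "\<lbrakk>0 \<le> s; 0 \<le> t\<rbrakk> \<Longrightarrow> distr M borel (\<lambda>\<omega>. X (s + t) \<omega> - X s \<omega>) = distr M borel (X t)"
    and cadlag_paths: "\<omega> \<in> space M \<Longrightarrow> cadlag (\<lambda>t. X t \<omega>)"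

definition has_law :: "'a measure \<Rightarrow> ('a \<Rightarrow> 'b::topological_space) \<Rightarrow> 'b measure \<Rightarrow> bool" where
  "has_law M Z \<mu> \<longleftrightarrow> Z \<in> borel_measurable M \<and> distr M borel Z = \<mu>"

text \<open>The initial condition \<open>\<eta>\<close> with law \<open>\<mu>\<close>, independent of \<open>X\<close>, is the first coordinate of
  the product space; \<open>X\<close> is read off the second. The space \<open>M\<close> itself need not carry such
  an \<open>\<eta>\<close>.\<close>

definition stationary_distribution ::
  "real^'n^'n \<Rightarrow> 'a measure \<Rightarrow> (real \<Rightarrow> 'a \<Rightarrow> real^'n) \<Rightarrow> (real^'n) measure \<Rightarrow> bool" where
  "stationary_distribution R M X \<mu> \<longleftrightarrow>
     prob_space \<mu> \<and> sets \<mu> = sets borel \<and> (AE x in \<mu>. \<forall>i. 0 \<le> x $ i) \<and>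
     (\<forall>t\<ge>0. has_law (\<mu> \<Otimes>\<^sub>M M) (\<lambda>(\<eta>, \<omega>). reflected R (\<lambda>s. \<eta> + X s \<omega>) t) \<mu>)"

definition converges_in_distribution ::
  "'a measure \<Rightarrow> (real \<Rightarrow> 'a \<Rightarrow> 'b::topological_space) \<Rightarrow> 'b measure \<Rightarrow> bool" where
  "converges_in_distribution M Z \<mu> \<longleftrightarrow>
     (\<forall>t\<ge>0. Z t \<in> borel_measurable M) \<and>
     (\<forall>f :: 'b \<Rightarrow> real. continuous_on UNIV f \<longrightarrow> bounded (range f) \<longrightarrow>
        ((\<lambda>t. \<integral>\<omega>. f (Z t \<omega>) \<partial>M) \<longlongrightarrow> (\<integral>x. f x \<partial>\<mu>)) at_top)"

end

theory Submission
  imports Defs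
begin

text \<open>Write \<open>A\<close> for the transpose of \<open>P\<close>, so that \<open>R = I - A\<close>. Since the spectral radius is below one,
there is a vector \<open>v \<ge> 1\<close> with \<open>R v = 1\<close> (\<open>positive_solution_of_spectral_radius\<close>), and its existence
makes \<open>R\<close> inverse-positive.

\<^bold>\<open>The reflection map.\<close> For a cadlag path \<open>Y\<close> the Skorohod problem is equivalent to the fixed point
equation \<open>L\<^sub>i(t) = sup\<^bsub>s\<le>t\<^esub> max(0, (A L - Y)\<^sub>i(s))\<close>, which Picard iteration from \<open>0\<close> solves and which
has only one solution (\<open>reflected_eq_reflect\<close>). Iterating the one-dimensional monotonicity of running
maxima shows that a larger starting point increases the reflected path \<open>W\<close> and reduces all
increments of the regulator \<open>L\<close> (\<open>reflection_monotone\<close>).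

\<^bold>\<open>Loss of memory.\<close> Hence the difference of two reflected paths driven by the same \<open>Y\<close>, one of which
starts at a higher point, converges. If all coordinates of the regulator are unbounded, each coordinate
of the upper path comes close to zero again and again, so the limit is zero
(\<open>reflect_forgets_initial_condition\<close>). For the Levy process the regulators are unbounded almost surely:
\<open>R\<inverse>X + L = R\<inverse>W \<ge> 0\<close> and \<open>R\<inverse>X\<close> drifts to \<open>-\<infinity>\<close>. Everything then follows once a stationary law \<open>\<mu>\<close>
exists: started from \<open>\<mu>\<close>, the process has law \<open>\<mu>\<close> at all times, and every other start
eventually leads to almost the same path, whether or not the starting point depends on \<open>X\<close>. This gives convergence in
distribution, and uniqueness of \<open>\<mu>\<close> as well.

\<^bold>\<open>Existence.\<close> Following Loynes, the path is cut into unit blocks, and the blocks are used in reversed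
order. The states \<open>loynes n\<close> so obtained have the laws of \<open>W(n)\<close> started from \<open>0\<close>, but they increase in
\<open>n\<close>. Provided that these laws are tight, \<open>loynes n\<close> converges almost surely to a finite limit, whose law
is stationary (\<open>distr_stationary_law\<close>).

\<^bold>\<open>Tightness.\<close> For \<open>D = R\<inverse>W\<close> the function \<open>max\<^sub>i D\<^sub>i / v\<^sub>i\<close> is a Lyapunov function: at a coordinate
where the maximum is attained, \<open>W\<^sub>i\<close> is positive, so the regulator is inactive there and \<open>D\<^sub>i\<close> follows
the negative drift of \<open>R\<inverse>X\<close>. Pathwise this bounds \<open>W(n)\<close> by the largest deviation of \<open>R\<inverse>X\<close> from its
drift, seen backwards from time \<open>n\<close> and reduced by a small multiple of the elapsed time
(\<open>reflect_drift_bound\<close>). Such a deviation is the workload of a one-dimensional queue with negative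
drift, to which the same reversal of blocks applies. That the reversed workloads stay bounded replaces
the strong law of large numbers; Ottaviani's inequality controls the path within a unit block (\<open>backward_workload_bounded\<close>).\<close>

section \<open>Nonnegative matrices with spectral radius below one\<close>

text \<open>Finiteness is what gives the \<open>Max\<close> in the definition of the spectral radius its meaning. The
eigenvalues are roots of the characteristic polynomial, which is not the zero polynomial since
a number exceeding the sum of all moduli of entries is no eigenvalue.\<close>

lemma finite_eigenvalues:
  fixes A :: "complex^'n^'n"
  shows "finite {z. \<exists>v. v \<noteq> 0 \<and> A *v v = z *s v}"
proof -
  define C :: "complex poly^'n^'n" where "C = (\<chi> i j. [:- (A $ i $ j), if i = j then 1 else 0:])"
  have poly_det: "poly (det C) z = det (mat z - A)" for z
    unfolding det_def C_def by (auto simp: poly_sum poly_prod mat_def sign_def intro!: sum.cong prod.cong)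
  have eigen: "det (mat z - A) = 0" if "v \<noteq> 0" "A *v v = z *s v" for z v
  proof -
    have "mat z *v v = z *s v"
      by (simp add: vec_eq_iff matrix_vector_mult_def mat_def if_distrib if_distribR cong: if_cong)
    then have "(mat z - A) *v v = 0"
      using that by (simp add: matrix_vector_mult_diff_rdistrib)
    then have "\<not> invertible (mat z - A)"
      using that(1) by (auto simp: invertible_left_inverse matrix_left_invertible_ker)
    then show ?thesis by (simp add: invertible_det_nz)
  qed
  define z0 where "z0 = complex_of_real (1 + (\<Sum>i\<in>UNIV. \<Sum>j\<in>UNIV. cmod (A $ i $ j)))"
  have "det (mat z0 - A) \<noteq> 0"
  proof
    assume "det (mat z0 - A) = 0"
    then have "\<not> invertible (mat z0 - A)" by (simp add: invertible_det_nz)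
    then obtain v where v: "v \<noteq> 0" "(mat z0 - A) *v v = 0"
      by (auto simp: invertible_left_inverse matrix_left_invertible_ker)
    have "mat z0 *v v = z0 *s v"
      by (simp add: vec_eq_iff matrix_vector_mult_def mat_def if_distrib if_distribR cong: if_cong)
    with v have e: "A *v v = z0 *s v" by (simp add: matrix_vector_mult_diff_rdistrib)
    define m where "m = (\<Sum>i\<in>UNIV. cmod (v $ i))"
    have le_m: "cmod (v $ i) \<le> m" for i unfolding m_def by (rule member_le_sum) auto
    obtain i where "v $ i \<noteq> 0" using v(1) by (auto simp: vec_eq_iff)
    then have m0: "0 < m" using le_m[of i] by (smt (verit) zero_less_norm_iff)
    have "cmod z0 * m = (\<Sum>i\<in>UNIV. cmod ((A *v v) $ i))"
      by (simp add: e m_def norm_mult sum_distrib_left)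
    also have "\<dots> \<le> (\<Sum>i\<in>UNIV. \<Sum>j\<in>UNIV. cmod (A $ i $ j) * m)"
    proof (rule sum_mono)
      fix i
      have "cmod ((A *v v) $ i) \<le> (\<Sum>j\<in>UNIV. cmod (A $ i $ j * v $ j))"
        unfolding matrix_vector_mult_def by (simp add: norm_sum)
      also have "\<dots> \<le> (\<Sum>j\<in>UNIV. cmod (A $ i $ j) * m)"
        by (intro sum_mono) (simp add: norm_mult le_m mult_left_mono)
      finally show "cmod ((A *v v) $ i) \<le> (\<Sum>j\<in>UNIV. cmod (A $ i $ j) * m)" .
    qed
    also have "\<dots> = (\<Sum>i\<in>UNIV. \<Sum>j\<in>UNIV. cmod (A $ i $ j)) * m"
      by (simp add: sum_distrib_right)
    finally have "cmod z0 \<le> (\<Sum>i\<in>UNIV. \<Sum>j\<in>UNIV. cmod (A $ i $ j))"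
      using m0 by simp
    moreover have "cmod z0 = 1 + (\<Sum>i\<in>UNIV. \<Sum>j\<in>UNIV. cmod (A $ i $ j))"
      unfolding z0_def norm_of_real by (intro abs_of_nonneg add_nonneg_nonneg sum_nonneg) auto
    ultimately show False by simp
  qed
  then have "det C \<noteq> 0" using poly_det[of z0] by auto
  then have "finite {z. poly (det C) z = 0}" by (rule poly_roots_finite)
  then show ?thesis by (rule rev_finite_subset) (auto simp: poly_det eigen)
qed

lemma matrix_vector_mono:
  fixes A :: "real^'n^'n"
  assumes "\<And>i j. 0 \<le> A $ i $ j" "x \<le> y"
  shows "A *v x \<le> A *v y"
  using assms by (auto simp: less_eq_vec_def matrix_vector_mult_def intro!: sum_mono mult_left_mono)

text \<open>The maximum principle for M-matrices. If \<open>x\<close> had a negative coordinate, subtract from it the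
multiple \<open>m u\<close> of the positive vector that touches \<open>x\<close> from below; at the touching coordinate
\<open>u - A u > 0\<close> is violated.\<close>

lemma inverse_positive_of_positive_vector:
  fixes A :: "real^'n^'n"
  assumes A: "\<And>i j. 0 \<le> A $ i $ j" and u: "\<And>i. 0 < u $ i" "\<And>i. (A *v u) $ i < u $ i"
    and x: "A *v x \<le> x"
  shows "0 \<le> x"
proof -
  define m where "m = Min (range (\<lambda>i. x $ i / u $ i))"
  have m_le: "m * u $ i \<le> x $ i" for i
  proof -
    have "m \<le> x $ i / u $ i" unfolding m_def by (rule Min_le) auto
    then show ?thesis using u(1)[of i] by (simp add: pos_le_divide_eq)
  qed
  have "m \<in> range (\<lambda>i. x $ i / u $ i)" unfolding m_def by (rule Min_in) auto
  then obtain i where "m = x $ i / u $ i" by auto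
  then have i: "x $ i = m * u $ i" using u(1)[of i] by simp
  have "0 \<le> m"
  proof (rule ccontr)
    assume "\<not> 0 \<le> m"
    then have "m * u $ i < m * (A *v u) $ i" using u(2)[of i] by simp
    also have "\<dots> = (A *v (m *\<^sub>R u)) $ i" by (simp add: matrix_vector_mult_scaleR)
    also have "\<dots> \<le> (A *v x) $ i"
      using matrix_vector_mono[OF A, of "m *\<^sub>R u" x] m_le by (simp add: less_eq_vec_def)
    also have "\<dots> \<le> x $ i" using x by (simp add: less_eq_vec_def)
    finally show False using i by simp
  qed
  then show ?thesis
    using m_le u(1) by (auto simp: less_eq_vec_def) (meson less_eq_real_def mult_nonneg_nonneg order_trans)
qed

text \<open>For \<open>0 \<le> t \<le> 1\<close> the matrix \<open>I - tA\<close> is invertible, because \<open>1/t\<close> is not an eigenvalue. The set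
of those \<open>t\<close> for which its inverse is nonnegative contains \<open>0\<close> and is both open (the maximum
principle with \<open>u = (I - tA)\<inverse>1\<close>) and closed, so it contains \<open>1\<close>. This replaces the
Perron-Frobenius theorem; the vector \<open>v = (I - A)\<inverse>1\<close> obtained here carries every estimate on
the reflection map below.\<close>

lemma positive_solution_of_spectral_radius:
  fixes P :: "real^'n^'n"
  assumes P: "\<And>i j. 0 \<le> P $ i $ j" and radius: "matrix_spectral_radius P < 1"
  shows "\<exists>v. 0 \<le> v \<and> v = 1 + transpose P *v v"
proof -
  define A where "A = transpose P"
  have A: "0 \<le> A $ i $ j" for i j unfolding A_def transpose_def using P by simp
  have inv: "invertible (mat 1 - t *\<^sub>R A)" if t: "t \<in> {0..1}" for t
  proof (rule ccontr)
    assume "\<not> invertible (mat 1 - t *\<^sub>R A)"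
    moreover have "transpose (mat 1 - t *\<^sub>R P) = mat 1 - t *\<^sub>R A"
      by (auto simp: A_def transpose_def vec_eq_iff mat_def)
    ultimately have "\<not> invertible (mat 1 - t *\<^sub>R P)"
      by (metis transpose_invertible)
    then obtain w where w: "w \<noteq> 0" "(mat 1 - t *\<^sub>R P) *v w = 0"
      by (auto simp: invertible_left_inverse matrix_left_invertible_ker)
    then have w': "w = t *\<^sub>R (P *v w)"
      by (simp add: matrix_vector_mult_diff_rdistrib scaleR_matrix_vector_assoc)
    then have t0: "0 < t" using w(1) t by (cases "t = 0") auto
    have ev: "P *v w = (1/t) *\<^sub>R w" by (subst (2) w') (use t0 in simp)
    define v where "v = (\<chi> i. complex_of_real (w $ i))"
    have "v \<noteq> 0" using w(1) by (auto simp: v_def vec_eq_iff)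
    moreover have "(\<chi> i j. complex_of_real (P $ i $ j)) *v v = complex_of_real (1/t) *s v"
    proof -
      have "complex_of_real ((P *v w) $ i) = complex_of_real (((1/t) *\<^sub>R w) $ i)" for i
        using ev by simp
      then show ?thesis by (simp add: vec_eq_iff v_def matrix_vector_mult_def)
    qed
    ultimately have "cmod (complex_of_real (1/t)) \<in> {cmod z | z. \<exists>v :: complex^'n. v \<noteq> 0 \<and>
       (\<chi> i j. complex_of_real (P $ i $ j)) *v v = z *s v}" by blast
    moreover have "finite {cmod z | z. \<exists>v :: complex^'n. v \<noteq> 0 \<and>
       (\<chi> i j. complex_of_real (P $ i $ j)) *v v = z *s v}"
      using finite_imageI[OF finite_eigenvalues, of cmod "\<chi> i j. complex_of_real (P $ i $ j)"]
      by (rule rev_finite_subset) auto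
    ultimately have "cmod (complex_of_real (1/t)) \<le> matrix_spectral_radius P"
      unfolding matrix_spectral_radius_def by (intro Max_ge)
    then have "1 / t < 1" using radius t0 by (simp add: norm_divide del: divide_less_eq_1_pos)
    then have "1 < t" using t0 by simp
    then show False using t by simp
  qed
  have solve: "\<exists>x. x - t *\<^sub>R (A *v x) = y" if t: "t \<in> {0..1}" for t y
  proof -
    obtain B where "(mat 1 - t *\<^sub>R A) ** B = mat 1"
      using inv[OF t] by (auto simp: invertible_def)
    then have "(mat 1 - t *\<^sub>R A) *v (B *v y) = y"
      by (simp add: matrix_vector_mul_assoc)
    then have "B *v y - t *\<^sub>R (A *v (B *v y)) = y"
      by (simp add: matrix_vector_mult_diff_rdistrib scaleR_matrix_vector_assoc)
    then show ?thesis by blast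
  qed
  define S where "S = {t \<in> {0..1}. \<forall>x. t *\<^sub>R (A *v x) \<le> x \<longrightarrow> 0 \<le> x}"
  have S_near: "\<exists>d>0. \<forall>t'\<in>{0..1}. \<bar>t' - t\<bar> < d \<longrightarrow> t' \<in> S" if tS: "t \<in> S" for t
  proof -
    have t: "t \<in> {0..1}" using tS by (simp add: S_def)
    \<comment> \<open>Openness: \<open>u \<ge> 1\<close>, so \<open>u - t'Au\<close> stays positive for \<open>t'\<close> within \<open>1/B\<close> of \<open>t\<close>.\<close>
    obtain u where u: "u - t *\<^sub>R (A *v u) = 1" using solve[OF t] by blast
    have u1: "u $ i = 1 + t * (A *v u) $ i" for i
      using arg_cong[OF u, of "\<lambda>x. x $ i"] by simp
    have u0: "0 \<le> u"
    proof -
      have "t *\<^sub>R (A *v u) \<le> u" by (simp add: less_eq_vec_def u1)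
      then show ?thesis using tS by (simp add: S_def)
    qed
    have Au: "0 \<le> (A *v u) $ i" for i
      using matrix_vector_mono[OF A u0] by (simp add: less_eq_vec_def)
    define B where "B = 1 + (\<Sum>i\<in>UNIV. (A *v u) $ i)"
    have B: "1 \<le> B" "(A *v u) $ i \<le> B" for i
      using Au member_le_sum[of i UNIV "\<lambda>i. (A *v u) $ i"] by (auto simp: B_def sum_nonneg intro: add_increasing)
    have "t' \<in> S" if t': "t' \<in> {0..1}" "\<bar>t' - t\<bar> < 1 / B" for t'
    proof -
      have "0 \<le> x" if "t' *\<^sub>R (A *v x) \<le> x" for x
      proof (rule inverse_positive_of_positive_vector[of "t' *\<^sub>R A" u])
        show "0 \<le> (t' *\<^sub>R A) $ i $ j" for i j using t' A by simp
        show "0 < u $ i" for i using u1[of i] Au[of i] t by (simp add: add_pos_nonneg)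
        show "((t' *\<^sub>R A) *v u) $ i < u $ i" for i
        proof -
          have "(t' - t) * (A *v u) $ i \<le> \<bar>t' - t\<bar> * B"
            using Au[of i] B by (intro mult_mono) auto
          also have "\<dots> < 1" using t'(2) B(1) by (simp add: field_simps)
          finally show ?thesis
            using u1[of i] by (simp flip: scaleR_matrix_vector_assoc add: algebra_simps)
        qed
        show "t' *\<^sub>R A *v x \<le> x" using that by (simp flip: scaleR_matrix_vector_assoc)
      qed
      then show ?thesis using t' by (simp add: S_def)
    qed
    then show ?thesis using B(1) by (intro exI[of _ "1/B"]) auto
  qed
  have S_closed: "t \<in> S" if t: "t \<in> {0..1}" and lim: "\<And>d. 0 < d \<Longrightarrow> \<exists>t'\<in>S. \<bar>t' - t\<bar> < d" for t
  proof -
    have "0 \<le> x" if x: "t *\<^sub>R (A *v x) \<le> x" for x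
    proof -
      \<comment> \<open>Closedness: \<open>x + \<delta>w\<close> is strictly feasible for \<open>t\<close>, hence feasible for nearby \<open>t'\<close>; then let \<open>\<delta>\<close> tend to \<open>0\<close>.\<close>
      obtain w where w: "w - t *\<^sub>R (A *v w) = 1" using solve[OF t] by blast
      have pos: "0 \<le> x + \<delta> *\<^sub>R w" if \<delta>: "0 < \<delta>" for \<delta>
      proof -
        define q where "q = x + \<delta> *\<^sub>R w"
        have q: "q $ i - t * (A *v q) $ i \<ge> \<delta>" for i
        proof -
          have "w $ i - t * (A *v w) $ i = 1" using arg_cong[OF w, of "\<lambda>x. x $ i"] by simp
          then have "\<delta> * w $ i - t * (\<delta> * (A *v w) $ i) = \<delta>" by (metis (no_types) mult.assoc mult.commute mult.right_neutral right_diff_distrib)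
          moreover have "t * (A *v x) $ i \<le> x $ i" using x by (simp add: less_eq_vec_def)
          ultimately show ?thesis
            by (simp add: q_def matrix_vector_right_distrib matrix_vector_mult_scaleR algebra_simps)
        qed
        define B where "B = 1 + (\<Sum>i\<in>UNIV. \<bar>(A *v q) $ i\<bar>)"
        have B: "1 \<le> B" "\<bar>(A *v q) $ i\<bar> \<le> B" for i
          using member_le_sum[of i UNIV "\<lambda>i. \<bar>(A *v q) $ i\<bar>"] by (auto simp: B_def sum_nonneg intro: add_increasing)
        obtain t' where t': "t' \<in> S" "\<bar>t' - t\<bar> < \<delta> / B"
          using lim[of "\<delta> / B"] \<delta> B(1) by auto
        have "t' *\<^sub>R (A *v q) \<le> q"
          unfolding less_eq_vec_def
        proof
          fix i
          have "(t' - t) * (A *v q) $ i \<le> \<bar>t' - t\<bar> * \<bar>(A *v q) $ i\<bar>"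
            by (metis abs_ge_self abs_mult)
          also have "\<dots> \<le> \<bar>t' - t\<bar> * B" using B(2) by (intro mult_left_mono) auto
          also have "\<dots> \<le> \<delta>" using t'(2) B(1) by (simp add: field_simps)
          finally show "(t' *\<^sub>R (A *v q)) $ i \<le> q $ i" using q[of i] by (simp add: algebra_simps)
        qed
        then show ?thesis using t'(1) by (simp add: S_def q_def)
      qed
      have "0 \<le> x $ i" for i
      proof (rule ccontr)
        assume "\<not> 0 \<le> x $ i"
        then have n: "x $ i < 0" by simp
        define \<delta> where "\<delta> = - x $ i / (2 * (1 + \<bar>w $ i\<bar>))"
        have "0 < 2 * (1 + \<bar>w $ i\<bar>)" by (intro mult_pos_pos add_pos_nonneg) auto
        then have "0 < \<delta>" unfolding \<delta>_def using n by (intro divide_pos_pos) simp_all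
        then have "0 \<le> x $ i + \<delta> * w $ i" using pos[of \<delta>] by (simp add: less_eq_vec_def)
        also have "\<delta> * w $ i \<le> \<delta> * (1 + \<bar>w $ i\<bar>)" using \<open>0 < \<delta>\<close> by (intro mult_left_mono) auto
        also have "\<dots> = - x $ i / 2" by (simp add: \<delta>_def field_simps add_nonneg_eq_0_iff)
        finally show False using n by simp
      qed
      then show ?thesis by (simp add: less_eq_vec_def)
    qed
    then show ?thesis using t by (simp add: S_def)
  qed
  have "S = {0..1}"
  proof -
    have "connected {0..1::real}" by simp
    moreover have "openin (top_of_set {0..1}) S"
      unfolding openin_euclidean_subtopology_iff using S_near by (auto simp: S_def dist_real_def)
    moreover have "closedin (top_of_set {0..1}) S"
      unfolding closedin_limpt
    proof (intro conjI allI impI)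
      show "S \<subseteq> {0..1}" by (auto simp: S_def)
      fix t assume "t islimpt S \<and> t \<in> {0..1}"
      then show "t \<in> S"
        by (intro S_closed) (auto simp: islimpt_approachable dist_real_def)
    qed
    moreover have "0 \<in> S" by (simp add: S_def)
    ultimately show ?thesis by (auto simp: connected_clopen)
  qed
  then have "1 \<in> S" by simp
  moreover obtain v where v: "v - A *v v = 1" using solve[of 1 1] by auto
  moreover have "A *v v \<le> v"
  proof -
    have "0 \<le> (1 :: real^'n)" by (simp add: less_eq_vec_def)
    then show ?thesis by (simp flip: v)
  qed
  ultimately have "0 \<le> v" by (simp add: S_def)
  moreover have "v = 1 + A *v v" using v by (simp add: algebra_simps)
  ultimately show ?thesis unfolding A_def by blast
qed

section \<open>The regulator of a path\<close>

definition locally_bounded :: "(real \<Rightarrow> real^'n) \<Rightarrow> bool" where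
  "locally_bounded Y \<longleftrightarrow> (\<forall>T. \<exists>B. \<forall>s\<in>{0..T}. \<forall>i. \<bar>Y s $ i\<bar> \<le> B)"

lemma locally_boundedE:
  assumes "locally_bounded Y"
  obtains B where "0 \<le> B" "\<And>s i. s \<in> {0..T} \<Longrightarrow> \<bar>Y s $ i\<bar> \<le> B"
proof -
  obtain B where "\<forall>s\<in>{0..T}. \<forall>i. \<bar>Y s $ i\<bar> \<le> B"
    using assms unfolding locally_bounded_def by blast
  then show ?thesis by (intro that[of "max 0 B"]) (auto simp: le_max_iff_disj)
qed

lemma locally_bounded_add_const:
  assumes "locally_bounded Y" shows "locally_bounded (\<lambda>s. a + Y s)"
  unfolding locally_bounded_def
proof
  fix T
  obtain B where B: "0 \<le> B" "\<And>s i. s \<in> {0..T} \<Longrightarrow> \<bar>Y s $ i\<bar> \<le> B"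
    using locally_boundedE[OF assms] by blast
  have "\<bar>(a + Y s) $ i\<bar> \<le> norm a + B" if "s \<in> {0..T}" for s i
    using B(2)[OF that, of i] component_le_norm_cart[of a i] by simp
  then show "\<exists>B. \<forall>s\<in>{0..T}. \<forall>i. \<bar>(a + Y s) $ i\<bar> \<le> B" by blast
qed

text \<open>Each point of \<open>[0,T]\<close> has a neighbourhood on which the path is bounded, by its two one-sided
limits there; compactness does the rest.\<close>

lemma cadlag_locally_bounded:
  fixes Y :: "real \<Rightarrow> real^'n"
  assumes "cadlag Y" shows "locally_bounded Y"
  unfolding locally_bounded_def
proof
  fix T :: real
  have "\<exists>U B. open U \<and> t \<in> U \<and> (\<forall>s\<in>U \<inter> {0..}. norm (Y s) \<le> B)" if t: "t \<in> {0..T}" for t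
  proof -
    have "(Y \<longlongrightarrow> Y t) (at_right t)" using assms t by (simp add: cadlag_def)
    then have "\<forall>\<^sub>F s in at_right t. dist (Y s) (Y t) < 1" by (rule tendstoD) simp
    then obtain b where b: "t < b" "\<And>s. t < s \<Longrightarrow> s < b \<Longrightarrow> dist (Y s) (Y t) < 1"
      by (auto simp: eventually_at_right[of t "t + 1"])
    have right: "norm (Y s) \<le> norm (Y t) + 1" if "t \<le> s" "s < b" for s
    proof (cases "s = t")
      case False
      then have "norm (Y s - Y t) < 1" using b(2)[of s] that by (simp add: dist_norm)
      then show ?thesis by (smt (verit) norm_triangle_sub)
    qed simp
    have "\<exists>a<t. \<exists>B. \<forall>s. a < s \<longrightarrow> s < t \<longrightarrow> 0 \<le> s \<longrightarrow> norm (Y s) \<le> B"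
    proof (cases "t = 0")
      case True then show ?thesis by (intro exI[of _ "-1"]) auto
    next
      case False
      then have "0 < t" using t by simp
      then obtain l where "(Y \<longlongrightarrow> l) (at_left t)" using assms unfolding cadlag_def by blast
      then have "\<forall>\<^sub>F s in at_left t. dist (Y s) l < 1" by (rule tendstoD) simp
      then obtain a where a: "a < t" "\<And>s. a < s \<Longrightarrow> s < t \<Longrightarrow> dist (Y s) l < 1"
        by (auto simp: eventually_at_left[of "t - 1" t])
      have "norm (Y s) \<le> norm l + 1" if "a < s" "s < t" for s
      proof -
        have "norm (Y s - l) < 1" using a(2)[of s] that by (simp add: dist_norm)
        then show ?thesis by (smt (verit) norm_triangle_sub)
      qed
      then show ?thesis using a(1) by blast
    qed
    then obtain a B where a: "a < t" "\<And>s. a < s \<Longrightarrow> s < t \<Longrightarrow> 0 \<le> s \<Longrightarrow> norm (Y s) \<le> B" by blast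
    have "\<forall>s\<in>{a<..<b} \<inter> {0..}. norm (Y s) \<le> max B (norm (Y t) + 1)"
    proof
      fix s assume s: "s \<in> {a<..<b} \<inter> {0..}"
      show "norm (Y s) \<le> max B (norm (Y t) + 1)"
        using s a(2)[of s] right[of s] by (cases "s < t") (auto simp: max_def)
    qed
    then show ?thesis
      using a(1) b(1) by (intro exI[of _ "{a<..<b}"]) (auto intro!: exI[of _ "max B (norm (Y t) + 1)"])
  qed
  then obtain U B where U: "\<And>t. t \<in> {0..T} \<Longrightarrow> open (U t) \<and> t \<in> U t \<and> (\<forall>s\<in>U t \<inter> {0..}. norm (Y s) \<le> B t)"
    by metis
  have "compact {0..T}" by simp
  then obtain F where F: "F \<subseteq> {0..T}" "finite F" "{0..T} \<subseteq> (\<Union>t\<in>F. U t)"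
    using U by (elim compactE_image[of "{0..T}" "{0..T}" U]) auto
  have "\<bar>Y s $ i\<bar> \<le> (\<Sum>t\<in>F. \<bar>B t\<bar>)" if "s \<in> {0..T}" for s i
  proof -
    obtain t where t: "t \<in> F" "s \<in> U t" using F(3) \<open>s \<in> {0..T}\<close> by blast
    then have "norm (Y s) \<le> B t" using U[of t] F(1) \<open>s \<in> {0..T}\<close> by auto
    also have "B t \<le> \<bar>B t\<bar>" by simp
    also have "\<dots> \<le> (\<Sum>t\<in>F. \<bar>B t\<bar>)" using t F(2) by (intro member_le_sum) auto
    finally show ?thesis using component_le_norm_cart[of "Y s" i] by linarith
  qed
  then show "\<exists>B. \<forall>s\<in>{0..T}. \<forall>i. \<bar>Y s $ i\<bar> \<le> B" by blast
qed

text \<open>The maximum with \<open>0\<close> makes \<open>running_max (\<lambda>s. - x s)\<close> the regulator of the one-dimensional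
Skorohod problem for \<open>x\<close>.\<close>

definition running_max :: "(real \<Rightarrow> real) \<Rightarrow> real \<Rightarrow> real" where
  "running_max f t = (SUP s\<in>{0..t}. max 0 (f s))"

lemma running_max_le_iff:
  assumes "0 \<le> t" and "\<And>s. s \<in> {0..t} \<Longrightarrow> f s \<le> B"
  shows "running_max f t \<le> c \<longleftrightarrow> 0 \<le> c \<and> (\<forall>s\<in>{0..t}. f s \<le> c)"
proof -
  have "bdd_above ((\<lambda>s. max 0 (f s)) ` {0..t})"
    using assms(2) by (intro bdd_aboveI2[of _ _ "max 0 B"]) fastforce
  then have "running_max f t \<le> c \<longleftrightarrow> (\<forall>s\<in>{0..t}. max 0 (f s) \<le> c)"
    unfolding running_max_def using assms(1) by (intro cSUP_le_iff) auto
  then show ?thesis using assms(1) by force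
qed

lemma running_max_ge:
  assumes "0 \<le> t" and "\<And>s. s \<in> {0..t} \<Longrightarrow> f s \<le> B"
  shows "0 \<le> running_max f t" "s \<in> {0..t} \<Longrightarrow> f s \<le> running_max f t"
  using running_max_le_iff[of t f B "running_max f t", OF assms] by auto

text \<open>Adding a nonnegative nondecreasing input \<open>\<delta>\<close> to a one-dimensional reflected path reduces every
increment of its regulator, and the regulator drops by no more than the input received so far.
In dimension one this is the whole monotonicity theory of reflection; the \<open>n\<close>-dimensional
statements follow by iterating it.\<close>

lemma running_max_subtract_monotone:
  assumes f: "\<And>r. r \<in> {0..t} \<Longrightarrow> f r \<le> B" and f': "\<And>r. r \<in> {0..t} \<Longrightarrow> f' r = f r - \<delta> r"
    and \<delta>: "\<And>r. r \<in> {0..t} \<Longrightarrow> 0 \<le> \<delta> r" "\<And>r u. 0 \<le> r \<Longrightarrow> r \<le> u \<Longrightarrow> u \<le> t \<Longrightarrow> \<delta> r \<le> \<delta> u"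
    and st: "0 \<le> s" "s \<le> t"
  shows "running_max f' t - running_max f' s \<le> running_max f t - running_max f s"
    and "running_max f' s \<le> running_max f s"
    and "running_max f s \<le> running_max f' s + \<delta> s"
proof -
  have f'_le: "f' r \<le> B" if "r \<in> {0..t}" for r using f[OF that] f'[OF that] \<delta>(1)[OF that] by simp
  have ft: "f r \<le> B" "f' r \<le> B" if "r \<in> {0..s}" for r using f f'_le that st by auto
  have t0: "0 \<le> t" using st by simp
  have mono: "running_max f s \<le> running_max f t"
    using running_max_le_iff[of s f B "running_max f t", OF st(1) ft(1)]
      running_max_ge[of t f B, OF t0 f] st by auto
  have above: "running_max f s \<le> running_max f' s + \<delta> u" if u: "s \<le> u" "u \<le> t" for u
  proof -
    have "f r \<le> running_max f' s + \<delta> u" if r: "r \<in> {0..s}" for r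
    proof -
      have "f r = f' r + \<delta> r" using f'[of r] r st by auto
      also have "\<dots> \<le> running_max f' s + \<delta> u"
        using running_max_ge(2)[of s f' B, OF st(1) ft(2) r] \<delta>(2)[of r u] r u by (intro add_mono) auto
      finally show ?thesis .
    qed
    moreover have "0 \<le> running_max f' s + \<delta> u"
      using running_max_ge(1)[of s f' B, OF st(1) ft(2)] \<delta>(1)[of u] st u by auto
    ultimately show ?thesis using running_max_le_iff[of s f B, OF st(1) ft(1)] by blast
  qed
  show "running_max f s \<le> running_max f' s + \<delta> s" using above st by blast
  have "f' r \<le> running_max f s" if "r \<in> {0..s}" for r
    using running_max_ge(2)[of s f B, OF st(1) ft(1) that] f'[of r] \<delta>(1)[of r] that st by auto
  then show "running_max f' s \<le> running_max f s"
    using running_max_le_iff[of s f' B, OF st(1) ft(2)] running_max_ge(1)[of s f B, OF st(1) ft(1)] by blast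
  have "f' r \<le> running_max f' s + (running_max f t - running_max f s)" if r: "r \<in> {0..t}" for r
  proof (cases "r \<le> s")
    case True
    then show ?thesis using running_max_ge(2)[of s f' B, OF st(1) ft(2), of r] r mono by auto
  next
    case False
    have "f' r = f r - \<delta> r" using f' r by auto
    also have "\<dots> \<le> running_max f t - \<delta> r" using running_max_ge(2)[of t f B, OF t0 f r] by simp
    finally show ?thesis using above[of r] r False by auto
  qed
  moreover have "0 \<le> running_max f' s + (running_max f t - running_max f s)"
    using running_max_ge(1)[of s f' B, OF st(1) ft(2)] mono by simp
  ultimately have "running_max f' t \<le> running_max f' s + (running_max f t - running_max f s)"
    using running_max_le_iff[of t f' B, OF t0 f'_le] by blast
  then show "running_max f' t - running_max f' s \<le> running_max f t - running_max f s" by simp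
qed

lemma tendsto_matrix_vector:
  fixes A :: "real^'n^'m"
  assumes "(f \<longlongrightarrow> x) F" shows "((\<lambda>t. A *v f t) \<longlongrightarrow> A *v x) F"
  by (rule bounded_linear.tendsto[OF matrix_vector_mul_bounded_linear assms])

lemma increasing_bounded_tendsto_at_top:
  fixes g :: "real \<Rightarrow> real"
  assumes mono: "\<And>s t. 0 \<le> s \<Longrightarrow> s \<le> t \<Longrightarrow> g s \<le> g t" and bound: "\<And>t. 0 \<le> t \<Longrightarrow> g t \<le> B"
  shows "\<exists>l. (g \<longlongrightarrow> l) at_top"
proof -
  define l where "l = (SUP t\<in>{0..}. g t)"
  have bdd: "bdd_above (g ` {0..})" using bound by (intro bdd_aboveI2[of _ _ B]) auto
  have "(g \<longlongrightarrow> l) at_top"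
  proof (rule order_tendstoI)
    fix a assume "a < l"
    then obtain t where t: "0 \<le> t" "a < g t" unfolding l_def using less_cSUP_iff[OF _ bdd] by auto
    then have "a < g s" if "t \<le> s" for s using mono[of t s] that by simp
    then show "\<forall>\<^sub>F s in at_top. a < g s" by (auto simp: eventually_at_top_linorder)
  next
    fix a assume "l < a"
    then have "g s < a" if "0 \<le> s" for s using cSUP_upper[OF _ bdd, of s] that by (simp add: l_def)
    then show "\<forall>\<^sub>F s in at_top. g s < a" by (auto simp: eventually_at_top_linorder)
  qed
  then show ?thesis ..
qed

text \<open>Here \<open>A\<close> stands for the transposed routing matrix, so that \<open>I - A\<close> is the reflection matrix, and
\<open>v = (I - A)\<inverse>1\<close>.\<close>

locale reflection =
  fixes A :: "real^'n^'n" and v :: "real^'n"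
  assumes A_nonneg: "0 \<le> A $ i $ j" and v_nonneg: "0 \<le> v" and v_eq: "v = 1 + A *v v"
begin

lemma A_mono: "x \<le> y \<Longrightarrow> A *v x \<le> A *v y"
  by (rule matrix_vector_mono[OF A_nonneg])

lemma A_mono_nth: "x \<le> y \<Longrightarrow> (A *v x) $ i \<le> (A *v y) $ i"
  using A_mono[of x y] by (simp add: less_eq_vec_def)

lemma A_v: "(A *v v) $ i = v $ i - 1"
  using arg_cong[OF v_eq, of "\<lambda>x. x $ i"] by simp

lemma v_ge_1: "1 \<le> v $ i"
  using A_v[of i] A_mono_nth[OF v_nonneg, of i] by simp

lemma inverse_positive: "A *v x \<le> x \<Longrightarrow> 0 \<le> x"
proof (rule inverse_positive_of_positive_vector[OF A_nonneg])
  show "0 < v $ i" for i using v_ge_1[of i] by simp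
  show "(A *v v) $ i < v $ i" for i by (simp add: A_v)
qed

text \<open>The contraction principle: whatever dominates a vector \<open>e\<close> by \<open>A e\<close> up to an error \<open>\<epsilon>\<close> makes
\<open>e\<close> of order \<open>\<epsilon>\<close>. It yields uniqueness (\<open>\<epsilon> = 0\<close>) and right continuity of the regulator.\<close>

lemma le_of_le_A_plus:
  assumes "\<And>i. e $ i \<le> (A *v e) $ i + \<epsilon>"
  shows "e $ i \<le> \<epsilon> * v $ i"
proof -
  have "A *v (\<epsilon> *\<^sub>R v - e) \<le> \<epsilon> *\<^sub>R v - e"
    unfolding less_eq_vec_def
  proof
    fix i show "(A *v (\<epsilon> *\<^sub>R v - e)) $ i \<le> (\<epsilon> *\<^sub>R v - e) $ i"
      using assms[of i] by (simp add: matrix_vector_mult_diff_distrib matrix_vector_mult_scaleR A_v algebra_simps)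
  qed
  from inverse_positive[OF this] show ?thesis by (simp add: less_eq_vec_def)
qed

text \<open>The fixed point equation \<open>L\<^sub>i(t) = sup\<^bsub>s\<le>t\<^esub> max(0, (A L - Y)\<^sub>i(s))\<close>, with the supremum expressed by its
universal property. Unlike an equation between suprema, this form carries the existence of the
supremum with it; that \<open>L\<close> is nondecreasing is a consequence.\<close>

definition is_regulator :: "(real \<Rightarrow> real^'n) \<Rightarrow> (real \<Rightarrow> real^'n) \<Rightarrow> bool" where
  "is_regulator Y L \<longleftrightarrow> (\<forall>t\<ge>0. \<forall>i c. L t $ i \<le> c \<longleftrightarrow>
     0 \<le> c \<and> (\<forall>s\<in>{0..t}. (A *v L s - Y s) $ i \<le> c))"

lemma regulator_le_iff:
  assumes "is_regulator Y L" "0 \<le> t"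
  shows "L t $ i \<le> c \<longleftrightarrow> 0 \<le> c \<and> (\<forall>s\<in>{0..t}. (A *v L s - Y s) $ i \<le> c)"
  using assms by (simp add: is_regulator_def)

lemma regulator_props:
  assumes L: "is_regulator Y L"
  shows "0 \<le> t \<Longrightarrow> 0 \<le> L t $ i"
    and "0 \<le> s \<Longrightarrow> s \<le> t \<Longrightarrow> (A *v L s) $ i - Y s $ i \<le> L t $ i"
    and "0 \<le> s \<Longrightarrow> s \<le> t \<Longrightarrow> L s $ i \<le> L t $ i"
proof -
  show "0 \<le> L t $ i" if "0 \<le> t" for t
    using regulator_le_iff[OF L that, of i "L t $ i"] by simp
  show "(A *v L s) $ i - Y s $ i \<le> L t $ i" if "0 \<le> s" "s \<le> t" for s t
    using regulator_le_iff[OF L, of t i "L t $ i"] that by auto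
  show "L s $ i \<le> L t $ i" if "0 \<le> s" "s \<le> t" for s t
    using regulator_le_iff[OF L, of t i "L t $ i"] regulator_le_iff[OF L, of s i "L t $ i"] that by auto
qed

text \<open>The regulator is the least nondecreasing nonnegative \<open>Z\<close> that keeps \<open>Y + (I - A) Z\<close> nonnegative:
the vector \<open>e\<close> of maximal excesses of \<open>L\<close> over \<open>Z\<close> satisfies \<open>e \<le> A e\<close>. Uniqueness is the case in
which \<open>Z\<close> solves the same equation.\<close>

lemma regulator_minimal:
  assumes L: "is_regulator Y L"
    and Z: "\<And>s. 0 \<le> s \<Longrightarrow> 0 \<le> Z s" "\<And>s t. 0 \<le> s \<Longrightarrow> s \<le> t \<Longrightarrow> Z s \<le> Z t"
      "\<And>s. 0 \<le> s \<Longrightarrow> A *v Z s - Y s \<le> Z s"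
    and t: "0 \<le> t"
  shows "L t \<le> Z t"
proof -
  define e where "e = (\<chi> i. SUP s\<in>{0..t}. max 0 (L s $ i - Z s $ i))"
  have bdd: "bdd_above ((\<lambda>s. max 0 (L s $ i - Z s $ i)) ` {0..t})" for i
  proof (rule bdd_aboveI2)
    fix s assume s: "s \<in> {0..t}"
    then have "L s $ i \<le> L t $ i" "0 \<le> Z s $ i" "0 \<le> L t $ i"
      using regulator_props[OF L] Z(1) by (auto simp: less_eq_vec_def)
    then show "max 0 (L s $ i - Z s $ i) \<le> L t $ i" by simp
  qed
  have le_e: "max 0 (L s $ i - Z s $ i) \<le> e $ i" if "s \<in> {0..t}" for s i
    unfolding e_def using cSUP_upper[OF that bdd] by simp
  have e0: "0 \<le> e" using le_e[of 0] t by (auto simp: less_eq_vec_def)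
  have "L s $ i \<le> Z s $ i + (A *v e) $ i" if s: "s \<in> {0..t}" for s i
  proof -
    have s0: "0 \<le> s" using s by simp
    show ?thesis
      unfolding regulator_le_iff[OF L s0]
    proof (intro conjI ballI)
      show "0 \<le> Z s $ i + (A *v e) $ i"
        using Z(1)[of s] A_mono_nth[OF e0, of i] s by (auto simp: less_eq_vec_def)
      fix r assume r: "r \<in> {0..s}"
      have "L r \<le> Z r + e"
        using le_e[of r] r s by (auto simp: less_eq_vec_def) (smt (verit))
      from A_mono_nth[OF this, of i] have "(A *v L r) $ i \<le> (A *v Z r) $ i + (A *v e) $ i"
        by (simp add: matrix_vector_right_distrib)
      moreover have "(A *v Z r) $ i - Y r $ i \<le> Z r $ i" using Z(3)[of r] r by (simp add: less_eq_vec_def)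
      moreover have "Z r $ i \<le> Z s $ i" using Z(2)[of r s] r s by (simp add: less_eq_vec_def)
      ultimately show "(A *v L r - Y r) $ i \<le> Z s $ i + (A *v e) $ i" by simp
    qed
  qed
  then have "max 0 (L s $ i - Z s $ i) \<le> (A *v e) $ i" if "s \<in> {0..t}" for s i
    using A_mono_nth[OF e0, of i] that by (simp add: algebra_simps)
  then have "(SUP s\<in>{0..t}. max 0 (L s $ i - Z s $ i)) \<le> (A *v e) $ i" for i
    using t by (intro cSUP_least) auto
  then have "e $ i \<le> (A *v e) $ i" for i
    by (subst e_def) simp
  then have "e $ i \<le> 0 * v $ i" for i by (intro le_of_le_A_plus) simp
  then show ?thesis using le_e[of t] t by (auto simp: less_eq_vec_def) (smt (verit))
qed

lemma regulator_unique:
  assumes L: "is_regulator Y L" and L': "is_regulator Y L'" and t: "0 \<le> t"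
  shows "L t = L' t"
proof (rule antisym)
  show "L t \<le> L' t"
    using regulator_props[OF L'] by (intro regulator_minimal[OF L _ _ _ t]) (auto simp: less_eq_vec_def)
  show "L' t \<le> L t"
    using regulator_props[OF L] by (intro regulator_minimal[OF L' _ _ _ t]) (auto simp: less_eq_vec_def)
qed

text \<open>Picard iteration from \<open>0\<close>; since the iterates increase, their supremum is the regulator.\<close>

fun iterate :: "(real \<Rightarrow> real^'n) \<Rightarrow> nat \<Rightarrow> real \<Rightarrow> real^'n" where
  "iterate Y 0 = (\<lambda>t. 0)"
| "iterate Y (Suc k) = (\<lambda>t. \<chi> i. running_max (\<lambda>s. (A *v iterate Y k s - Y s) $ i) t)"

definition regulator :: "(real \<Rightarrow> real^'n) \<Rightarrow> real \<Rightarrow> real^'n" where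
  "regulator Y t = (\<chi> i. SUP k. iterate Y k t $ i)"

text \<open>The bound \<open>B v\<close> is invariant under the iteration because \<open>A (B v) + B = B v\<close>.\<close>

lemma iterate_bounds:
  assumes B: "0 \<le> B" "\<And>s i. s \<in> {0..T} \<Longrightarrow> \<bar>Y s $ i\<bar> \<le> B" and s: "s \<in> {0..T}"
  shows "0 \<le> iterate Y k s" "iterate Y k s \<le> B *\<^sub>R v" "(A *v iterate Y k s - Y s) $ i \<le> B * v $ i"
proof -
  have step: "(A *v x - Y s) $ i \<le> B * v $ i" if "x \<le> B *\<^sub>R v" "s \<in> {0..T}" for x s i
    using A_mono_nth[OF that(1), of i] B(2)[OF that(2), of i]
    by (simp add: matrix_vector_mult_scaleR A_v algebra_simps)
  have *: "0 \<le> iterate Y k s \<and> iterate Y k s \<le> B *\<^sub>R v" if "s \<in> {0..T}" for s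
    using that
  proof (induction k arbitrary: s)
    case 0 then show ?case using B(1) v_nonneg by (auto simp: less_eq_vec_def)
  next
    case (Suc k)
    have le: "(A *v iterate Y k r - Y r) $ i \<le> B * v $ i" if "r \<in> {0..s}" for r i
      using step[of "iterate Y k r" r i] Suc.IH[of r] Suc.prems that by auto
    have "0 \<le> B * v $ i" for i using B(1) v_nonneg by (simp add: less_eq_vec_def)
    then have "0 \<le> running_max (\<lambda>r. (A *v iterate Y k r - Y r) $ i) s
      \<and> running_max (\<lambda>r. (A *v iterate Y k r - Y r) $ i) s \<le> B * v $ i" for i
      using running_max_le_iff[of s "\<lambda>r. (A *v iterate Y k r - Y r) $ i" "B * v $ i" "B * v $ i"]
        running_max_ge(1)[of s "\<lambda>r. (A *v iterate Y k r - Y r) $ i" "B * v $ i"] Suc.prems le by auto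
    then show ?case by (simp add: less_eq_vec_def)
  qed
  show "0 \<le> iterate Y k s" "iterate Y k s \<le> B *\<^sub>R v" "(A *v iterate Y k s - Y s) $ i \<le> B * v $ i"
    using *[OF s] step[OF _ s] by auto
qed

lemma iterate_Suc_le_iff:
  assumes Y: "locally_bounded Y" and t: "0 \<le> t"
  shows "iterate Y (Suc k) t $ i \<le> c \<longleftrightarrow> 0 \<le> c \<and> (\<forall>s\<in>{0..t}. (A *v iterate Y k s - Y s) $ i \<le> c)"
proof -
  obtain B where B: "0 \<le> B" "\<And>s i. s \<in> {0..t} \<Longrightarrow> \<bar>Y s $ i\<bar> \<le> B"
    using locally_boundedE[OF Y] by blast
  show ?thesis
    using running_max_le_iff[of t "\<lambda>s. (A *v iterate Y k s - Y s) $ i" "B * v $ i", OF t iterate_bounds(3)[of B t Y, OF B]]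
    by simp
qed

lemma iterate_mono:
  assumes Y: "locally_bounded Y" and t: "0 \<le> t"
  shows "iterate Y k t \<le> iterate Y (Suc k) t"
  using t
proof (induction k arbitrary: t)
  case 0
  obtain B where B: "0 \<le> B" "\<And>s i. s \<in> {0..t} \<Longrightarrow> \<bar>Y s $ i\<bar> \<le> B"
    using locally_boundedE[OF Y] by blast
  show ?case using iterate_bounds(1)[of B t Y t "Suc 0", OF B] 0 by simp
next
  case (Suc k)
  have "iterate Y (Suc k) t $ i \<le> iterate Y (Suc (Suc k)) t $ i" for i
    unfolding iterate_Suc_le_iff[OF Y Suc.prems]
  proof (intro conjI ballI)
    have *: "0 \<le> iterate Y (Suc (Suc k)) t $ i \<and>
      (\<forall>s\<in>{0..t}. (A *v iterate Y (Suc k) s - Y s) $ i \<le> iterate Y (Suc (Suc k)) t $ i)"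
      using iterate_Suc_le_iff[OF Y Suc.prems, of "Suc k" i "iterate Y (Suc (Suc k)) t $ i"] by blast
    then show "0 \<le> iterate Y (Suc (Suc k)) t $ i" by blast
    fix s assume s: "s \<in> {0..t}"
    then have "(A *v iterate Y k s) $ i \<le> (A *v iterate Y (Suc k) s) $ i"
      by (intro A_mono_nth Suc.IH) simp
    then show "(A *v iterate Y k s - Y s) $ i \<le> iterate Y (Suc (Suc k)) t $ i"
      using * s by fastforce
  qed
  then show ?case by (simp add: less_eq_vec_def)
qed

lemma iterate_tendsto:
  assumes Y: "locally_bounded Y" and t: "0 \<le> t"
  shows "(\<lambda>k. iterate Y k t) \<longlonglongrightarrow> regulator Y t" and "iterate Y k t \<le> regulator Y t"
proof -
  obtain B where B: "0 \<le> B" "\<And>s i. s \<in> {0..t} \<Longrightarrow> \<bar>Y s $ i\<bar> \<le> B"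
    using locally_boundedE[OF Y] by blast
  have bdd: "bdd_above (range (\<lambda>k. iterate Y k t $ i))" for i
    using iterate_bounds(2)[of B t Y t, OF B] t by (intro bdd_aboveI2[of _ _ "B * v $ i"]) (auto simp: less_eq_vec_def)
  have inc: "incseq (\<lambda>k. iterate Y k t $ i)" for i
    using iterate_mono[OF Y t] by (intro incseq_SucI) (auto simp: less_eq_vec_def)
  have "(\<lambda>k. iterate Y k t $ i) \<longlonglongrightarrow> regulator Y t $ i" for i
    unfolding regulator_def using LIMSEQ_incseq_SUP[OF bdd inc] by simp
  then show "(\<lambda>k. iterate Y k t) \<longlonglongrightarrow> regulator Y t" by (rule vec_tendstoI)
  show "iterate Y k t \<le> regulator Y t"
    unfolding less_eq_vec_def regulator_def by (auto intro!: cSUP_upper bdd)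
qed

lemma is_regulator_regulator:
  assumes Y: "locally_bounded Y"
  shows "is_regulator Y (regulator Y)"
  unfolding is_regulator_def
proof (intro allI impI iffI)
  fix t i c assume t: "0 \<le> (t::real)"
  { assume le: "regulator Y t $ i \<le> c"
    have it: "iterate Y k t $ i \<le> c" for k
      using iterate_tendsto(2)[OF Y t, of k] le by (auto simp: less_eq_vec_def intro: order_trans)
    have "(A *v regulator Y s - Y s) $ i \<le> c" if s: "s \<in> {0..t}" for s
    proof (rule LIMSEQ_le_const2)
      show "(\<lambda>k. (A *v iterate Y k s - Y s) $ i) \<longlonglongrightarrow> (A *v regulator Y s - Y s) $ i"
        using s by (intro tendsto_intros tendsto_vec_nth
            tendsto_matrix_vector iterate_tendsto(1)[OF Y]) auto
      show "\<exists>N. \<forall>k\<ge>N. (A *v iterate Y k s - Y s) $ i \<le> c"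
        using it[of "Suc _"] iterate_Suc_le_iff[OF Y t] s by blast
    qed
    moreover have "0 \<le> c" using it[of "Suc 0"] iterate_Suc_le_iff[OF Y t] by blast
    ultimately show "0 \<le> c \<and> (\<forall>s\<in>{0..t}. (A *v regulator Y s - Y s) $ i \<le> c)" by blast }
  { assume c: "0 \<le> c \<and> (\<forall>s\<in>{0..t}. (A *v regulator Y s - Y s) $ i \<le> c)"
    have "iterate Y k t $ i \<le> c" for k
    proof (cases k)
      case 0 then show ?thesis using c by simp
    next
      case (Suc k')
      have "(A *v iterate Y k' s - Y s) $ i \<le> c" if s: "s \<in> {0..t}" for s
      proof -
        have "(A *v iterate Y k' s) $ i \<le> (A *v regulator Y s) $ i"
          using s by (intro A_mono_nth iterate_tendsto(2)[OF Y]) auto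
        then show ?thesis using c s by fastforce
      qed
      then show ?thesis using c Suc iterate_Suc_le_iff[OF Y t] by blast
    qed
    then show "regulator Y t $ i \<le> c"
      using tendsto_vec_nth[OF iterate_tendsto(1)[OF Y t], of i] by (intro LIMSEQ_le_const2) auto }
qed

definition reflect :: "(real \<Rightarrow> real^'n) \<Rightarrow> real \<Rightarrow> real^'n" where
  "reflect Y t = Y t + regulator Y t - A *v regulator Y t"

lemma regulator_eqI:
  assumes "locally_bounded Y" "is_regulator Y L" "0 \<le> t"
  shows "regulator Y t = L t"
  using regulator_unique[OF is_regulator_regulator] assms by blast

lemma reflect_nonneg:
  assumes "locally_bounded Y" "0 \<le> t"
  shows "0 \<le> reflect Y t"
  using regulator_props(2)[OF is_regulator_regulator, of Y t t] assms
  by (auto simp: less_eq_vec_def reflect_def algebra_simps)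

text \<open>Just after \<open>t\<close> the increment \<open>e\<close> of the regulator satisfies \<open>e \<le> A e + \<epsilon>\<close>, where \<open>\<epsilon>\<close> bounds the
oscillation of \<open>Y\<close>; hence \<open>e \<le> \<epsilon> v\<close>.\<close>

lemma regulator_right_continuous:
  assumes L: "is_regulator Y L" and t: "0 \<le> t" and Y: "(Y \<longlongrightarrow> Y t) (at_right t)"
  shows "(L \<longlongrightarrow> L t) (at_right t)"
proof (rule vec_tendstoI)
  fix i
  show "((\<lambda>s. L s $ i) \<longlongrightarrow> L t $ i) (at_right t)"
  proof (rule tendstoI)
    fix e :: real assume e: "0 < e"
    define \<epsilon> where "\<epsilon> = e / (2 * v $ i)"
    have v: "0 < v $ i" using v_ge_1[of i] by simp
    have \<epsilon>: "0 < \<epsilon>" "\<epsilon> * v $ i < e" using e v by (auto simp: \<epsilon>_def)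
    have "\<forall>\<^sub>F s in at_right t. dist (Y s) (Y t) < \<epsilon>" using tendstoD[OF Y \<epsilon>(1)] .
    then obtain b where b: "t < b" "\<And>s. t < s \<Longrightarrow> s < b \<Longrightarrow> dist (Y s) (Y t) < \<epsilon>"
      by (auto simp: eventually_at_right[of t "t + 1"])
    have "dist (L s $ i) (L t $ i) < e" if s: "t < s" "s < b" for s
    proof -
      have "(L s - L t) $ j \<le> (A *v (L s - L t)) $ j + \<epsilon>" for j
      proof -
        define c where "c = L t $ j + ((A *v (L s - L t)) $ j + \<epsilon>)"
        have Lts: "L t \<le> L s" using regulator_props(3)[OF L t] s by (simp add: less_eq_vec_def)
        then have "0 \<le> (A *v (L s - L t)) $ j"
          using A_mono_nth[of 0 "L s - L t" j] by simp
        then have c: "L t $ j \<le> c" using \<epsilon> by (simp add: c_def)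
        have "(A *v L r - Y r) $ j \<le> c" if r: "r \<in> {0..s}" for r
        proof (cases "r \<le> t")
          case True
          then show ?thesis using regulator_props(2)[OF L, of r t j] r c by simp
        next
          case False
          have "L r \<le> L s" using regulator_props(3)[OF L, of r s] r by (simp add: less_eq_vec_def)
          then have "(A *v L r) $ j \<le> (A *v L s) $ j" by (rule A_mono_nth)
          moreover have "norm ((Y r - Y t)) < \<epsilon>" using b(2)[of r] False r s by (simp add: dist_norm)
          then have "\<bar>Y r $ j - Y t $ j\<bar> < \<epsilon>" using component_le_norm_cart[of "Y r - Y t" j] by simp
          moreover have "(A *v L t) $ j - Y t $ j \<le> L t $ j" using regulator_props(2)[OF L t] by simp
          ultimately show ?thesis unfolding c_def by (simp add: matrix_vector_mult_diff_distrib)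
        qed
        moreover have "0 \<le> c" using c regulator_props(1)[OF L t, of j] by simp
        ultimately have "L s $ j \<le> c" using regulator_le_iff[OF L, of s j c] t s by auto
        then show ?thesis by (simp add: c_def)
      qed
      then have "(L s - L t) $ i \<le> \<epsilon> * v $ i" by (rule le_of_le_A_plus)
      moreover have "L t $ i \<le> L s $ i" using regulator_props(3)[OF L t] s by simp
      ultimately show ?thesis using \<epsilon>(2) by (simp add: dist_real_def)
    qed
    then show "\<forall>\<^sub>F s in at_right t. dist (L s $ i) (L t $ i) < e"
      using b(1) by (auto simp: eventually_at_right[of t "t + 1"])
  qed
qed

text \<open>Flow property: the regulator after time \<open>s\<close>, minus its value at \<open>s\<close>, solves the fixed point
equation of the path that starts from the reflected position at time \<open>s\<close>.\<close>

lemma regulator_restart: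
  assumes Y: "locally_bounded Y" and s: "0 \<le> s" and u: "0 \<le> u"
    and Y': "\<And>u. 0 \<le> u \<Longrightarrow> Y' u = reflect Y s + (Y (s + u) - Y s)"
  shows "locally_bounded Y'"
    and "regulator Y (s + u) = regulator Y s + regulator Y' u"
    and "reflect Y (s + u) = reflect Y' u"
proof -
  show lb: "locally_bounded Y'"
    unfolding locally_bounded_def
  proof
    fix T
    obtain B where B: "0 \<le> B" "\<And>r i. r \<in> {0..s+T} \<Longrightarrow> \<bar>Y r $ i\<bar> \<le> B"
      using locally_boundedE[OF Y] by blast
    have "\<bar>Y' r $ i\<bar> \<le> norm (reflect Y s) + 2 * B" if "r \<in> {0..T}" for r i
      using B(2)[of "s + r" i] B(2)[of s i] component_le_norm_cart[of "reflect Y s" i] that s by (simp add: Y')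
    then show "\<exists>B. \<forall>s\<in>{0..T}. \<forall>i. \<bar>Y' s $ i\<bar> \<le> B" by blast
  qed
  define L where "L = regulator Y"
  have L: "is_regulator Y L" unfolding L_def by (rule is_regulator_regulator[OF Y])
  have "is_regulator Y' (\<lambda>u. L (s + u) - L s)"
    unfolding is_regulator_def
  proof (intro allI impI)
    fix u i c assume u: "0 \<le> (u::real)"
    have eq: "(A *v (L (s + r) - L s) - Y' r) $ i = (A *v L (s + r) - Y (s + r)) $ i - L s $ i" if "0 \<le> r" for r
      by (simp add: Y'[OF that] reflect_def L_def matrix_vector_mult_diff_distrib)
    have "(L (s + u) - L s) $ i \<le> c \<longleftrightarrow> L (s + u) $ i \<le> L s $ i + c" by auto
    also have "\<dots> \<longleftrightarrow> 0 \<le> L s $ i + c \<and> (\<forall>r\<in>{0..s+u}. (A *v L r - Y r) $ i \<le> L s $ i + c)"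
      using regulator_le_iff[OF L, of "s + u" i "L s $ i + c"] s u by simp
    also have "\<dots> \<longleftrightarrow> 0 \<le> c \<and> (\<forall>r\<in>{0..u}. (A *v L (s + r) - Y (s + r)) $ i \<le> L s $ i + c)"
    proof safe
      assume a: "0 \<le> L s $ i + c" "\<forall>r\<in>{0..s+u}. (A *v L r - Y r) $ i \<le> L s $ i + c"
      then have "L s $ i \<le> L s $ i + c" using regulator_le_iff[OF L s, of i "L s $ i + c"] u by auto
      then show "0 \<le> c" by simp
      show "(A *v L (s + r) - Y (s + r)) $ i \<le> L s $ i + c" if "r \<in> {0..u}" for r
        using a(2) that s by auto
    next
      assume a: "0 \<le> c" "\<forall>r\<in>{0..u}. (A *v L (s + r) - Y (s + r)) $ i \<le> L s $ i + c"
      then show "0 \<le> L s $ i + c" using regulator_props(1)[OF L s, of i] by simp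
      fix r assume r: "r \<in> {0..s+u}"
      show "(A *v L r - Y r) $ i \<le> L s $ i + c"
      proof (cases "r \<le> s")
        case True
        then show ?thesis using regulator_props(2)[OF L, of r s i] r a(1) by simp
      next
        case False
        then show ?thesis using a(2)[rule_format, of "r - s"] r by auto
      qed
    qed
    also have "\<dots> \<longleftrightarrow> 0 \<le> c \<and> (\<forall>r\<in>{0..u}. (A *v (L (s + r) - L s) - Y' r) $ i \<le> c)"
      using eq by (auto simp del: vector_minus_component)
    finally show "(L (s + u) - L s) $ i \<le> c \<longleftrightarrow>
      0 \<le> c \<and> (\<forall>r\<in>{0..u}. (A *v (L (s + r) - L s) - Y' r) $ i \<le> c)" .
  qed
  from regulator_eqI[OF lb this u] show r: "regulator Y (s + u) = regulator Y s + regulator Y' u"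
    by (simp add: L_def)
  show "reflect Y (s + u) = reflect Y' u"
    using Y'[OF u] by (simp add: reflect_def r matrix_vector_right_distrib)
qed

section \<open>Monotonicity, loss of memory and a Lyapunov bound\<close>

text \<open>A larger initial position reduces all increments of the regulator and increases the reflected
path. Along the Picard iteration the differences \<open>G k\<close> of the iterates stay nonnegative and
nondecreasing, since \<open>a + A G k\<close> is then the additional input of the one-dimensional problems
in the next step.\<close>

lemma reflection_monotone:
  assumes Y: "locally_bounded Y" and a: "0 \<le> a" and st: "0 \<le> s" "s \<le> t"
  shows "regulator (\<lambda>r. a + Y r) t - regulator (\<lambda>r. a + Y r) s \<le> regulator Y t - regulator Y s"
    and "regulator (\<lambda>r. a + Y r) s \<le> regulator Y s"
    and "reflect Y s \<le> reflect (\<lambda>r. a + Y r) s"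
proof -
  let ?Y' = "\<lambda>r. a + Y r"
  have Y': "locally_bounded ?Y'" by (rule locally_bounded_add_const[OF Y])
  define G where "G k r = iterate Y k r - iterate ?Y' k r" for k r
  have step: "G (Suc k) s \<le> G (Suc k) t \<and> 0 \<le> G (Suc k) s \<and> G (Suc k) s \<le> a + A *v G k s"
    if IH: "\<And>s t. 0 \<le> s \<Longrightarrow> s \<le> t \<Longrightarrow> G k s \<le> G k t \<and> 0 \<le> G k s" and st: "0 \<le> s" "s \<le> t" for k s t
  proof -
    obtain B where B: "0 \<le> B" "\<And>s i. s \<in> {0..t} \<Longrightarrow> \<bar>Y s $ i\<bar> \<le> B"
      using locally_boundedE[OF Y] by blast
    have "G (Suc k) s $ i \<le> G (Suc k) t $ i \<and> 0 \<le> G (Suc k) s $ i \<and> G (Suc k) s $ i \<le> (a + A *v G k s) $ i" for i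
    proof -
      let ?f = "\<lambda>s. (A *v iterate Y k s - Y s) $ i"
      let ?f' = "\<lambda>s. (A *v iterate ?Y' k s - ?Y' s) $ i"
      let ?\<delta> = "\<lambda>s. (a + A *v G k s) $ i"
      have 1: "?f r \<le> B * v $ i" if "r \<in> {0..t}" for r using iterate_bounds(3)[of B t Y r k i, OF B that] by simp
      have 2: "?f' r = ?f r - ?\<delta> r" for r by (simp add: G_def matrix_vector_mult_diff_distrib)
      have 3: "0 \<le> ?\<delta> r" if "r \<in> {0..t}" for r
        using A_mono_nth[of 0 "G k r" i] IH[of r t] a that by (simp add: less_eq_vec_def)
      have 4: "?\<delta> r \<le> ?\<delta> u" if "0 \<le> r" "r \<le> u" "u \<le> t" for r u
        using A_mono_nth[of "G k r" "G k u" i] IH[of r u] that by simp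
      from running_max_subtract_monotone[of t ?f _ ?f' ?\<delta>, OF 1 2 3 4 st]
      show ?thesis by (simp add: G_def)
    qed
    then show ?thesis by (simp add: less_eq_vec_def)
  qed
  have mono: "G k s \<le> G k t \<and> 0 \<le> G k s" if "0 \<le> s" "s \<le> t" for k s t
    using that
  proof (induction k arbitrary: s t)
    case 0 then show ?case by (simp add: G_def)
  next
    case (Suc k)
    from step[OF Suc.IH Suc.prems] show ?case by blast
  qed
  have bound: "G (Suc k) s \<le> a + A *v G k s" for k
    using step[OF mono st] by blast
  define H where "H r = regulator Y r - regulator ?Y' r" for r
  have lim: "(\<lambda>k. G k r) \<longlonglongrightarrow> H r" if "0 \<le> r" for r
    unfolding G_def H_def by (intro tendsto_diff iterate_tendsto(1) Y Y' that)
  have "H s $ i \<le> H t $ i" "0 \<le> H s $ i" "H s $ i \<le> (a + A *v H s) $ i" for i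
  proof -
    have t: "0 \<le> t" using st by simp
    note l = tendsto_vec_nth[OF lim, of _ i]
    show "H s $ i \<le> H t $ i"
      by (rule LIMSEQ_le[OF l[OF st(1)] l[OF t]]) (use mono[OF st] in \<open>auto simp: less_eq_vec_def\<close>)
    show "0 \<le> H s $ i"
      by (rule LIMSEQ_le_const[OF l[OF st(1)]]) (use mono[OF st] in \<open>auto simp: less_eq_vec_def\<close>)
    have "(\<lambda>k. (a + A *v G k s) $ i) \<longlonglongrightarrow> (a + A *v H s) $ i"
      by (intro tendsto_vec_nth tendsto_add tendsto_const
          tendsto_matrix_vector lim st)
    from LIMSEQ_le[OF LIMSEQ_Suc[OF l[OF st(1)]] this]
    show "H s $ i \<le> (a + A *v H s) $ i" using bound by (auto simp: less_eq_vec_def)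
  qed
  then show "regulator ?Y' t - regulator ?Y' s \<le> regulator Y t - regulator Y s"
    and "regulator ?Y' s \<le> regulator Y s" and "reflect Y s \<le> reflect ?Y' s"
    by (auto simp: less_eq_vec_def H_def reflect_def matrix_vector_mult_diff_distrib algebra_simps)
qed

text \<open>By minimality: \<open>K v\<close> added once to the regulator makes up for the removal of the initial
position \<open>a\<close>.\<close>

lemma regulator_shift_upper:
  assumes Y: "locally_bounded Y" and a: "\<And>i. a $ i \<le> K" and K: "0 \<le> K" and t: "0 \<le> t"
  shows "regulator Y t $ i \<le> regulator (\<lambda>r. a + Y r) t $ i + K * v $ i"
proof -
  let ?Y' = "\<lambda>r. a + Y r"
  have Y': "is_regulator ?Y' (regulator ?Y')"
    by (intro is_regulator_regulator locally_bounded_add_const Y)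
  define Z where "Z r = regulator ?Y' r + K *\<^sub>R v" for r
  have "regulator Y t \<le> Z t"
  proof (rule regulator_minimal[OF is_regulator_regulator[OF Y] _ _ _ t])
    show "0 \<le> Z s" if "0 \<le> s" for s
      using regulator_props(1)[OF Y' that] K v_nonneg by (simp add: less_eq_vec_def Z_def)
    show "Z s \<le> Z r" if "0 \<le> s" "s \<le> r" for s r
      using regulator_props(3)[OF Y' that] by (simp add: less_eq_vec_def Z_def)
    show "A *v Z s - Y s \<le> Z s" if "0 \<le> s" for s
      unfolding less_eq_vec_def
    proof
      fix j
      show "(A *v Z s - Y s) $ j \<le> Z s $ j"
        using regulator_props(2)[OF Y' that, of s j] a[of j]
        by (simp add: Z_def matrix_vector_right_distrib matrix_vector_mult_scaleR A_v algebra_simps)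
    qed
  qed
  then show ?thesis by (simp add: less_eq_vec_def Z_def)
qed

lemma reflect_initial_lipschitz:
  assumes Y: "locally_bounded Y" and a: "0 \<le> a" and t: "0 \<le> t"
  shows "\<bar>reflect (\<lambda>r. a + Y r) t $ i - reflect Y t $ i\<bar> \<le> 2 * v $ i * norm a"
proof -
  define H where "H = regulator Y t - regulator (\<lambda>r. a + Y r) t"
  have le: "a $ j \<le> norm a" for j using component_le_norm_cart[of a j] by linarith
  have H0: "0 \<le> H" using reflection_monotone(2)[OF Y a t order_refl] by (simp add: H_def)
  have H1: "H \<le> norm a *\<^sub>R v"
    using regulator_shift_upper[OF Y le norm_ge_zero t]
    by (auto simp: less_eq_vec_def H_def algebra_simps)
  have "reflect (\<lambda>r. a + Y r) t $ i - reflect Y t $ i = a $ i - H $ i + (A *v H) $ i"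
    by (simp add: reflect_def H_def matrix_vector_mult_diff_distrib)
  moreover have "0 \<le> (A *v H) $ i" "(A *v H) $ i \<le> norm a * (v $ i - 1)"
    using A_mono_nth[OF H0, of i] A_mono_nth[OF H1, of i] by (simp_all add: matrix_vector_mult_scaleR A_v)
  moreover have "0 \<le> H $ i" "H $ i \<le> norm a * v $ i" "0 \<le> a $ i" "a $ i \<le> norm a"
    using H0 H1 a le[of i] by (auto simp: less_eq_vec_def)
  moreover have "0 \<le> norm a * (v $ i - 1)" using v_ge_1[of i] by simp
  ultimately show ?thesis by (simp add: algebra_simps abs_le_iff)
qed

text \<open>If the regulator had increased between \<open>T\<close> and \<open>t\<close>, the supremum defining \<open>L\<^sub>i(t)\<close> would be
approached at times after \<open>T\<close>, and the reflected path would be nearly zero there.\<close>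

lemma regulator_constant_while_positive:
  assumes L: "is_regulator Y L" and T: "0 \<le> T" "T \<le> t" and \<epsilon>: "0 < \<epsilon>"
    and big: "\<And>s. T < s \<Longrightarrow> s \<le> t \<Longrightarrow> \<epsilon> \<le> (Y s + L s - A *v L s) $ i"
  shows "L t $ i = L T $ i"
proof (rule antisym)
  have t: "0 \<le> t" using T by simp
  define c where "c = max (L T $ i) (L t $ i - \<epsilon>)"
  have "(A *v L s - Y s) $ i \<le> c" if s: "s \<in> {0..t}" for s
  proof (cases "s \<le> T")
    case True
    then show ?thesis using regulator_props(2)[OF L, of s T i] s by (simp add: c_def)
  next
    case False
    then have "(A *v L s - Y s) $ i \<le> L s $ i - \<epsilon>" using big[of s] s by simp
    also have "L s $ i \<le> L t $ i" using regulator_props(3)[OF L] s by auto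
    finally show ?thesis by (simp add: c_def)
  qed
  moreover have "0 \<le> c" using regulator_props(1)[OF L T(1), of i] by (simp add: c_def)
  ultimately have "L t $ i \<le> c" using regulator_le_iff[OF L t] by blast
  then show "L t $ i \<le> L T $ i" using \<epsilon> by (auto simp: c_def)
  show "L T $ i \<le> L t $ i" by (rule regulator_props(3)[OF L T])
qed

lemma reflect_small_infinitely_often:
  assumes Y: "locally_bounded Y" and unb: "\<And>K. \<exists>t\<ge>0. K \<le> regulator Y t $ i"
    and T: "0 \<le> T" and \<epsilon>: "0 < \<epsilon>"
  shows "\<exists>t\<ge>T. reflect Y t $ i < \<epsilon>"
proof (rule ccontr)
  assume "\<not> (\<exists>t\<ge>T. reflect Y t $ i < \<epsilon>)"
  then have big: "\<epsilon> \<le> reflect Y t $ i" if "T \<le> t" for t using that by (meson not_less)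
  note L = is_regulator_regulator[OF Y]
  obtain t where t: "t \<ge> 0" "regulator Y T $ i + 1 \<le> regulator Y t $ i" using unb by blast
  have "T \<le> t" using regulator_props(3)[OF L t(1), of T i] t(2) by (cases "T \<le> t") auto
  then have "regulator Y t $ i = regulator Y T $ i"
    using big by (intro regulator_constant_while_positive[OF L T _ \<epsilon>]) (auto simp: reflect_def)
  then show False using t(2) by simp
qed

text \<open>Loss of memory. The difference \<open>G\<close> of the two regulators is nondecreasing and bounded, so it
converges, and with it the difference of the reflected paths; let \<open>c \<ge> 0\<close> be the limit of the
latter. The upper path has a regulator that grows without bound, so each of its coordinates
returns near zero at arbitrarily late times. There it cannot exceed the lower, nonnegative path
by \<open>c\<^sub>i / 2\<close>, so \<open>c = 0\<close>.\<close>

lemma reflect_forgets_initial_condition: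
  assumes Y: "locally_bounded Y" and a: "0 \<le> a"
    and unb: "\<And>i K. \<exists>t\<ge>0. K \<le> regulator Y t $ i"
  shows "((\<lambda>t. reflect (\<lambda>r. a + Y r) t - reflect Y t) \<longlongrightarrow> 0) at_top"
proof -
  let ?Y' = "\<lambda>r. a + Y r"
  define G where "G t = regulator Y t - regulator ?Y' t" for t
  have le: "a $ j \<le> norm a" for j using component_le_norm_cart[of a j] by linarith
  have G_le: "G t $ i \<le> norm a * v $ i" if "0 \<le> t" for t i
    using regulator_shift_upper[OF Y le norm_ge_zero that] by (simp add: G_def algebra_simps)
  have "\<exists>l. ((\<lambda>t. G t $ i) \<longlongrightarrow> l) at_top" for i
  proof (rule increasing_bounded_tendsto_at_top)
    show "G s $ i \<le> G t $ i" if "0 \<le> s" "s \<le> t" for s t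
      using reflection_monotone(1)[OF Y a that] by (auto simp: less_eq_vec_def G_def algebra_simps)
    show "G t $ i \<le> norm a * v $ i" if "0 \<le> t" for t by (rule G_le[OF that])
  qed
  then obtain l where l: "\<And>i. ((\<lambda>t. G t $ i) \<longlongrightarrow> l i) at_top" by metis
  then have G: "(G \<longlongrightarrow> (\<chi> i. l i)) at_top" by (intro vec_tendstoI) simp
  define c where "c = a - (\<chi> i. l i) + A *v (\<chi> i. l i)"
  have "(\<lambda>t. reflect ?Y' t - reflect Y t) = (\<lambda>t. a - G t + A *v G t)"
    by (auto simp: reflect_def G_def matrix_vector_mult_diff_distrib)
  moreover have "((\<lambda>t. a - G t + A *v G t) \<longlongrightarrow> c) at_top"
    unfolding c_def by (intro tendsto_intros G tendsto_matrix_vector)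
  ultimately have lim: "((\<lambda>t. reflect ?Y' t - reflect Y t) \<longlongrightarrow> c) at_top" by simp
  have "c $ i = 0" for i
  proof (rule antisym)
    note limi = tendsto_vec_nth[OF lim, of i]
    have "0 \<le> (reflect ?Y' t - reflect Y t) $ i" if "0 \<le> t" for t
      using reflection_monotone(3)[OF Y a that order_refl] by (simp add: less_eq_vec_def)
    then show "0 \<le> c $ i"
      by (intro tendsto_lowerbound[OF limi]) (auto intro: eventually_at_top_linorderI[of 0])
    show "c $ i \<le> 0"
    proof (rule ccontr)
      assume "\<not> c $ i \<le> 0"
      then have pos: "c $ i / 2 < c $ i" "0 < c $ i / 2" by auto
      from order_tendstoD(1)[OF limi pos(1)] obtain T where
        T: "\<And>t. T \<le> t \<Longrightarrow> c $ i / 2 < (reflect ?Y' t - reflect Y t) $ i"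
        by (auto simp: eventually_at_top_linorder)
      have unb': "\<exists>t\<ge>0. K \<le> regulator ?Y' t $ i" for K
      proof -
        obtain t where "0 \<le> t" "K + norm a * v $ i \<le> regulator Y t $ i" using unb by blast
        then show ?thesis using G_le[of t i] by (intro exI[of _ t]) (simp add: G_def)
      qed
      obtain t where t: "max 0 T \<le> t" "reflect ?Y' t $ i < c $ i / 2"
        using reflect_small_infinitely_often[OF locally_bounded_add_const[OF Y] unb', of "max 0 T" "c $ i / 2"] pos
        by auto
      moreover have "0 \<le> reflect Y t $ i"
        using reflect_nonneg[OF Y, of t] t(1) by (simp add: less_eq_vec_def)
      ultimately show False using T[of t] by simp
    qed
  qed
  then have "c = 0" by (simp add: vec_eq_iff)
  then show ?thesis using lim by simp
qed

text \<open>The function \<open>max\<^sub>i D\<^sub>i / v\<^sub>i\<close> of \<open>D = (I - A)\<inverse>W\<close> is a Lyapunov function with strictly negative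
drift. Without reflection \<open>D\<close> would follow the free path \<open>V\<close>, whose drift is \<open>-d\<close>. The regulator
of coordinate \<open>i\<close> acts only when \<open>W\<^sub>i = 0\<close>, that is when \<open>D\<^sub>i = (A D)\<^sub>i \<le> (v\<^sub>i - 1) max\<^sub>j D\<^sub>j / v\<^sub>j\<close>,
and then \<open>D\<^sub>i / v\<^sub>i\<close> is smaller than the maximum by the factor \<open>\<rho> < 1\<close>.

The hypothesis \<open>dev\<close> states that, seen backwards from \<open>T\<close>, the path \<open>V\<close> deviates from its drift
by at most \<open>C\<close> plus a small multiple of the elapsed time. The bound is then uniform in \<open>T\<close>.
To close the argument without iterating over the previous reflection times, the Lyapunov function
is discounted by \<open>\<kappa> (T - s)\<close>: its supremum \<open>\<phi>\<close> over the past satisfies \<open>\<phi> \<le> \<rho> \<phi> + 2 C\<close>.\<close>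

lemma reflect_drift_bound:
  assumes Y: "locally_bounded Y" and T: "0 \<le> T"
    and V: "\<And>s. s \<in> {0..T} \<Longrightarrow> Y s = V s - A *v V s" and V0: "V 0 = 0"
    and c: "0 < c" and d: "\<And>i. c * v $ i \<le> d $ i"
    and \<rho>: "0 \<le> \<rho>" "\<rho> < 1" "\<And>i. v $ i - 1 \<le> \<rho> * v $ i"
    and C: "0 \<le> C"
    and dev: "\<And>i s. s \<in> {0..T} \<Longrightarrow>
      \<bar>V T $ i - V s $ i + d $ i * (T - s)\<bar> \<le> (1 - \<rho>) * c / 4 * (T - s) + C"
  shows "reflect Y T $ i \<le> v $ i * (2 * C / (1 - \<rho>))"
proof -
  define \<epsilon> where "\<epsilon> = (1 - \<rho>) * c / 4"
  define \<kappa> where "\<kappa> = c / 2"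
  have \<epsilon>: "0 < \<epsilon>" using \<rho> c by (simp add: \<epsilon>_def)
  have dev': "\<bar>V T $ i - V s $ i + d $ i * (T - s)\<bar> \<le> \<epsilon> * (T - s) + C" if "s \<in> {0..T}" for i s
    using dev[OF that] by (simp add: \<epsilon>_def)
  \<comment> \<open>The two inequalities that force the choices \<open>\<kappa> = c / 2\<close> and \<open>\<epsilon> = (1 - \<rho>) c / 4\<close>.\<close>
  have k1: "\<rho> * \<kappa> + \<epsilon> \<le> c" and k2: "\<rho> * \<kappa> + 2 * \<epsilon> \<le> \<kappa>"
  proof -
    have "\<rho> * c \<le> 1 * c" using \<rho> c by (intro mult_right_mono) auto
    moreover have "0 \<le> \<rho> * c" using \<rho> c by simp
    ultimately show "\<rho> * \<kappa> + \<epsilon> \<le> c" using c by (simp add: \<kappa>_def \<epsilon>_def field_simps)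
    show "\<rho> * \<kappa> + 2 * \<epsilon> \<le> \<kappa>" by (simp add: \<kappa>_def \<epsilon>_def field_simps)
  qed
  note L = is_regulator_regulator[OF Y]
  define D where "D s = V s + regulator Y s" for s
  have W: "reflect Y s = D s - A *v D s" if "s \<in> {0..T}" for s
    by (simp add: reflect_def D_def V[OF that] matrix_vector_right_distrib)
  have AD: "A *v D s \<le> D s" if "s \<in> {0..T}" for s
    using reflect_nonneg[OF Y, of s] W[OF that] that by simp
  then have D0: "0 \<le> D s" if "s \<in> {0..T}" for s using inverse_positive that by blast
  define F where "F p = D (snd p) $ fst p / v $ fst p - \<kappa> * (T - snd p)" for p
  define \<phi> where "\<phi> = (SUP p\<in>UNIV \<times> {0..T}. F p)"
  have vpos: "0 < v $ i" for i using v_ge_1[of i] by simp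
  have bdd: "bdd_above (F ` (UNIV \<times> {0..T}))"
  proof -
    define B where "B = (\<Sum>i\<in>UNIV. \<bar>V T $ i\<bar> + d $ i * T + \<epsilon> * T + C + regulator Y T $ i)"
    have d0: "0 \<le> d $ i" for i using d[of i] c vpos[of i] by (smt (verit) mult_pos_pos)
    have "F (i, s) \<le> B" if s: "s \<in> {0..T}" for i s
    proof -
      have "V s $ i \<le> \<bar>V T $ i\<bar> + d $ i * T + \<epsilon> * T + C"
      proof -
        have "d $ i * (T - s) \<le> d $ i * T" "\<epsilon> * (T - s) \<le> \<epsilon> * T"
          using d0[of i] \<epsilon> s by (auto intro!: mult_left_mono)
        then show ?thesis using dev'[OF s, of i] by simp
      qed
      moreover have "regulator Y s $ i \<le> regulator Y T $ i" using regulator_props(3)[OF L] s by auto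
      ultimately have "D s $ i \<le> \<bar>V T $ i\<bar> + d $ i * T + \<epsilon> * T + C + regulator Y T $ i"
        by (simp add: D_def)
      also have "\<dots> \<le> B" unfolding B_def
        using d0 T \<epsilon> C regulator_props(1)[OF L T] by (intro member_le_sum) auto
      finally have "D s $ i \<le> B" .
      moreover have "D s $ i / v $ i \<le> D s $ i"
        using mult_left_mono[OF v_ge_1[of i], of "D s $ i"] D0[OF s] vpos[of i]
        by (simp add: less_eq_vec_def divide_le_eq)
      moreover have "0 \<le> \<kappa> * (T - s)" using c s by (simp add: \<kappa>_def)
      ultimately show ?thesis by (simp add: F_def)
    qed
    then show ?thesis by (intro bdd_aboveI2[of _ _ B]) auto
  qed
  have F_le: "F (i, s) \<le> \<phi>" if "s \<in> {0..T}" for i s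
    unfolding \<phi>_def using that by (intro cSUP_upper bdd) auto
  have D_le: "D s \<le> (\<phi> + \<kappa> * (T - s)) *\<^sub>R v" if "s \<in> {0..T}" for s
    unfolding less_eq_vec_def
  proof
    fix i
    have "D s $ i / v $ i \<le> \<phi> + \<kappa> * (T - s)" using F_le[OF that, of i] by (simp add: F_def)
    then show "D s $ i \<le> ((\<phi> + \<kappa> * (T - s)) *\<^sub>R v) $ i"
      using vpos[of i] by (simp add: pos_divide_le_eq)
  qed
  have \<phi>0: "0 \<le> \<phi>"
  proof -
    have "0 \<le> F (i, T)" using D0[of T] T v_nonneg by (simp add: F_def less_eq_vec_def)
    then show ?thesis using F_le[of T i] T by simp
  qed
  have "F (i, s) \<le> \<rho> * \<phi> + 2 * C" if s: "s \<in> {0..T}" for i s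
  proof -
    define q where "q = v $ i * (\<rho> * \<phi> + 2 * C + \<kappa> * (T - s))"
    \<comment> \<open>The value of \<open>D\<^sub>i(s)\<close> if coordinate \<open>i\<close> was last reflected at time \<open>r\<close>.\<close>
    have q: "V s $ i - V r $ i + (A *v D r) $ i \<le> q" if r: "r \<in> {0..s}" for r
    proof -
      have rT: "r \<in> {0..T}" using r s by auto
      have 1: "(A *v D r) $ i \<le> (\<phi> + \<kappa> * (T - r)) * (\<rho> * v $ i)"
      proof -
        have "(A *v D r) $ i \<le> (\<phi> + \<kappa> * (T - r)) * (v $ i - 1)"
          using A_mono_nth[OF D_le[OF rT], of i] by (simp add: matrix_vector_mult_scaleR A_v)
        also have "\<dots> \<le> (\<phi> + \<kappa> * (T - r)) * (\<rho> * v $ i)"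
          using \<rho>(3)[of i] \<phi>0 rT c by (intro mult_left_mono) (auto simp: \<kappa>_def)
        finally show ?thesis .
      qed
      have 2: "V s $ i - V r $ i \<le> - d $ i * (s - r) + \<epsilon> * ((T - s) + (T - r)) + 2 * C"
        using dev'[OF s, of i] dev'[OF rT, of i] by (simp add: algebra_simps abs_le_iff)
      have "c * v $ i * (s - r) \<le> d $ i * (s - r)" using d[of i] r by (intro mult_right_mono) auto
      moreover have "\<epsilon> * ((T - s) + (T - r)) \<le> v $ i * (\<epsilon> * ((T - s) + (T - r)))"
        using mult_right_mono[OF v_ge_1[of i], of "\<epsilon> * ((T - s) + (T - r))"] \<epsilon> s rT by simp
      moreover have "2 * C \<le> v $ i * (2 * C)" using mult_right_mono[OF v_ge_1[of i], of "2 * C"] C by simp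
      ultimately have "V s $ i - V r $ i + (A *v D r) $ i \<le>
        v $ i * (\<rho> * (\<phi> + \<kappa> * (T - r)) - c * (s - r) + \<epsilon> * ((T - s) + (T - r)) + 2 * C)"
        using 1 2 by (simp add: algebra_simps)
      also have "\<dots> \<le> q" unfolding q_def
      proof (rule mult_left_mono)
        have "(\<rho> * \<kappa> + \<epsilon>) * (s - r) \<le> c * (s - r)" "(\<rho> * \<kappa> + 2 * \<epsilon>) * (T - s) \<le> \<kappa> * (T - s)"
          using k1 k2 r s by (auto intro!: mult_right_mono)
        then show "\<rho> * (\<phi> + \<kappa> * (T - r)) - c * (s - r) + \<epsilon> * ((T - s) + (T - r)) + 2 * C \<le> \<rho> * \<phi> + 2 * C + \<kappa> * (T - s)"
          by (simp add: algebra_simps)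
      qed (use vpos[of i] in simp)
      finally show ?thesis .
    qed
    have "regulator Y s $ i \<le> q - V s $ i"
    proof -
      \<comment> \<open>No reflection before \<open>s\<close> at all: compare with \<open>r = 0\<close>, where \<open>V\<close> vanishes and \<open>A D \<ge> 0\<close>.\<close>
      have "0 \<le> q - V s $ i"
      proof -
        have "0 \<in> {0..T}" using T by simp
        then have "0 \<le> (A *v D 0) $ i" using A_mono_nth[OF D0] by fastforce
        then show ?thesis using q[of 0] s V0 by simp
      qed
      moreover have "(A *v regulator Y r - Y r) $ i \<le> q - V s $ i" if r: "r \<in> {0..s}" for r
      proof -
        have "(A *v regulator Y r - Y r) $ i = (A *v D r) $ i - V r $ i"
          using V[of r] r s by (simp add: D_def matrix_vector_right_distrib)
        then show ?thesis using q[OF r] by simp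
      qed
      ultimately show ?thesis using regulator_le_iff[OF L, of s i] s by auto
    qed
    then have "D s $ i \<le> v $ i * (\<rho> * \<phi> + 2 * C + \<kappa> * (T - s))" by (simp add: D_def q_def)
    then show ?thesis using vpos[of i] by (simp add: F_def field_simps)
  qed
  then have "\<phi> \<le> \<rho> * \<phi> + 2 * C"
    unfolding \<phi>_def using T by (intro cSUP_least) (auto simp flip: \<phi>_def)
  then have \<phi>: "\<phi> \<le> 2 * C / (1 - \<rho>)" using \<rho> by (simp add: field_simps)
  have TT: "T \<in> {0..T}" using T by simp
  have "reflect Y T $ i \<le> D T $ i"
    using W[OF TT] A_mono_nth[OF D0[OF TT], of i] by simp
  also have "\<dots> \<le> v $ i * \<phi>" using D_le[OF TT] by (simp add: less_eq_vec_def mult.commute)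
  also have "\<dots> \<le> v $ i * (2 * C / (1 - \<rho>))" using \<phi> vpos[of i] by (intro mult_left_mono) auto
  finally show ?thesis .
qed

end

section \<open>The Skorohod problem\<close>

text \<open>The mass of \<open>{s \<le> t. F s > c}\<close> is the amount by which \<open>F\<close> climbs above \<open>c\<close>. The infimum \<open>\<sigma>\<close> of the
set may or may not belong to it; if it does, \<open>F\<close> jumps across \<open>c\<close> at \<open>\<sigma>\<close>, and the mass of the atom
is recovered from half-open intervals shrinking to \<open>[\<sigma>,t]\<close>.\<close>

lemma emeasure_interval_measure_superlevel:
  assumes mono: "\<And>x y. x \<le> y \<Longrightarrow> F x \<le> F y" and rc: "\<And>a. continuous (at_right a) F"
    and less: "c < F t" and low: "\<And>s. s < l \<Longrightarrow> F s \<le> c"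
  shows "{s. c < F s \<and> s \<le> t} \<in> sets borel"
    and "emeasure (interval_measure F) {s. c < F s \<and> s \<le> t} \<noteq> 0"
proof -
  let ?M = "interval_measure F"
  define B where "B = {s. c < F s \<and> s \<le> t}"
  define \<sigma> where "\<sigma> = Inf B"
  have tB: "t \<in> B" using less by (simp add: B_def)
  have bdd: "bdd_below B" using low[THEN leD] by (intro bdd_belowI[of _ l]) (auto simp: B_def not_less[symmetric])
  have \<sigma>_le: "\<sigma> \<le> s" if "s \<in> B" for s unfolding \<sigma>_def by (rule cInf_lower[OF that bdd])
  have above: "s \<in> B" if s: "\<sigma> < s" "s \<le> t" for s
  proof -
    obtain b where b: "b \<in> B" "b < s" using s(1) cInf_less_iff[of B s] tB bdd by (auto simp: \<sigma>_def)
    then show ?thesis using mono[of b s] s(2) by (auto simp: B_def)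
  qed
  have B_le: "s \<le> t" if "s \<in> B" for s using that by (simp add: B_def)
  have Ioc: "emeasure ?M {a<..b} = ennreal (F b - F a)" if "a \<le> b" for a b
    using emeasure_interval_measure_Ioc[OF that mono rc] by simp
  have "B \<in> sets borel \<and> emeasure ?M B \<noteq> 0"
  proof (cases "c < F \<sigma>")
    case False
    then have "x \<noteq> \<sigma>" if "x \<in> B" for x using that by (auto simp: B_def)
    then have "B = {\<sigma><..t}"
      using \<sigma>_le above B_le by (intro set_eqI iffI) (auto simp: order.strict_iff_order)
    moreover have "F \<sigma> < F t" using False less by simp
    ultimately show ?thesis using Ioc[OF \<sigma>_le[OF tB]] by (auto simp: ennreal_eq_0_iff)
  next
    case True
    then have "\<sigma> \<in> B" using \<sigma>_le[OF tB] by (simp add: B_def)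
    then have eq: "B = {\<sigma>..t}"
      using \<sigma>_le above B_le by (intro set_eqI iffI) (auto simp: le_less)
    have "(\<lambda>n. emeasure ?M {\<sigma> - 1 / real (Suc n)<..t}) \<longlonglongrightarrow> emeasure ?M (\<Inter>n. {\<sigma> - 1 / real (Suc n)<..t})"
    proof (rule Lim_emeasure_decseq)
      show "decseq (\<lambda>n. {\<sigma> - 1 / real (Suc n)<..t})"
        by (auto simp: decseq_def) (smt (verit) frac_le of_nat_0_le_iff of_nat_mono)
      show "emeasure ?M {\<sigma> - 1 / real (Suc n)<..t} \<noteq> \<infinity>" for n
      proof -
        have "\<sigma> - 1 / real (Suc n) \<le> t"
          using \<sigma>_le[OF tB] divide_nonneg_nonneg[of 1 "real (Suc n)"] by linarith
        then show ?thesis using Ioc by simp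
      qed
    qed auto
    moreover have "(\<Inter>n. {\<sigma> - 1 / real (Suc n)<..t}) = {\<sigma>..t}"
    proof (intro set_eqI iffI)
      fix x assume "x \<in> {\<sigma>..t}"
      then have "\<sigma> \<le> x" "x \<le> t" by auto
      then have "\<sigma> - 1 / real (Suc n) < x" for n
        using divide_pos_pos[of 1 "real (Suc n)"] by (smt (verit) of_nat_0_less_iff zero_less_Suc)
      then show "x \<in> (\<Inter>n. {\<sigma> - 1 / real (Suc n)<..t})" using \<open>x \<le> t\<close> by auto
    next
      fix x assume x: "x \<in> (\<Inter>n. {\<sigma> - 1 / real (Suc n)<..t})"
      have "\<sigma> \<le> x"
      proof (rule ccontr)
        assume "\<not> \<sigma> \<le> x"
        then have "0 < \<sigma> - x" by simp
        then obtain n where "1 / real (Suc n) < \<sigma> - x" using nat_approx_posE by (metis)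
        moreover have "\<sigma> - 1 / real (Suc n) < x" using x by (simp del: of_nat_Suc)
        ultimately show False by linarith
      qed
      then show "x \<in> {\<sigma>..t}" using x by auto
    qed
    moreover have "ennreal (F t - c) \<le> emeasure ?M {\<sigma> - 1 / real (Suc n)<..t}" for n
    proof -
      have lt: "\<sigma> - 1 / real (Suc n) < \<sigma>" using divide_pos_pos[of 1 "real (Suc n)"] by simp
      have le: "\<sigma> - 1 / real (Suc n) \<le> t" using lt \<sigma>_le[OF tB] by linarith
      have "\<sigma> - 1 / real (Suc n) \<notin> B" using \<sigma>_le lt by force
      then have "F (\<sigma> - 1 / real (Suc n)) \<le> c" using le by (auto simp: B_def)
      then show ?thesis using Ioc[OF le] by (simp add: ennreal_leI)
    qed
    ultimately have "ennreal (F t - c) \<le> emeasure ?M B"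
      unfolding eq by (intro LIMSEQ_le_const) auto
    moreover have "0 < ennreal (F t - c)" using less by simp
    ultimately show ?thesis by (auto simp: eq)
  qed
  then show "{s. c < F s \<and> s \<le> t} \<in> sets borel"
    and "emeasure (interval_measure F) {s. c < F s \<and> s \<le> t} \<noteq> 0" by (auto simp: B_def)
qed

context reflection
begin

text \<open>If \<open>L\<^sub>i(t)\<close> exceeded an upper bound \<open>c \<ge> 0\<close> of \<open>(A L - Y)\<^sub>i\<close> on \<open>[0,t]\<close>, then \<open>W\<^sub>i > 0\<close> wherever
\<open>L\<^sub>i > c\<close>, and this set has positive mass: complementarity would fail.\<close>

lemma skorohod_solution_is_regulator:
  assumes sol: "skorohod_solution (mat 1 - A) Y W L"
  shows "is_regulator Y L"
  unfolding is_regulator_def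
proof (intro allI impI)
  fix t i c assume t: "0 \<le> (t::real)"
  define F where "F s = L s $ i" for s
  have neg: "F s = 0" if "s < 0" for s
    using sol that by (simp add: skorohod_solution_def F_def)
  have pos: "0 \<le> F s" if "0 \<le> s" for s
    using sol that by (simp add: skorohod_solution_def F_def)
  have mono_pos: "F r \<le> F s" if "0 \<le> r" "r \<le> s" for r s
    using sol that by (auto simp: skorohod_solution_def F_def mono_on_def)
  have mono: "F r \<le> F s" if "r \<le> s" for r s
    using neg[of r] neg[of s] pos[of s] mono_pos[of r s] that by (cases "r < 0"; cases "s < 0") auto
  have rc: "continuous (at_right a) F" for a
  proof (cases "0 \<le> a")
    case True
    then show ?thesis using sol by (simp add: skorohod_solution_def F_def[abs_def])
  next
    case False
    then have "\<forall>\<^sub>F s in at_right a. F s = 0"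
      using neg by (auto simp: eventually_at_right[of a 0] intro!: exI[of _ 0])
    then have "(F \<longlongrightarrow> 0) (at_right a)" by (simp add: tendsto_eventually)
    then show ?thesis using neg[of a] False by (simp add: continuous_within)
  qed
  have W: "W s $ i = Y s $ i + F s - (A *v L s) $ i" if "0 \<le> s" for s
    using sol that by (simp add: skorohod_solution_def F_def matrix_vector_mult_diff_rdistrib)
  have W0: "0 \<le> W s $ i" if "0 \<le> s" for s
    using sol that unfolding skorohod_solution_def by blast
  have null: "(\<integral>\<^sup>+s\<in>{0..}. indicator {s. W s $ i > 0} s \<partial>interval_measure F) = 0"
    using sol by (simp add: skorohod_solution_def F_def[abs_def])
  show "L t $ i \<le> c \<longleftrightarrow> 0 \<le> c \<and> (\<forall>s\<in>{0..t}. (A *v L s - Y s) $ i \<le> c)"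
  proof (intro iffI conjI ballI)
    assume le: "L t $ i \<le> c"
    then show "0 \<le> c" using pos[OF t] by (simp add: F_def)
    fix s assume s: "s \<in> {0..t}"
    then show "(A *v L s - Y s) $ i \<le> c"
      using W[of s] W0[of s] mono[of s t] le by (auto simp: F_def)
  next
    assume c: "0 \<le> c \<and> (\<forall>s\<in>{0..t}. (A *v L s - Y s) $ i \<le> c)"
    show "L t $ i \<le> c"
    proof (rule ccontr)
      assume "\<not> L t $ i \<le> c"
      then have less: "c < F t" by (simp add: F_def)
      define B where "B = {s. c < F s \<and> s \<le> t}"
      have low: "F s \<le> c" if "s < 0" for s using neg[OF that] c by simp
      note B = emeasure_interval_measure_superlevel[of F c t 0, OF mono rc less low, folded B_def]
      have "W s $ i > 0 \<and> 0 \<le> s" if s: "s \<in> B" for s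
      proof -
        have s0: "0 \<le> s" using low[of s] s by (cases "s < 0") (auto simp: B_def)
        have "(A *v L s - Y s) $ i \<le> c" using c s s0 by (auto simp: B_def)
        then show ?thesis using W[OF s0] s s0 by (simp add: B_def)
      qed
      then have "(\<integral>\<^sup>+s. indicator B s \<partial>interval_measure F)
          \<le> (\<integral>\<^sup>+s\<in>{0..}. indicator {s. W s $ i > 0} s \<partial>interval_measure F)"
        by (intro nn_integral_mono) (auto simp: indicator_def)
      then show False using B null by simp
    qed
  qed
qed

text \<open>Complementarity. Where \<open>W\<^sub>i > 0\<close>, right continuity makes \<open>L\<^sub>i\<close> constant up to some rational time
\<open>q\<close>, so countably many intervals of constancy \<open>[\<sigma> q, q]\<close> cover the set in question. Their
interiors carry no mass, and a left end point with \<open>W\<^sub>i > 0\<close> is not an atom, as \<open>L\<^sub>i\<close> jumps only to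
make \<open>W\<^sub>i\<close> vanish.\<close>

lemma regulator_is_skorohod_solution:
  fixes Y :: "real \<Rightarrow> real^'n"
  assumes Y: "cadlag Y"
  shows "skorohod_solution (mat 1 - A) Y (\<lambda>t. if t < 0 then 0 else reflect Y t)
    (\<lambda>t. if t < 0 then 0 else regulator Y t)"
proof -
  define W where "W t = (if t < 0 then 0 else reflect Y t)" for t
  define L where "L t = (if t < 0 then 0 else regulator Y t)" for t
  note lb = cadlag_locally_bounded[OF Y]
  note reg = is_regulator_regulator[OF lb]
  have Yrc: "(Y \<longlongrightarrow> Y t) (at_right t)" if "0 \<le> t" for t
    using Y that by (simp add: cadlag_def)
  have ev: "\<forall>\<^sub>F s in at_right t. L s = regulator Y s \<and> W s = reflect Y s" if "0 \<le> t" for t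
    using that by (auto simp: eventually_at_right[of t "t + 1"] L_def W_def intro!: exI[of _ "t + 1"])
  have Lrc: "(L \<longlongrightarrow> L t) (at_right t)" if t: "0 \<le> t" for t
  proof -
    have "(regulator Y \<longlongrightarrow> L t) (at_right t)"
      using regulator_right_continuous[OF reg t Yrc[OF t]] t by (simp add: L_def)
    then show ?thesis using ev[OF t] by (subst tendsto_cong[of L "regulator Y"]) (auto elim: eventually_mono)
  qed
  have Wrc: "(W \<longlongrightarrow> W t) (at_right t)" if t: "0 \<le> t" for t
  proof -
    have "((\<lambda>s. Y s + L s - A *v L s) \<longlongrightarrow> Y t + L t - A *v L t) (at_right t)"
      by (intro tendsto_add tendsto_diff tendsto_matrix_vector Lrc Yrc t)
    moreover have "\<forall>\<^sub>F s in at_right t. W s = Y s + L s - A *v L s"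
      using ev[OF t] by (rule eventually_mono) (auto simp: reflect_def)
    moreover have "W t = Y t + L t - A *v L t" using t by (simp add: W_def L_def reflect_def)
    ultimately show ?thesis by (subst tendsto_cong) auto
  qed
  have mono: "L r $ i \<le> L s $ i" if "r \<le> s" for r s i
    using that regulator_props(3)[OF reg, of r s i] regulator_props(1)[OF reg, of s i] by (auto simp: L_def)
  have rc: "continuous (at_right a) (\<lambda>s. L s $ i)" for a i
  proof (cases "0 \<le> a")
    case True
    then show ?thesis using tendsto_vec_nth[OF Lrc[OF True]] by (simp add: continuous_within)
  next
    case False
    then have "\<forall>\<^sub>F s in at_right a. L s $ i = 0"
      by (auto simp: eventually_at_right[of a 0] L_def intro!: exI[of _ 0])
    then have "((\<lambda>s. L s $ i) \<longlongrightarrow> 0) (at_right a)" by (simp add: tendsto_eventually)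
    then show ?thesis using False by (simp add: continuous_within L_def)
  qed
  have null: "(\<integral>\<^sup>+t\<in>{0..}. indicator {s. W s $ i > 0} t \<partial>interval_measure (\<lambda>s. L s $ i)) = 0" for i
  proof -
    let ?M = "interval_measure (\<lambda>s. L s $ i)"
    have Ioc: "emeasure ?M {a<..b} = ennreal (L b $ i - L a $ i)" if "a \<le> b" for a b
      using emeasure_interval_measure_Ioc[OF that mono rc] by simp
    \<comment> \<open>A jump of \<open>L\<^sub>i\<close> at \<open>s\<close> with \<open>W\<^sub>i(s) > 0\<close> would contradict the supremum property at \<open>s\<close>; at \<open>s = 0\<close>
      the values before the jump are the zeros on the negative half-line.\<close>
    have atom: "emeasure ?M {s} = 0" if s: "0 \<le> s" "0 < W s $ i" for s
    proof -
      have "emeasure ?M {s} \<le> ennreal e" if e: "0 < e" for e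
      proof -
        have "\<exists>r<s. L s $ i - e \<le> L r $ i"
        proof (rule ccontr)
          assume "\<not> (\<exists>r<s. L s $ i - e \<le> L r $ i)"
          then have gap: "L r $ i < L s $ i - e" if "r < s" for r using that by (meson not_le)
          define c where "c = max (L s $ i - e) (L s $ i - W s $ i)"
          have "0 \<le> L s $ i - e" using gap[of "-1"] s by (simp add: L_def)
          then have "0 \<le> c" by (simp add: c_def)
          moreover have "(A *v regulator Y r - Y r) $ i \<le> c" if r: "r \<in> {0..s}" for r
          proof (cases "r = s")
            case True
            then show ?thesis using s by (simp add: c_def W_def L_def reflect_def)
          next
            case False
            then show ?thesis
              using gap[of r] r regulator_props(2)[OF reg, of r r i] by (simp add: c_def L_def)
          qed
          ultimately have "regulator Y s $ i \<le> c" using regulator_le_iff[OF reg s(1)] by blast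
          then show False using s e by (auto simp: c_def L_def)
        qed
        then obtain r where r: "r < s" "L s $ i - e \<le> L r $ i" by blast
        have "emeasure ?M {s} \<le> emeasure ?M {r<..s}" using r by (intro emeasure_mono) auto
        also have "\<dots> \<le> ennreal e" using Ioc[of r s] r by (auto intro: ennreal_leI)
        finally show ?thesis .
      qed
      then have "emeasure ?M {s} \<le> 0"
        by (rule_tac ennreal_le_epsilon) simp
      then show ?thesis by (simp only: le_zero_eq)
    qed
    define \<sigma> where "\<sigma> q = Inf {s. 0 \<le> s \<and> s \<le> q \<and> L s $ i = L q $ i}" for q
    define N where "N q = {\<sigma> q<..q} \<union> (if 0 \<le> \<sigma> q \<and> 0 < W (\<sigma> q) $ i then {\<sigma> q} else {})" for q
    have \<sigma>: "0 \<le> \<sigma> q" "\<sigma> q \<le> q" "L (\<sigma> q) $ i = L q $ i" "\<And>s. 0 \<le> s \<Longrightarrow> s \<le> q \<Longrightarrow> L s $ i = L q $ i \<Longrightarrow> \<sigma> q \<le> s"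
      if q: "0 \<le> q" for q
    proof -
      let ?S = "{s. 0 \<le> s \<and> s \<le> q \<and> L s $ i = L q $ i}"
      have ne: "q \<in> ?S" using q by simp
      have bdd: "bdd_below ?S" by (intro bdd_belowI[of _ 0]) auto
      show le: "\<And>s. 0 \<le> s \<Longrightarrow> s \<le> q \<Longrightarrow> L s $ i = L q $ i \<Longrightarrow> \<sigma> q \<le> s"
        unfolding \<sigma>_def by (rule cInf_lower[OF _ bdd]) auto
      show s0: "0 \<le> \<sigma> q" unfolding \<sigma>_def using ne by (rule_tac cInf_greatest) auto
      show sq: "\<sigma> q \<le> q" using le[OF q order_refl refl] .
      have const: "L s $ i = L q $ i" if s: "\<sigma> q < s" "s \<le> q" for s
      proof -
        obtain r where "r \<in> ?S" "r < s" using s(1) cInf_less_iff[of ?S s] ne bdd unfolding \<sigma>_def by blast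
        then have "L q $ i \<le> L s $ i" using mono[of r s i] by simp
        then show ?thesis using mono[OF s(2), of i] by (rule_tac antisym)
      qed
      show "L (\<sigma> q) $ i = L q $ i"
      proof (cases "\<sigma> q = q")
        case False
        then have lt: "\<sigma> q < q" using sq by simp
        have "\<forall>\<^sub>F s in at_right (\<sigma> q). L s $ i = L q $ i"
          unfolding eventually_at_right[OF lt] using lt by (intro exI[of _ q] conjI allI impI const less_imp_le)
        then have "((\<lambda>s. L s $ i) \<longlongrightarrow> L q $ i) (at_right (\<sigma> q))" by (simp add: tendsto_eventually)
        then show ?thesis using tendsto_unique[OF trivial_limit_at_right_real _ tendsto_vec_nth[OF Lrc[OF s0], of i]] by simp
      qed simp
    qed
    have "N q \<in> null_sets ?M" if q: "0 \<le> q" for q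
    proof -
      have "{\<sigma> q<..q} \<in> null_sets ?M" using Ioc[OF \<sigma>(2)[OF q]] \<sigma>(3)[OF q] by (auto simp: null_sets_def)
      moreover have "(if 0 \<le> \<sigma> q \<and> 0 < W (\<sigma> q) $ i then {\<sigma> q} else {}) \<in> null_sets ?M"
        using atom by (auto simp: null_sets_def)
      ultimately show ?thesis unfolding N_def by (rule null_sets.Un)
    qed
    then have "(\<Union>q\<in>\<rat> \<inter> {0..}. N q) \<in> null_sets ?M"
      by (intro null_sets_UN') (auto simp: countable_rat)
    moreover have "{s \<in> space ?M. \<not> \<not> (0 \<le> s \<and> 0 < W s $ i)} \<subseteq> (\<Union>q\<in>\<rat> \<inter> {0..}. N q)"
    proof
      fix s assume "s \<in> {s \<in> space ?M. \<not> \<not> (0 \<le> s \<and> 0 < W s $ i)}"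
      then have s: "0 \<le> s" "0 < W s $ i" by auto
      define \<epsilon> where "\<epsilon> = W s $ i / 2"
      have \<epsilon>: "0 < \<epsilon>" "\<epsilon> < W s $ i" using s by (auto simp: \<epsilon>_def)
      from order_tendstoD(1)[OF tendsto_vec_nth[OF Wrc[OF s(1)], of i] \<epsilon>(2)]
      obtain b where b: "s < b" "\<And>r. s < r \<Longrightarrow> r < b \<Longrightarrow> \<epsilon> < W r $ i"
        by (auto simp: eventually_at_right[of s "s + 1"])
      obtain q where q: "q \<in> \<rat>" "s < q" "q < b" using Rats_dense_in_real[OF b(1)] by blast
      have "regulator Y q $ i = regulator Y s $ i"
      proof (rule regulator_constant_while_positive[OF reg s(1) _ \<epsilon>(1)])
        show "\<epsilon> \<le> (Y r + regulator Y r - A *v regulator Y r) $ i" if "s < r" "r \<le> q" for r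
          using b(2)[of r] that q s by (simp add: W_def reflect_def)
      qed (use q in simp)
      then have "L s $ i = L q $ i" using q s by (simp add: L_def)
      then have "\<sigma> q \<le> s" using \<sigma>(4)[of q s] q s by simp
      then have "s \<in> N q" using q s by (cases "\<sigma> q = s") (simp_all add: N_def)
      then show "s \<in> (\<Union>q\<in>\<rat> \<inter> {0..}. N q)" using q s by (intro UN_I[of q]) simp_all
    qed
    ultimately have "AE s in ?M. \<not> (0 \<le> s \<and> 0 < W s $ i)" by (rule AE_I')
    then have "AE s in ?M. indicator {s. W s $ i > 0} s * indicator {0..} s = (0::ennreal)"
      by (rule eventually_mono) (auto simp: indicator_def)
    then have "(\<integral>\<^sup>+t\<in>{0..}. indicator {s. W s $ i > 0} t \<partial>?M) = (\<integral>\<^sup>+t. 0 \<partial>?M)"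
      by (rule nn_integral_cong_AE)
    then show ?thesis by simp
  qed
  have "skorohod_solution (mat 1 - A) Y W L"
    unfolding skorohod_solution_def
  proof (intro conjI allI impI)
    show "W t = 0" "L t = 0" if "t < 0" for t using that by (auto simp: W_def L_def)
    show "W t = Y t + (mat 1 - A) *v L t" if "0 \<le> t" for t
      using that by (simp add: W_def L_def reflect_def matrix_vector_mult_diff_rdistrib)
    show "mono_on {0..} (\<lambda>t. L t $ i)" for i using mono by (auto simp: mono_on_def)
    show "0 \<le> L t $ i" if "0 \<le> t" for t i using that regulator_props(1)[OF reg] by (simp add: L_def)
    show "continuous (at_right t) (\<lambda>s. L s $ i)" for t i by (rule rc)
    show "0 \<le> W t $ i" if "0 \<le> t" for t i
      using that reflect_nonneg[OF lb that] by (simp add: W_def less_eq_vec_def)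
  qed (rule null)
  then show ?thesis by (simp add: W_def[abs_def] L_def[abs_def])
qed

lemma reflected_eq_reflect:
  fixes Y :: "real \<Rightarrow> real^'n"
  assumes Y: "cadlag Y" and t: "0 \<le> t"
  shows "reflected (mat 1 - A) Y t = reflect Y t"
proof -
  define W where "W t = (if t < 0 then 0 else reflect Y t)" for t
  define L where "L t = (if t < 0 then 0 else regulator Y t)" for t
  note lb = cadlag_locally_bounded[OF Y]
  have sol: "skorohod_solution (mat 1 - A) Y W L"
    unfolding W_def[abs_def] L_def[abs_def] by (rule regulator_is_skorohod_solution[OF Y])
  have unique: "W' = W \<and> L' = L" if sol': "skorohod_solution (mat 1 - A) Y W' L'" for W' L'
  proof -
    have "L' s = L s \<and> W' s = W s" for s
    proof (cases "s < 0")
      case True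
      then show ?thesis using sol sol' by (simp add: skorohod_solution_def)
    next
      case False
      then have s: "0 \<le> s" by simp
      have "L' s = L s"
        using regulator_unique[OF skorohod_solution_is_regulator[OF sol'] skorohod_solution_is_regulator[OF sol] s] .
      then show ?thesis using sol sol' s by (simp add: skorohod_solution_def)
    qed
    then show ?thesis by auto
  qed
  have "reflection_map (mat 1 - A) Y = (W, L)"
    unfolding reflection_map_def
  proof (rule the_equality)
    show "case (W, L) of (W, L) \<Rightarrow> skorohod_solution (mat 1 - A) Y W L" using sol by simp
    fix p assume p: "case p of (W, L) \<Rightarrow> skorohod_solution (mat 1 - A) Y W L"
    show "p = (W, L)"
    proof (cases p)
      case (Pair W' L')
      then show ?thesis using unique[of W' L'] p by simp
    qed
  qed
  then show ?thesis using t by (simp add: reflected_def W_def)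
qed

end

section \<open>Path space and the law of a Levy process\<close>

lemma eventually_at_right_ex: "(\<forall>\<^sub>F s in at_right (t::real). P s) \<longleftrightarrow> (\<exists>b>t. \<forall>s. t < s \<longrightarrow> s < b \<longrightarrow> P s)"
  by (simp add: eventually_at_right[of t "t + 1"])

lemma eventually_at_left_ex: "(\<forall>\<^sub>F s in at_left (t::real). P s) \<longleftrightarrow> (\<exists>b<t. \<forall>s. b < s \<longrightarrow> s < t \<longrightarrow> P s)"
  by (simp add: eventually_at_left[of "t - 1" t])

lemma cadlag_cong:
  assumes "\<And>t. 0 \<le> t \<Longrightarrow> Y t = Y' t" shows "cadlag Y = cadlag Y'"
proof -
  have "(Y \<longlongrightarrow> Y t) (at_right t) = (Y' \<longlongrightarrow> Y' t) (at_right t)" if "0 \<le> t" for t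
    using that assms by (subst assms[OF that], intro tendsto_cong) (auto simp: eventually_at_right_ex intro!: exI[of _ "t + 1"])
  moreover have "(Y \<longlongrightarrow> l) (at_left t) = (Y' \<longlongrightarrow> l) (at_left t)" if "0 < t" for t l
    using that assms by (intro tendsto_cong) (auto simp: eventually_at_left_ex intro!: exI[of _ 0])
  ultimately show ?thesis by (simp add: cadlag_def)
qed

lemma cadlag_const_add:
  fixes Y :: "real \<Rightarrow> 'b::real_normed_vector"
  assumes "cadlag Y" shows "cadlag (\<lambda>t. a + Y t)"
  unfolding cadlag_def
proof (intro conjI allI impI)
  show "((\<lambda>t. a + Y t) \<longlongrightarrow> a + Y t) (at_right t)" if "0 \<le> t" for t
    using assms that by (intro tendsto_intros) (simp add: cadlag_def)
  fix t :: real assume "0 < t"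
  then obtain l where "(Y \<longlongrightarrow> l) (at_left t)" using assms unfolding cadlag_def by blast
  then show "\<exists>l. ((\<lambda>t. a + Y t) \<longlongrightarrow> l) (at_left t)"
    using tendsto_add[OF tendsto_const] by blast
qed

lemma cadlag_diff_const:
  fixes Y :: "real \<Rightarrow> 'b::real_normed_vector"
  assumes "cadlag Y" shows "cadlag (\<lambda>t. Y t - a)"
  using cadlag_const_add[OF assms, of "- a"] by simp

lemma cadlag_shift:
  fixes Y :: "real \<Rightarrow> 'b::real_normed_vector"
  assumes Y: "cadlag Y" and s: "0 \<le> s" shows "cadlag (\<lambda>t. Y (s + t))"
  unfolding cadlag_def
proof (intro conjI allI impI)
  fix t :: real assume "0 \<le> t"
  then have "(Y \<longlongrightarrow> Y (s + t)) (at_right (s + t))" using Y s by (simp add: cadlag_def)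
  moreover have "filterlim (\<lambda>u. s + u) (at_right (s + t)) (at_right t)"
    unfolding filterlim_at by (auto intro!: tendsto_intros simp: eventually_at_right_ex intro: exI[of _ "t + 1"])
  ultimately show "((\<lambda>u. Y (s + u)) \<longlongrightarrow> Y (s + t)) (at_right t)" by (rule filterlim_compose)
next
  fix t :: real assume "0 < t"
  then obtain l where "(Y \<longlongrightarrow> l) (at_left (s + t))"
    using Y s unfolding cadlag_def by (metis add_nonneg_pos)
  moreover have "filterlim (\<lambda>u. s + u) (at_left (s + t)) (at_left t)"
    unfolding filterlim_at by (auto intro!: tendsto_intros simp: eventually_at_left_ex intro: exI[of _ "t - 1"])
  ultimately have "((\<lambda>u. Y (s + u)) \<longlongrightarrow> l) (at_left t)" by (rule filterlim_compose)
  then show "\<exists>l. ((\<lambda>u. Y (s + u)) \<longlongrightarrow> l) (at_left t)" ..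
qed

lemma cadlag_stop:
  assumes Y: "cadlag Y" and s: "0 \<le> s" shows "cadlag (\<lambda>t. Y (min s t))"
  unfolding cadlag_def
proof (intro conjI allI impI)
  fix t :: real assume t: "0 \<le> t"
  show "((\<lambda>u. Y (min s u)) \<longlongrightarrow> Y (min s t)) (at_right t)"
  proof (cases "t < s")
    case True
    then have "\<forall>\<^sub>F u in at_right t. Y (min s u) = Y u"
      by (auto simp: eventually_at_right_ex intro!: exI[of _ s])
    then show ?thesis using Y t True by (simp add: cadlag_def tendsto_cong)
  next
    case False
    then have "\<forall>\<^sub>F u in at_right t. Y (min s u) = Y (min s t)"
      by (auto simp: eventually_at_right_ex intro!: exI[of _ "t + 1"])
    then show ?thesis by (rule tendsto_eventually)
  qed
next
  fix t :: real assume t: "0 < t"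
  show "\<exists>l. ((\<lambda>u. Y (min s u)) \<longlongrightarrow> l) (at_left t)"
  proof (cases "t \<le> s")
    case True
    then have "\<forall>\<^sub>F u in at_left t. Y (min s u) = Y u"
      by (auto simp: eventually_at_left_ex intro!: exI[of _ "t - 1"])
    then show ?thesis using Y t by (simp add: cadlag_def tendsto_cong)
  next
    case False
    then have "\<forall>\<^sub>F u in at_left t. Y (min s u) = Y s"
      by (auto simp: eventually_at_left_ex intro!: exI[of _ s])
    then show ?thesis by (intro exI[of _ "Y s"] tendsto_eventually)
  qed
qed

text \<open>Cadlag paths that start at \<open>0\<close>. Restricting the uncountable product to these paths keeps its
\<open>\<sigma>\<close>-algebra generated by finitely many coordinates, while functionals that depend on
uncountably many times, such as the reflected path, become measurable.\<close>

definition path_space :: "(real \<Rightarrow> 'b::euclidean_space) measure" where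
  "path_space = restrict_space (\<Pi>\<^sub>M t\<in>{0..}. borel) {x. cadlag x \<and> x 0 = 0}"

text \<open>The path after time \<open>s\<close>, restarted at \<open>0\<close>.\<close>

definition shift :: "real \<Rightarrow> (real \<Rightarrow> 'b::euclidean_space) \<Rightarrow> real \<Rightarrow> 'b" where
  "shift s x = (\<lambda>t\<in>{0..}. x (s + t) - x s)"

definition stop :: "real \<Rightarrow> (real \<Rightarrow> 'b::euclidean_space) \<Rightarrow> real \<Rightarrow> 'b" where
  "stop s x = (\<lambda>t\<in>{0..}. x (min s t))"

lemma space_path_space: "space path_space = {x \<in> extensional {0..}. cadlag x \<and> x 0 = 0}"
  by (auto simp: path_space_def space_restrict_space space_PiM PiE_def)

lemma measurable_path_spaceI:
  assumes "\<And>\<omega>. \<omega> \<in> space N \<Longrightarrow> f \<omega> \<in> space path_space"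
    and "\<And>t. 0 \<le> t \<Longrightarrow> (\<lambda>\<omega>. f \<omega> t) \<in> borel_measurable N"
  shows "f \<in> measurable N path_space"
  unfolding path_space_def
proof (rule measurable_restrict_space2)
  show "f \<in> space N \<rightarrow> {x. cadlag x \<and> x 0 = 0}" using assms(1) by (auto simp: space_path_space)
  show "f \<in> N \<rightarrow>\<^sub>M Pi\<^sub>M {0..} (\<lambda>t. borel)"
    using assms by (intro measurable_PiM_single') (auto simp: space_path_space PiE_def)
qed

lemma measurable_path_eval: "0 \<le> t \<Longrightarrow> (\<lambda>x. x t) \<in> borel_measurable path_space"
  unfolding path_space_def by (intro measurable_restrict_space1 measurable_component_singleton) auto

lemma shift_in_path_space: "x \<in> space path_space \<Longrightarrow> 0 \<le> s \<Longrightarrow> shift s x \<in> space path_space"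
  using cadlag_cong[of "shift s x" "\<lambda>t. x (s + t) - x s"] cadlag_diff_const[OF cadlag_shift, of x s "x s"]
  by (auto simp: space_path_space shift_def)

lemma stop_in_path_space: "x \<in> space path_space \<Longrightarrow> 0 \<le> s \<Longrightarrow> stop s x \<in> space path_space"
  using cadlag_cong[of "stop s x" "\<lambda>t. x (min s t)"] cadlag_stop[of x s]
  by (auto simp: space_path_space stop_def)

lemma measurable_shift: "0 \<le> s \<Longrightarrow> shift s \<in> measurable path_space path_space"
  by (intro measurable_path_spaceI shift_in_path_space)
    (auto simp: shift_def intro!: borel_measurable_diff measurable_path_eval)

lemma measurable_stop: "0 \<le> s \<Longrightarrow> stop s \<in> measurable path_space path_space"
  by (intro measurable_path_spaceI stop_in_path_space)
    (auto simp: stop_def intro!: measurable_path_eval)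

text \<open>Joint laws of a Levy process at finitely many times are read off its independent increments
between consecutive times; this enumerates the times in increasing order, beginning with \<open>0\<close>.\<close>

lemma finite_times_enumeration:
  fixes T :: "real set"
  assumes T: "finite T" "T \<subseteq> {0..}" "0 \<in> T"
  obtains \<tau> :: "nat \<Rightarrow> real" and k :: nat and idx :: "real \<Rightarrow> nat" where "\<tau> 0 = 0" "\<And>i j. i < j \<Longrightarrow> j \<le> k \<Longrightarrow> \<tau> i < \<tau> j"
    "\<And>u. u \<in> T \<Longrightarrow> idx u \<le> k \<and> \<tau> (idx u) = u"
proof -
  define xs where "xs = sorted_list_of_set T"
  have set: "set xs = T" unfolding xs_def by (rule set_sorted_list_of_set[OF T(1)])
  have sorted: "sorted_wrt (<) xs" unfolding xs_def by (rule strict_sorted_list_of_set)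
  define k where "k = length xs - 1"
  have ne: "xs \<noteq> []" using set T by auto
  then have lt: "j < length xs \<longleftrightarrow> j \<le> k" for j by (cases xs) (auto simp: k_def)
  have mono: "xs ! i < xs ! j" if "i < j" "j \<le> k" for i j
    using sorted_wrt_nth_less[OF sorted that(1)] that lt by simp
  have ex: "\<exists>i\<le>k. xs ! i = u" if "u \<in> T" for u
    using that unfolding set[symmetric] by (auto simp: in_set_conv_nth lt)
  define idx where "idx u = (SOME i. i \<le> k \<and> xs ! i = u)" for u
  have idx: "idx u \<le> k \<and> xs ! idx u = u" if "u \<in> T" for u
    unfolding idx_def using someI_ex[of "\<lambda>i. i \<le> k \<and> xs ! i = u"] ex[OF that] by blast
  have "xs ! 0 = 0"
  proof (rule ccontr)
    assume "xs ! 0 \<noteq> 0"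
    moreover have "xs ! 0 \<in> T" using ne set by (metis length_greater_0_conv nth_mem)
    ultimately have "0 < xs ! 0" using T(2) by force
    moreover obtain i where i: "i \<le> k" "xs ! i = 0" using ex[OF T(3)] by blast
    moreover have "xs ! 0 \<le> xs ! i" using mono[of 0 i] i by (cases "i = 0") auto
    ultimately show False by simp
  qed
  then show ?thesis using mono idx by (rule that)
qed

lemma telescope:
  fixes x :: "real \<Rightarrow> 'b::ab_group_add"
  assumes "m \<le> (i::nat)"
  shows "(\<Sum>j\<in>{m..<i}. x (\<tau> (Suc j)) - x (\<tau> j)) = x (\<tau> i) - x (\<tau> m)"
  using sum_Suc_diff'[OF assms, of "\<lambda>j. x (\<tau> j)"] .

context levy_process
begin

lemma increments_indep:
  assumes "0 \<le> s" "\<tau> 0 = 0" "\<And>i j. i < j \<Longrightarrow> j \<le> k \<Longrightarrow> \<tau> i < \<tau> j"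
  shows "indep_vars (\<lambda>_. borel) (\<lambda>(j::nat) \<omega>. X (s + \<tau> (Suc j)) \<omega> - X (s + \<tau> j) \<omega>) {..<k}"
proof (rule independent_increments)
  show "0 \<le> s + \<tau> 0" using assms by simp
  show "s + \<tau> j \<le> s + \<tau> (Suc j)" if "j < k" for j using assms(3)[of j "Suc j"] that by simp
qed

text \<open>The two events are functions of disjoint sets of increments.\<close>

lemma indep_past_future_cylinders:
  assumes s: "0 \<le> s" and J: "finite J" "J \<subseteq> {0..}" and K: "finite K" "K \<subseteq> {0..}"
    and E: "\<And>u. u \<in> J \<Longrightarrow> E u \<in> sets borel" and E': "\<And>v. v \<in> K \<Longrightarrow> E' v \<in> sets borel"
  shows "prob ({\<omega>\<in>space M. \<forall>u\<in>J. X (min s u) \<omega> - X 0 \<omega> \<in> E u} \<inter> {\<omega>\<in>space M. \<forall>v\<in>K. X (s + v) \<omega> - X s \<omega> \<in> E' v})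
    = prob {\<omega>\<in>space M. \<forall>u\<in>J. X (min s u) \<omega> - X 0 \<omega> \<in> E u} * prob {\<omega>\<in>space M. \<forall>v\<in>K. X (s + v) \<omega> - X s \<omega> \<in> E' v}"
proof -
  define T where "T = {0, s} \<union> min s ` J \<union> (+) s ` K"
  have T: "finite T" "T \<subseteq> {0..}" "0 \<in> T" using s J K by (auto simp: T_def)
  obtain \<tau> :: "nat \<Rightarrow> real" and k :: nat and idx :: "real \<Rightarrow> nat" where
    \<tau>0: "\<tau> 0 = 0" and mono: "\<And>i j. i < j \<Longrightarrow> j \<le> k \<Longrightarrow> \<tau> i < \<tau> j"
    and idx: "\<And>u. u \<in> T \<Longrightarrow> idx u \<le> k \<and> \<tau> (idx u) = u"
    by (rule finite_times_enumeration[OF T]) (rule that)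
  define D where "D j \<omega> = X (\<tau> (Suc j)) \<omega> - X (\<tau> j) \<omega>" for j \<omega>
  have D: "indep_vars (\<lambda>_. borel) D {..<k}"
    using increments_indep[of 0 \<tau> k, OF order_refl \<tau>0 mono] by (simp add: D_def[abs_def])
  define m where "m = idx s"
  have m: "m \<le> k" "\<tau> m = s" using idx[of s] by (auto simp: T_def m_def)
  have le_idx: "idx u \<le> m" if "u \<in> T" "u \<le> s" for u
    using mono[of m "idx u"] idx[OF that(1)] m that by (cases "m < idx u") auto
  have ge_idx: "m \<le> idx u" if "u \<in> T" "s \<le> u" for u
    using mono[of "idx u" m] idx[OF that(1)] m that by (cases "idx u < m") auto
  have past: "X (min s u) \<omega> - X 0 \<omega> = (\<Sum>j<idx (min s u). restrict (\<lambda>j. D j \<omega>) {..<m} j)" if u: "u \<in> J" for u \<omega>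
  proof -
    have uT: "min s u \<in> T" using u by (auto simp: T_def)
    then have "idx (min s u) \<le> m" by (intro le_idx) auto
    then have "(\<Sum>j<idx (min s u). restrict (\<lambda>j. D j \<omega>) {..<m} j) = (\<Sum>j\<in>{0..<idx (min s u)}. D j \<omega>)"
      by (intro sum.cong) auto
    then show ?thesis
      using telescope[of 0 "idx (min s u)" "\<lambda>t. X t \<omega>" \<tau>] idx[OF uT] \<tau>0 by (simp add: D_def)
  qed
  have future: "X (s + v) \<omega> - X s \<omega> = (\<Sum>j\<in>{m..<idx (s + v)}. restrict (\<lambda>j. D j \<omega>) {m..<k} j)" if v: "v \<in> K" for v \<omega>
  proof -
    have vT: "s + v \<in> T" using v by (auto simp: T_def)
    then have "m \<le> idx (s + v)" "idx (s + v) \<le> k" using ge_idx[OF vT] idx[OF vT] v K by auto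
    moreover from this have "(\<Sum>j\<in>{m..<idx (s + v)}. restrict (\<lambda>j. D j \<omega>) {m..<k} j) = (\<Sum>j\<in>{m..<idx (s + v)}. D j \<omega>)"
      by (intro sum.cong) auto
    ultimately show ?thesis
      using telescope[of m "idx (s + v)" "\<lambda>t. X t \<omega>" \<tau>] idx[OF vT] m by (simp add: D_def)
  qed
  let ?P = "\<Pi>\<^sub>M j\<in>{..<m}. (borel :: 'b measure)"
  let ?F = "\<Pi>\<^sub>M j\<in>{m..<k}. (borel :: 'b measure)"
  let ?p = "\<lambda>\<omega>. restrict (\<lambda>j. D j \<omega>) {..<m}" and ?f = "\<lambda>\<omega>. restrict (\<lambda>j. D j \<omega>) {m..<k}"
  define U where "U = {x\<in>space ?P. \<forall>u\<in>J. (\<Sum>j<idx (min s u). x j) \<in> E u}"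
  define U' where "U' = {x\<in>space ?F. \<forall>v\<in>K. (\<Sum>j\<in>{m..<idx (s + v)}. x j) \<in> E' v}"
  have U: "U \<in> sets ?P" unfolding U_def
  proof (rule sets.sets_Collect_finite_All[OF _ J(1)])
    fix u assume u: "u \<in> J"
    have "idx (min s u) \<le> m" using u by (intro le_idx) (auto simp: T_def)
    then have "(\<lambda>x. \<Sum>j<idx (min s u). x j) \<in> borel_measurable ?P"
      by (intro borel_measurable_sum measurable_component_singleton) auto
    from measurable_sets[OF this E[OF u]]
    show "{x \<in> space ?P. (\<Sum>j<idx (min s u). x j) \<in> E u} \<in> sets ?P" by (simp add: vimage_def Int_def conj_commute)
  qed
  have U': "U' \<in> sets ?F" unfolding U'_def
  proof (rule sets.sets_Collect_finite_All[OF _ K(1)])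
    fix v assume v: "v \<in> K"
    have "idx (s + v) \<le> k" using v idx[of "s + v"] by (auto simp: T_def)
    then have "(\<lambda>x. \<Sum>j\<in>{m..<idx (s + v)}. x j) \<in> borel_measurable ?F"
      by (intro borel_measurable_sum measurable_component_singleton) auto
    from measurable_sets[OF this E'[OF v]]
    show "{x \<in> space ?F. (\<Sum>j\<in>{m..<idx (s + v)}. x j) \<in> E' v} \<in> sets ?F" by (simp add: vimage_def Int_def conj_commute)
  qed
  have "indep_var ?P ?p ?F ?f"
    using m by (intro indep_var_restrict[OF D]) auto
  note indep_varD[OF this U U']
  moreover have "?p -` U \<inter> space M = {\<omega>\<in>space M. \<forall>u\<in>J. X (min s u) \<omega> - X 0 \<omega> \<in> E u}"
    by (auto simp: U_def space_PiM past)
  moreover have "?f -` U' \<inter> space M = {\<omega>\<in>space M. \<forall>v\<in>K. X (s + v) \<omega> - X s \<omega> \<in> E' v}"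
    by (auto simp: U'_def space_PiM future)
  moreover have "(\<lambda>\<omega>. (?p \<omega>, ?f \<omega>)) -` (U \<times> U') \<inter> space M = (?p -` U \<inter> space M) \<inter> (?f -` U' \<inter> space M)"
    by auto
  ultimately show ?thesis by simp
qed

text \<open>The increments are independent, and the law of each depends only on the length of its time
interval; so the joint law is the same product measure for every starting time.\<close>

lemma stationary_cylinders:
  assumes s: "0 \<le> s" and J: "finite J" "J \<subseteq> {0..}" and E: "\<And>u. u \<in> J \<Longrightarrow> E u \<in> sets borel"
  shows "prob {\<omega>\<in>space M. \<forall>u\<in>J. X (s + u) \<omega> - X s \<omega> \<in> E u} = prob {\<omega>\<in>space M. \<forall>u\<in>J. X u \<omega> - X 0 \<omega> \<in> E u}"
proof -
  have T: "finite (insert 0 J)" "insert 0 J \<subseteq> {0..}" "0 \<in> insert 0 J" using J by auto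
  obtain \<tau> :: "nat \<Rightarrow> real" and k :: nat and idx :: "real \<Rightarrow> nat" where
    \<tau>0: "\<tau> 0 = 0" and mono: "\<And>i j. i < j \<Longrightarrow> j \<le> k \<Longrightarrow> \<tau> i < \<tau> j"
    and idx: "\<And>u. u \<in> insert 0 J \<Longrightarrow> idx u \<le> k \<and> \<tau> (idx u) = u"
    by (rule finite_times_enumeration[OF T]) (rule that)
  have \<tau>_nonneg: "0 \<le> \<tau> j" if "j \<le> k" for j using mono[of 0 j] \<tau>0 that by (cases j) auto
  let ?P = "\<Pi>\<^sub>M j\<in>{..<k}. (borel :: 'b measure)"
  define U where "U = {x\<in>space ?P. \<forall>u\<in>J. (\<Sum>j<idx u. x j) \<in> E u}"
  have U: "U \<in> sets ?P" unfolding U_def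
  proof (rule sets.sets_Collect_finite_All[OF _ J(1)])
    fix u assume u: "u \<in> J"
    have "idx u \<le> k" using u idx by auto
    then have "(\<lambda>x. \<Sum>j<idx u. x j) \<in> borel_measurable ?P"
      by (intro borel_measurable_sum measurable_component_singleton) auto
    from measurable_sets[OF this E[OF u]]
    show "{x \<in> space ?P. (\<Sum>j<idx u. x j) \<in> E u} \<in> sets ?P" by (simp add: vimage_def Int_def conj_commute)
  qed
  have law: "emeasure M {\<omega>\<in>space M. \<forall>u\<in>J. X (r + u) \<omega> - X r \<omega> \<in> E u}
      = emeasure (\<Pi>\<^sub>M j\<in>{..<k}. distr M borel (X (\<tau> (Suc j) - \<tau> j))) U" if k: "k \<noteq> 0" and r: "0 \<le> r" for r
  proof -
    define D where "D j \<omega> = X (r + \<tau> (Suc j)) \<omega> - X (r + \<tau> j) \<omega>" for j \<omega>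
    have D: "indep_vars (\<lambda>_. borel) D {..<k}"
      using increments_indep[of r \<tau> k, OF r \<tau>0 mono] by (simp add: D_def[abs_def])
    have rv: "D j \<in> borel_measurable M" if "j < k" for j
      unfolding D_def[abs_def] using \<tau>_nonneg[of j] \<tau>_nonneg[of "Suc j"] r that
      by (intro borel_measurable_diff random_vector) auto
    have Dj: "distr M borel (D j) = distr M borel (X (\<tau> (Suc j) - \<tau> j))" if "j < k" for j
      using stationary_increments[of "r + \<tau> j" "\<tau> (Suc j) - \<tau> j"] r \<tau>_nonneg[of j] mono[of j "Suc j"] that
      by (simp add: D_def[abs_def] add.assoc)
    have "distr M ?P (\<lambda>\<omega>. \<lambda>j\<in>{..<k}. D j \<omega>) = (\<Pi>\<^sub>M j\<in>{..<k}. distr M borel (D j))"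
      using D k rv by (subst indep_vars_iff_distr_eq_PiM'[symmetric]) auto
    also have "\<dots> = (\<Pi>\<^sub>M j\<in>{..<k}. distr M borel (X (\<tau> (Suc j) - \<tau> j)))"
      by (intro PiM_cong refl Dj) auto
    finally have eq: "distr M ?P (\<lambda>\<omega>. \<lambda>j\<in>{..<k}. D j \<omega>) = (\<Pi>\<^sub>M j\<in>{..<k}. distr M borel (X (\<tau> (Suc j) - \<tau> j)))" .
    have sum: "X (r + u) \<omega> - X r \<omega> = (\<Sum>j<idx u. restrict (\<lambda>j. D j \<omega>) {..<k} j)" if u: "u \<in> J" for u \<omega>
    proof -
      have "idx u \<le> k" using idx u by auto
      then have "(\<Sum>j<idx u. restrict (\<lambda>j. D j \<omega>) {..<k} j) = (\<Sum>j\<in>{0..<idx u}. D j \<omega>)"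
        by (intro sum.cong) auto
      then show ?thesis
        using telescope[of 0 "idx u" "\<lambda>t. X (r + t) \<omega>" \<tau>] idx[of u] u \<tau>0 by (simp add: D_def)
    qed
    have "emeasure (\<Pi>\<^sub>M j\<in>{..<k}. distr M borel (X (\<tau> (Suc j) - \<tau> j))) U
      = emeasure M ((\<lambda>\<omega>. \<lambda>j\<in>{..<k}. D j \<omega>) -` U \<inter> space M)"
      unfolding eq[symmetric] using U rv by (intro emeasure_distr measurable_restrict) auto
    also have "(\<lambda>\<omega>. \<lambda>j\<in>{..<k}. D j \<omega>) -` U \<inter> space M = {\<omega>\<in>space M. \<forall>u\<in>J. X (r + u) \<omega> - X r \<omega> \<in> E u}"
      by (auto simp: U_def space_PiM sum)
    finally show ?thesis by simp
  qed
  show ?thesis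
  proof (cases "k = 0")
    case False
    then show ?thesis using law[OF False s] law[OF False order_refl] by (simp add: measure_def)
  next
    case True
    then have "u = 0" if "u \<in> J" for u using idx[of u] \<tau>0 that by auto
    then have "X (s + u) \<omega> - X s \<omega> = X u \<omega> - X 0 \<omega>" if "u \<in> J" for u \<omega> using that by force
    then show ?thesis by (intro arg_cong[of _ _ prob]) auto
  qed
qed

end

lemma sets_path_spaceE:
  assumes "A \<in> sets path_space"
  obtains B where "B \<in> sets (\<Pi>\<^sub>M t\<in>{0..}. borel)" "A = B \<inter> space path_space"
proof -
  obtain B where B: "B \<in> sets (\<Pi>\<^sub>M t\<in>{0..}. borel)" "A = {x. cadlag x \<and> x 0 = 0} \<inter> B"
    using assms by (auto simp: path_space_def sets_restrict_space)
  moreover have "B \<subseteq> extensional {0..}" using sets.sets_into_space[OF B(1)] by (auto simp: space_PiM PiE_def)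
  ultimately show ?thesis by (intro that[of B]) (auto simp: space_path_space)
qed

lemma vimage_path_space:
  assumes "f \<in> measurable N path_space" "A = B \<inter> space path_space"
  shows "f -` A \<inter> space N = f -` B \<inter> space N"
  using measurable_space[OF assms(1)] assms(2) by auto

lemma measurable_path_space_PiM:
  assumes "f \<in> measurable N path_space"
  shows "f \<in> measurable N (\<Pi>\<^sub>M t\<in>{0..}. borel)"
  using assms unfolding path_space_def by (simp add: measurable_restrict_space2_iff)

text \<open>Through \<open>prod_emb\<close>, events about finitely many coordinates turn into plain set comprehensions.\<close>

lemma vimage_prod_emb:
  assumes "f \<in> measurable N path_space" "J \<subseteq> {0..}"
  shows "f -` prod_emb {0..} (\<lambda>_. borel) J (Pi\<^sub>E J E) \<inter> space N = {\<omega>\<in>space N. \<forall>u\<in>J. f \<omega> u \<in> E u}"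
proof -
  have "f \<omega> \<in> prod_emb {0..} (\<lambda>_. borel) J (Pi\<^sub>E J E) \<longleftrightarrow> (\<forall>u\<in>J. f \<omega> u \<in> E u)" if "\<omega> \<in> space N" for \<omega>
    using measurable_space[OF measurable_path_space_PiM[OF assms(1)] that] assms(2)
    by (auto simp: prod_emb_def space_PiM PiE_iff)
  then show ?thesis by auto
qed

lemma path_law_eqI:
  assumes f: "f \<in> measurable N path_space" and g: "g \<in> measurable N' path_space" and "finite_measure N"
    and eq: "\<And>J E. finite J \<Longrightarrow> J \<subseteq> {0..} \<Longrightarrow> (\<And>u. u \<in> J \<Longrightarrow> E u \<in> sets borel) \<Longrightarrow>
      emeasure N {\<omega>\<in>space N. \<forall>u\<in>J. f \<omega> u \<in> E u} = emeasure N' {\<omega>\<in>space N'. \<forall>u\<in>J. g \<omega> u \<in> E u}"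
  shows "distr N path_space f = distr N' path_space (g :: 'c \<Rightarrow> real \<Rightarrow> 'b::euclidean_space)"
proof (rule measure_eqI)
  let ?P = "\<Pi>\<^sub>M t\<in>{0::real..}. (borel :: 'b measure)"
  note f' = measurable_path_space_PiM[OF f] and g' = measurable_path_space_PiM[OF g]
  have PiM_eq: "distr N ?P f = distr N' ?P g"
  proof (rule measure_eqI_PiM_infinite)
    interpret finite_measure N by fact
    show "finite_measure (distr N ?P f)" by (rule finite_measure_distr[OF f'])
    fix J :: "real set" and E :: "real \<Rightarrow> 'b set" assume J: "finite J" "J \<subseteq> {0..}" and E: "\<And>u. u \<in> J \<Longrightarrow> E u \<in> sets borel"
    have "prod_emb {0..} (\<lambda>_. borel) J (Pi\<^sub>E J E) \<in> sets ?P"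
      using J E by (intro sets_PiM_I) auto
    then show "emeasure (distr N ?P f) (prod_emb {0..} (\<lambda>t. borel) J (Pi\<^sub>E J E)) = emeasure (distr N' ?P g) (prod_emb {0..} (\<lambda>t. borel) J (Pi\<^sub>E J E))"
      by (simp add: emeasure_distr f' g' vimage_prod_emb[OF f J(2)] vimage_prod_emb[OF g J(2)] eq[OF J E])
  qed auto
  fix A :: "(real \<Rightarrow> 'b) set" assume "A \<in> sets (distr N path_space f)"
  then have A: "A \<in> sets path_space" by simp
  then obtain B where B: "B \<in> sets ?P" "A = B \<inter> space path_space" by (rule sets_path_spaceE)
  have "emeasure N (f -` A \<inter> space N) = emeasure N' (g -` A \<inter> space N')"
    using arg_cong[OF PiM_eq, of "\<lambda>M. emeasure M B"] B(1)
    by (simp add: emeasure_distr f' g' vimage_path_space[OF f B(2)] vimage_path_space[OF g B(2)])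
  then show "emeasure (distr N path_space f) A = emeasure (distr N' path_space g) A"
    by (simp add: emeasure_distr f g A)
qed simp

lemma sigma_sets_path_space:
  assumes f: "f \<in> measurable N path_space"
  shows "{f -` A \<inter> space N | A. A \<in> sets path_space} =
    sigma_sets (space N) {f -` A \<inter> space N | A. A \<in> prod_algebra {0..} (\<lambda>_. borel)}"
proof -
  let ?P = "\<Pi>\<^sub>M t\<in>{0..}. borel"
  have "{f -` A \<inter> space N | A. A \<in> sets path_space} = {f -` A \<inter> space N | A. A \<in> sets ?P}"
  proof (intro set_eqI iffI)
    fix S assume "S \<in> {f -` A \<inter> space N | A. A \<in> sets path_space}"
    then obtain A where A: "S = f -` A \<inter> space N" "A \<in> sets path_space" by blast
    obtain B where B: "B \<in> sets ?P" "A = B \<inter> space path_space" using A(2) by (rule sets_path_spaceE)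
    show "S \<in> {f -` A \<inter> space N | A. A \<in> sets ?P}" using vimage_path_space[OF f B(2)] A(1) B(1) by blast
  next
    fix S assume "S \<in> {f -` A \<inter> space N | A. A \<in> sets ?P}"
    then obtain B where B: "S = f -` B \<inter> space N" "B \<in> sets ?P" by blast
    have "{x. cadlag x \<and> x 0 = 0} \<inter> B \<in> sets path_space"
      using B(2) by (auto simp: path_space_def sets_restrict_space)
    moreover have "f -` ({x. cadlag x \<and> x 0 = 0} \<inter> B) \<inter> space N = S"
      using measurable_space[OF f] B(1) by (auto simp: space_path_space)
    ultimately show "S \<in> {f -` A \<inter> space N | A. A \<in> sets path_space}" by blast
  qed
  also have "\<dots> = sigma_sets (space N) {f -` A \<inter> space N | A. A \<in> prod_algebra {0..} (\<lambda>_. borel)}"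
    unfolding sets_PiM
    using measurable_space[OF measurable_path_space_PiM[OF f]]
    by (intro sigma_sets_vimage_commute) (auto simp: space_PiM)
  finally show ?thesis .
qed

lemma (in prob_space) indep_var_path_spaceI:
  fixes f g :: "'a \<Rightarrow> real \<Rightarrow> 'b::euclidean_space"
  assumes f: "f \<in> measurable M path_space" and g: "g \<in> measurable M path_space"
    and cyl: "\<And>J E K E'. finite J \<Longrightarrow> J \<subseteq> {0..} \<Longrightarrow> (\<And>u. u \<in> J \<Longrightarrow> E u \<in> sets borel) \<Longrightarrow>
      finite K \<Longrightarrow> K \<subseteq> {0..} \<Longrightarrow> (\<And>v. v \<in> K \<Longrightarrow> E' v \<in> sets borel) \<Longrightarrow>
      prob ({\<omega>\<in>space M. \<forall>u\<in>J. f \<omega> u \<in> E u} \<inter> {\<omega>\<in>space M. \<forall>v\<in>K. g \<omega> v \<in> E' v})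
      = prob {\<omega>\<in>space M. \<forall>u\<in>J. f \<omega> u \<in> E u} * prob {\<omega>\<in>space M. \<forall>v\<in>K. g \<omega> v \<in> E' v}"
  shows "indep_var path_space f path_space g"
proof -
  let ?A = "prod_algebra {0::real..} (\<lambda>_. borel :: 'b measure)"
  let ?G = "\<lambda>f. {f -` A \<inter> space M | A. A \<in> ?A}"
  have Int: "Int_stable (?G f)" for f :: "'a \<Rightarrow> real \<Rightarrow> 'b"
  proof (rule Int_stableI)
    fix a b assume "a \<in> ?G f" "b \<in> ?G f"
    then obtain A B where "A \<in> ?A" "B \<in> ?A" "a = f -` A \<inter> space M" "b = f -` B \<inter> space M" by blast
    then show "a \<inter> b \<in> ?G f"
      using Int_stable_prod_algebra[of "{0..}" "\<lambda>_. borel"]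
      by (intro CollectI exI[of _ "A \<inter> B"]) (auto simp: Int_stable_def)
  qed
  have events: "?G f \<subseteq> events" if "f \<in> measurable M path_space" for f :: "'a \<Rightarrow> real \<Rightarrow> 'b"
    using measurable_sets[OF measurable_path_space_PiM[OF that]] by (auto simp: sets_PiM intro: sigma_sets.Basic)
  have "indep_set (?G f) (?G g)"
  proof (rule indep_setI)
    fix a b assume "a \<in> ?G f" "b \<in> ?G g"
    then obtain A B where AB: "A \<in> ?A" "B \<in> ?A" "a = f -` A \<inter> space M" "b = g -` B \<inter> space M" by blast
    obtain J E where J: "A = prod_emb {0..} (\<lambda>_. borel) J (Pi\<^sub>E J E)" "finite J" "J \<subseteq> {0..}" "\<And>u. u \<in> J \<Longrightarrow> E u \<in> sets borel"
      using AB(1) by (elim prod_algebraE) auto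
    obtain K E' where K: "B = prod_emb {0..} (\<lambda>_. borel) K (Pi\<^sub>E K E')" "finite K" "K \<subseteq> {0..}" "\<And>u. u \<in> K \<Longrightarrow> E' u \<in> sets borel"
      using AB(2) by (elim prod_algebraE) auto
    show "prob (a \<inter> b) = prob a * prob b"
      unfolding AB(3,4) J(1) K(1) vimage_prod_emb[OF f J(3)] vimage_prod_emb[OF g K(3)]
      by (rule cyl[OF J(2,3,4) K(2,3,4)])
  qed (use events f g in auto)
  have idem: "sigma_sets (space M) (sigma_sets (space M) (?G f)) = sigma_sets (space M) (?G f)" for f :: "'a \<Rightarrow> real \<Rightarrow> 'b"
    by (rule sigma_sets_sigma_sets_eq) auto
  from indep_set_sigma_sets[OF \<open>indep_set (?G f) (?G g)\<close> Int Int] show ?thesis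
    unfolding indep_var_eq sigma_sets_path_space[OF f] sigma_sets_path_space[OF g]
    using f g by (simp add: idem)
qed

text \<open>The Markov property of a Levy process in the form in which it enters every later argument: for each
fixed time the path before it and the restarted path after it are independent, and the latter has
the law of the whole path.\<close>

locale levy_path_law = prob_space P for P :: "(real \<Rightarrow> real^'n) measure" +
  assumes sets_P: "sets P = sets path_space"
    and distr_stop_shift: "0 \<le> s \<Longrightarrow> distr P (path_space \<Otimes>\<^sub>M path_space) (\<lambda>x. (stop s x, shift s x))
      = distr P path_space (stop s) \<Otimes>\<^sub>M P"

context levy_process
begin

text \<open>Subtracting \<open>X 0\<close>, which vanishes only almost surely, puts every path into \<open>path_space\<close>.\<close>

definition path :: "'a \<Rightarrow> real \<Rightarrow> 'b" where
  "path \<omega> = (\<lambda>t\<in>{0..}. X t \<omega> - X 0 \<omega>)"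

lemma measurable_path: "path \<in> measurable M path_space"
proof (rule measurable_path_spaceI)
  show "path \<omega> \<in> space path_space" if "\<omega> \<in> space M" for \<omega>
    using cadlag_diff_const[OF cadlag_paths[OF that], of "X 0 \<omega>"]
      cadlag_cong[of "path \<omega>" "\<lambda>t. X t \<omega> - X 0 \<omega>"] by (auto simp: space_path_space path_def)
  show "(\<lambda>\<omega>. path \<omega> t) \<in> borel_measurable M" if "0 \<le> t" for t
    using that by (auto simp: path_def intro!: borel_measurable_diff random_vector)
qed

lemma stop_path: "0 \<le> t \<Longrightarrow> 0 \<le> s \<Longrightarrow> stop s (path \<omega>) t = X (min s t) \<omega> - X 0 \<omega>"
  by (simp add: stop_def path_def)

lemma shift_path: "0 \<le> t \<Longrightarrow> 0 \<le> s \<Longrightarrow> shift s (path \<omega>) t = X (s + t) \<omega> - X s \<omega>"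
  by (simp add: shift_def path_def)

lemma distr_shift_path:
  assumes s: "0 \<le> s"
  shows "distr M path_space (\<lambda>\<omega>. shift s (path \<omega>)) = distr M path_space path"
proof (rule path_law_eqI)
  show "(\<lambda>\<omega>. shift s (path \<omega>)) \<in> measurable M path_space"
    using measurable_compose[OF measurable_path measurable_shift[OF s]] .
  show "path \<in> measurable M path_space" by (rule measurable_path)
  show "finite_measure M" by unfold_locales
  fix J :: "real set" and E :: "real \<Rightarrow> 'b set" assume J: "finite J" "J \<subseteq> {0..}" and E: "\<And>u. u \<in> J \<Longrightarrow> E u \<in> sets borel"
  have "{\<omega>\<in>space M. \<forall>u\<in>J. shift s (path \<omega>) u \<in> E u} = {\<omega>\<in>space M. \<forall>u\<in>J. X (s + u) \<omega> - X s \<omega> \<in> E u}"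
    using J(2) s by (auto simp: shift_path subset_eq)
  moreover have "{\<omega>\<in>space M. \<forall>u\<in>J. path \<omega> u \<in> E u} = {\<omega>\<in>space M. \<forall>u\<in>J. X u \<omega> - X 0 \<omega> \<in> E u}"
    using J(2) by (auto simp: path_def subset_eq)
  ultimately show "emeasure M {\<omega>\<in>space M. \<forall>u\<in>J. shift s (path \<omega>) u \<in> E u} = emeasure M {\<omega>\<in>space M. \<forall>u\<in>J. path \<omega> u \<in> E u}"
    using stationary_cylinders[OF s J E] by (simp add: emeasure_eq_measure)
qed

lemma indep_stop_shift_path:
  assumes s: "0 \<le> s"
  shows "indep_var path_space (\<lambda>\<omega>. stop s (path \<omega>)) path_space (\<lambda>\<omega>. shift s (path \<omega>))"
proof (rule indep_var_path_spaceI)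
  show "(\<lambda>\<omega>. stop s (path \<omega>)) \<in> measurable M path_space"
    using measurable_compose[OF measurable_path measurable_stop[OF s]] .
  show "(\<lambda>\<omega>. shift s (path \<omega>)) \<in> measurable M path_space"
    using measurable_compose[OF measurable_path measurable_shift[OF s]] .
  fix J K :: "real set" and E E' :: "real \<Rightarrow> 'b set"
  assume J: "finite J" "J \<subseteq> {0..}" and E: "\<And>u. u \<in> J \<Longrightarrow> E u \<in> sets borel"
    and K: "finite K" "K \<subseteq> {0..}" and E': "\<And>u. u \<in> K \<Longrightarrow> E' u \<in> sets borel"
  have "{\<omega>\<in>space M. \<forall>u\<in>J. stop s (path \<omega>) u \<in> E u} = {\<omega>\<in>space M. \<forall>u\<in>J. X (min s u) \<omega> - X 0 \<omega> \<in> E u}"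
    using J(2) s by (auto simp: stop_path subset_eq)
  moreover have "{\<omega>\<in>space M. \<forall>u\<in>K. shift s (path \<omega>) u \<in> E' u} = {\<omega>\<in>space M. \<forall>u\<in>K. X (s + u) \<omega> - X s \<omega> \<in> E' u}"
    using K(2) s by (auto simp: shift_path subset_eq)
  ultimately show "prob ({\<omega>\<in>space M. \<forall>u\<in>J. stop s (path \<omega>) u \<in> E u} \<inter> {\<omega>\<in>space M. \<forall>u\<in>K. shift s (path \<omega>) u \<in> E' u})
      = prob {\<omega>\<in>space M. \<forall>u\<in>J. stop s (path \<omega>) u \<in> E u} * prob {\<omega>\<in>space M. \<forall>u\<in>K. shift s (path \<omega>) u \<in> E' u}"
    using indep_past_future_cylinders[OF s J K E E'] by simp
qed

end

lemma levy_path_law_distr_path: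
  assumes "levy_process M (X :: real \<Rightarrow> 'a \<Rightarrow> real^'n)"
  shows "levy_path_law (distr M path_space (levy_process.path X))"
proof -
  interpret levy_process M X by fact
  let ?P = "distr M path_space path"
  interpret P: prob_space ?P by (rule prob_space_distr[OF measurable_path])
  show ?thesis
  proof
    fix s :: real assume s: "0 \<le> s"
    have "distr ?P (path_space \<Otimes>\<^sub>M path_space) (\<lambda>x. (stop s x, shift s x))
      = distr M (path_space \<Otimes>\<^sub>M path_space) (\<lambda>\<omega>. (stop s (path \<omega>), shift s (path \<omega>)))"
      using measurable_Pair[OF measurable_stop[OF s] measurable_shift[OF s]] measurable_path
      by (subst distr_distr) (auto simp: comp_def)
    also have "\<dots> = distr M path_space (\<lambda>\<omega>. stop s (path \<omega>)) \<Otimes>\<^sub>M distr M path_space (\<lambda>\<omega>. shift s (path \<omega>))"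
      using indep_stop_shift_path[OF s] unfolding indep_var_distribution_eq by simp
    also have "distr M path_space (\<lambda>\<omega>. stop s (path \<omega>)) = distr ?P path_space (stop s)"
      using measurable_stop[OF s] measurable_path by (subst distr_distr) (auto simp: comp_def)
    also have "distr M path_space (\<lambda>\<omega>. shift s (path \<omega>)) = ?P" by (rule distr_shift_path[OF s])
    finally show "distr ?P (path_space \<Otimes>\<^sub>M path_space) (\<lambda>x. (stop s x, shift s x))
      = distr ?P path_space (stop s) \<Otimes>\<^sub>M ?P" .
  qed simp
qed

section \<open>Measurability of reflected paths\<close>

lemma running_max_le_iff_rational:
  assumes t: "0 \<le> t" and bound: "\<And>s. s \<in> {0..t} \<Longrightarrow> f s \<le> B"
    and rc: "\<And>s. 0 \<le> s \<Longrightarrow> (f \<longlongrightarrow> f s) (at_right s)"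
  shows "running_max f t \<le> c \<longleftrightarrow> 0 \<le> c \<and> (\<forall>s\<in>insert t (\<rat> \<inter> {0..t}). f s \<le> c)"
proof -
  have "f s \<le> c" if rat: "\<forall>s\<in>insert t (\<rat> \<inter> {0..t}). f s \<le> c" and s: "s \<in> {0..t}" for s
  proof (rule ccontr)
    assume "\<not> f s \<le> c"
    then have "c < f s" by simp
    then have "\<forall>\<^sub>F r in at_right s. c < f r" using order_tendstoD(1)[OF rc[of s]] s by simp
    then obtain b where b: "s < b" "\<And>r. s < r \<Longrightarrow> r < b \<Longrightarrow> c < f r"
      unfolding eventually_at_right_ex by blast
    have "s < t" using \<open>\<not> f s \<le> c\<close> rat s by (cases "s = t") auto
    then obtain q where "q \<in> \<rat>" "s < q" "q < min b t"
      using Rats_dense_in_real[of s "min b t"] b(1) by auto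
    then show False using b(2)[of q] rat s by force
  qed
  then have "(\<forall>s\<in>insert t (\<rat> \<inter> {0..t}). f s \<le> c) \<longleftrightarrow> (\<forall>s\<in>{0..t}. f s \<le> c)"
    using t by (intro iffI ballI) (blast, auto)
  then show ?thesis using running_max_le_iff[of t f B c, OF t bound] by simp
qed

lemma borel_measurable_running_max:
  assumes t: "0 \<le> t" and meas: "\<And>u. 0 \<le> u \<Longrightarrow> f u \<in> borel_measurable N"
    and bound: "\<And>\<omega>. \<omega> \<in> space N \<Longrightarrow> \<exists>B. \<forall>u\<in>{0..t}. f u \<omega> \<le> B"
    and rc: "\<And>\<omega> s. \<omega> \<in> space N \<Longrightarrow> 0 \<le> s \<Longrightarrow> ((\<lambda>u. f u \<omega>) \<longlongrightarrow> f s \<omega>) (at_right s)"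
  shows "(\<lambda>\<omega>. running_max (\<lambda>u. f u \<omega>) t) \<in> borel_measurable N"
  unfolding borel_measurable_iff_le
proof
  fix c
  have eq: "running_max (\<lambda>u. f u \<omega>) t \<le> c \<longleftrightarrow> 0 \<le> c \<and> (\<forall>s\<in>insert t (\<rat> \<inter> {0..t}). f s \<omega> \<le> c)"
    if \<omega>: "\<omega> \<in> space N" for \<omega>
  proof -
    obtain B where "\<forall>u\<in>{0..t}. f u \<omega> \<le> B" using bound[OF \<omega>] by blast
    then show ?thesis using rc[OF \<omega>] by (intro running_max_le_iff_rational[OF t, of _ B]) auto
  qed
  have "{\<omega> \<in> space N. 0 \<le> c \<and> (\<forall>s\<in>insert t (\<rat> \<inter> {0..t}). f s \<omega> \<le> c)} \<in> sets N"
  proof (intro sets.sets_Collect_conj sets.sets_Collect_countable_All' sets.sets_Collect_const)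
    show "countable (insert t (\<rat> \<inter> {0..t}))" by (intro countable_insert countable_Int1 countable_rat)
    fix s assume "s \<in> insert t (\<rat> \<inter> {0..t})"
    then have "0 \<le> s" using t by auto
    then show "{\<omega> \<in> space N. f s \<omega> \<le> c} \<in> sets N" using meas[of s] by (simp add: borel_measurable_iff_le)
  qed
  moreover have "{\<omega> \<in> space N. running_max (\<lambda>u. f u \<omega>) t \<le> c} =
      {\<omega> \<in> space N. 0 \<le> c \<and> (\<forall>s\<in>insert t (\<rat> \<inter> {0..t}). f s \<omega> \<le> c)}"
    using eq by auto
  ultimately show "{\<omega> \<in> space N. running_max (\<lambda>u. f u \<omega>) t \<le> c} \<in> sets N" by (simp only:)
qed

lemma running_max_right_continuous:
  assumes t: "0 \<le> t" and bound: "\<And>T. \<exists>B. \<forall>u\<in>{0..T}. f u \<le> B"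
    and rc: "(f \<longlongrightarrow> f t) (at_right t)"
  shows "(running_max f \<longlongrightarrow> running_max f t) (at_right t)"
proof (rule tendstoI)
  fix e :: real assume e: "0 < e"
  have "\<forall>\<^sub>F s in at_right t. f s < f t + e / 2" using order_tendstoD(2)[OF rc] e by simp
  then obtain b where b: "t < b" "\<And>s. t < s \<Longrightarrow> s < b \<Longrightarrow> f s < f t + e / 2"
    unfolding eventually_at_right_ex by blast
  obtain B where B: "\<And>u. u \<in> {0..b} \<Longrightarrow> f u \<le> B" using bound by blast
  have "dist (running_max f s) (running_max f t) < e" if s: "t < s" "s < b" for s
  proof -
    have Bs: "f u \<le> B" if "u \<in> {0..s}" for u using B that s by auto
    have Bt: "f u \<le> B" if "u \<in> {0..t}" for u using B that b by auto
    have s0: "0 \<le> s" using s t by simp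
    have "\<forall>u\<in>{0..t}. f u \<le> running_max f s"
      using running_max_ge(2)[of s f B, OF s0 Bs] s by simp
    then have "running_max f t \<le> running_max f s"
      using running_max_le_iff[of t f B "running_max f s", OF t Bt] running_max_ge(1)[of s f B, OF s0 Bs] by blast
    moreover have "f u \<le> running_max f t + e / 2" if u: "u \<in> {0..s}" for u
    proof (cases "u \<le> t")
      case True
      then show ?thesis using running_max_ge(2)[of t f B u, OF t Bt] u e by simp
    next
      case False
      then show ?thesis using b(2)[of u] u s running_max_ge(2)[of t f B t, OF t Bt] t by simp
    qed
    then have "running_max f s \<le> running_max f t + e / 2"
      using running_max_le_iff[of s f B "running_max f t + e / 2", OF s0 Bs]
        running_max_ge(1)[of t f B, OF t Bt] e by simp
    ultimately show ?thesis using e by (simp add: dist_real_def)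
  qed
  then show "\<forall>\<^sub>F s in at_right t. dist (running_max f s) (running_max f t) < e"
    unfolding eventually_at_right_ex using b(1) by blast
qed

lemma borel_measurable_vecI:
  fixes f :: "'a \<Rightarrow> real^'n"
  assumes "\<And>i. (\<lambda>x. f x $ i) \<in> borel_measurable M"
  shows "f \<in> borel_measurable M"
  unfolding borel_measurable_euclidean_space[of f] using assms
  by (auto simp: Basis_vec_def inner_axis)

lemma borel_measurable_vec_nth:
  fixes f :: "'a \<Rightarrow> real^'n"
  assumes "f \<in> borel_measurable M"
  shows "(\<lambda>x. f x $ i) \<in> borel_measurable M"
  by (rule borel_measurable_continuous_on[OF _ assms]) (intro continuous_intros)

lemma borel_measurable_matrix_vector:
  fixes f :: "'a \<Rightarrow> real^'n" and A :: "real^'n^'m"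
  assumes "f \<in> borel_measurable M"
  shows "(\<lambda>x. A *v f x) \<in> borel_measurable M"
  by (rule borel_measurable_continuous_on[OF _ assms]) (intro linear_continuous_on matrix_vector_mul_bounded_linear)

lemma (in reflection) borel_measurable_iterate:
  fixes Y :: "real \<Rightarrow> 'a \<Rightarrow> real^'n"
  assumes meas: "\<And>u. 0 \<le> u \<Longrightarrow> Y u \<in> borel_measurable N"
    and cadlag: "\<And>\<omega>. \<omega> \<in> space N \<Longrightarrow> cadlag (\<lambda>u. Y u \<omega>)" and t: "0 \<le> t"
  shows "(\<lambda>\<omega>. iterate (\<lambda>u. Y u \<omega>) k t) \<in> borel_measurable N"
    and "\<omega> \<in> space N \<Longrightarrow> (iterate (\<lambda>u. Y u \<omega>) k \<longlongrightarrow> iterate (\<lambda>u. Y u \<omega>) k t) (at_right t)"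
proof -
  have "(\<forall>t\<ge>0. (\<lambda>\<omega>. iterate (\<lambda>u. Y u \<omega>) k t) \<in> borel_measurable N) \<and>
    (\<forall>t\<ge>0. \<forall>\<omega>\<in>space N. (iterate (\<lambda>u. Y u \<omega>) k \<longlongrightarrow> iterate (\<lambda>u. Y u \<omega>) k t) (at_right t))"
  proof (induction k)
    case (Suc k)
    define f where "f i u \<omega> = (A *v iterate (\<lambda>u. Y u \<omega>) k u - Y u \<omega>) $ i" for i u \<omega>
    have f: "f i u \<in> borel_measurable N" if "0 \<le> u" for i u
      unfolding f_def[abs_def] using Suc.IH meas that
      by (intro borel_measurable_vec_nth borel_measurable_diff borel_measurable_matrix_vector) auto
    have rc: "((\<lambda>u. f i u \<omega>) \<longlongrightarrow> f i s \<omega>) (at_right s)" if "\<omega> \<in> space N" "0 \<le> s" for i \<omega> s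
      unfolding f_def using Suc.IH cadlag[OF that(1)] that
      by (intro tendsto_vec_nth tendsto_diff tendsto_matrix_vector) (auto simp: cadlag_def)
    have bound: "\<exists>B. \<forall>u\<in>{0..T}. f i u \<omega> \<le> B" if \<omega>: "\<omega> \<in> space N" for i \<omega> T
    proof -
      obtain B where B: "0 \<le> B" "\<And>s i. s \<in> {0..T} \<Longrightarrow> \<bar>Y s \<omega> $ i\<bar> \<le> B"
        by (rule locally_boundedE[OF cadlag_locally_bounded[OF cadlag[OF \<omega>]]]) (rule that)
      show ?thesis
        using iterate_bounds(3)[of B T "\<lambda>u. Y u \<omega>" _ k i, OF B] unfolding f_def by blast
    qed
    have Suc_eq: "iterate (\<lambda>u. Y u \<omega>) (Suc k) t $ i = running_max (\<lambda>u. f i u \<omega>) t" for \<omega> t i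
      by (simp add: f_def)
    show ?case
    proof (intro conjI allI impI ballI)
      show "(\<lambda>\<omega>. iterate (\<lambda>u. Y u \<omega>) (Suc k) t) \<in> borel_measurable N" if "0 \<le> t" for t
        by (rule borel_measurable_vecI) (unfold Suc_eq, intro borel_measurable_running_max f rc bound that)
      show "(iterate (\<lambda>u. Y u \<omega>) (Suc k) \<longlongrightarrow> iterate (\<lambda>u. Y u \<omega>) (Suc k) t) (at_right t)"
        if "0 \<le> t" "\<omega> \<in> space N" for t \<omega>
        by (rule vec_tendstoI) (unfold Suc_eq, intro running_max_right_continuous rc bound that)
    qed
  qed auto
  then show "(\<lambda>\<omega>. iterate (\<lambda>u. Y u \<omega>) k t) \<in> borel_measurable N"
    and "\<omega> \<in> space N \<Longrightarrow> (iterate (\<lambda>u. Y u \<omega>) k \<longlongrightarrow> iterate (\<lambda>u. Y u \<omega>) k t) (at_right t)"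
    using t by auto
qed

text \<open>The reflected path is built by countably many running maxima and a limit, and for right
continuous paths a running maximum is a supremum over rational times.\<close>

lemma (in reflection) borel_measurable_reflect:
  fixes Y :: "real \<Rightarrow> 'a \<Rightarrow> real^'n"
  assumes meas: "\<And>u. 0 \<le> u \<Longrightarrow> Y u \<in> borel_measurable N"
    and cadlag: "\<And>\<omega>. \<omega> \<in> space N \<Longrightarrow> cadlag (\<lambda>u. Y u \<omega>)" and t: "0 \<le> t"
  shows "(\<lambda>\<omega>. reflect (\<lambda>u. Y u \<omega>) t) \<in> borel_measurable N"
proof -
  have "(\<lambda>\<omega>. regulator (\<lambda>u. Y u \<omega>) t) \<in> borel_measurable N"
  proof (rule borel_measurable_LIMSEQ_metric)
    show "(\<lambda>\<omega>. iterate (\<lambda>u. Y u \<omega>) k t) \<in> borel_measurable N" for k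
      by (rule borel_measurable_iterate(1)[OF meas cadlag t])
    show "(\<lambda>k. iterate (\<lambda>u. Y u \<omega>) k t) \<longlonglongrightarrow> regulator (\<lambda>u. Y u \<omega>) t" if "\<omega> \<in> space N" for \<omega>
      by (rule iterate_tendsto(1)[OF cadlag_locally_bounded[OF cadlag[OF that]] t])
  qed
  then show ?thesis
    unfolding reflect_def using meas[OF t]
    by (intro borel_measurable_add borel_measurable_diff borel_measurable_matrix_vector) auto
qed

section \<open>Forward and backward iteration\<close>

lemma distr_pair_snd:
  assumes "prob_space N" "sigma_finite_measure M"
  shows "distr (N \<Otimes>\<^sub>M M) M snd = M"
proof (rule measure_eqI)
  interpret N: prob_space N by fact
  interpret M: sigma_finite_measure M by fact
  fix A assume "A \<in> sets (distr (N \<Otimes>\<^sub>M M) M snd)"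
  then have A: "A \<in> sets M" by simp
  have "snd -` A \<inter> space (N \<Otimes>\<^sub>M M) = space N \<times> A"
    using sets.sets_into_space[OF A] by (auto simp: space_pair_measure)
  then show "emeasure (distr (N \<Otimes>\<^sub>M M) M snd) A = emeasure M A"
    using A by (simp add: emeasure_distr M.emeasure_pair_measure_Times N.emeasure_space_1)
qed simp

text \<open>The state after \<open>n\<close> unit time steps, when \<open>step\<close> updates it by the increments over one unit of
time.\<close>

primrec forward :: "('s \<Rightarrow> (real \<Rightarrow> 'b::euclidean_space) \<Rightarrow> 's) \<Rightarrow> 's \<Rightarrow> nat \<Rightarrow> (real \<Rightarrow> 'b) \<Rightarrow> 's" where
  "forward step s 0 x = s"
| "forward step s (Suc n) x = step (forward step s n x) (shift (real n) x)"

text \<open>The same steps with the unit blocks of the path in reversed order: the block that is used last is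
always \<open>[0,1]\<close>, so passing from \<open>n\<close> to \<open>n + 1\<close> prepends a step. This is the device of Loynes: for
monotone \<open>step\<close> the backward iterates increase pathwise, whereas the forward iterates only
converge in law.\<close>

primrec backward :: "('s \<Rightarrow> (real \<Rightarrow> 'b::euclidean_space) \<Rightarrow> 's) \<Rightarrow> 's \<Rightarrow> nat \<Rightarrow> (real \<Rightarrow> 'b) \<Rightarrow> 's" where
  "backward step s 0 x = s"
| "backward step s (Suc n) x = step (backward step s n (shift 1 x)) x"

context levy_path_law
begin

lemma space_P: "space P = space path_space"
  by (rule sets_eq_imp_space_eq[OF sets_P])

lemma measurable_P: "measurable P N = measurable path_space N"
  by (rule measurable_cong_sets[OF sets_P refl])

lemma distr_shift:
  assumes "0 \<le> s" shows "distr P path_space (shift s) = P"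
proof -
  interpret S: prob_space "distr P path_space (stop s)"
    by (rule prob_space_distr) (simp add: measurable_P measurable_stop assms)
  have "distr P path_space (shift s) = distr (distr P (path_space \<Otimes>\<^sub>M path_space) (\<lambda>x. (stop s x, shift s x))) path_space snd"
    using measurable_Pair[OF measurable_stop[OF assms] measurable_shift[OF assms]]
    by (subst distr_distr) (auto simp: comp_def measurable_P)
  also have "\<dots> = distr (distr P path_space (stop s) \<Otimes>\<^sub>M P) path_space snd"
    by (simp add: distr_stop_shift[OF assms])
  also have "\<dots> = P"
    using distr_pair_snd[OF S.prob_space_axioms sigma_finite_measure_axioms]
    by (simp add: distr_cong[OF refl sets_P])
  finally show ?thesis .
qed

lemma indep_stop_shift: "0 \<le> s \<Longrightarrow> indep_var path_space (stop s) path_space (shift s)"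
  unfolding indep_var_distribution_eq
  by (simp add: measurable_P measurable_stop measurable_shift distr_shift distr_stop_shift)

text \<open>The path after time \<open>s\<close> may be replaced by an independent copy.\<close>

lemma distr_restart:
  assumes s: "0 \<le> s" and g: "g \<in> measurable (path_space \<Otimes>\<^sub>M path_space) S"
  shows "distr P S (\<lambda>x. g (stop s x, shift s x)) = distr (P \<Otimes>\<^sub>M P) S (\<lambda>(y, z). g (stop s y, z))"
proof -
  interpret PP: pair_prob_space P P ..
  have id: "distr P path_space (\<lambda>x. x) = P" by (rule distr_id2[OF sets_P[symmetric]])
  interpret D: prob_space "distr P path_space (\<lambda>x. x)" unfolding id by (rule prob_space_axioms)
  have "distr P S (\<lambda>x. g (stop s x, shift s x)) = distr (distr P (path_space \<Otimes>\<^sub>M path_space) (\<lambda>x. (stop s x, shift s x))) S g"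
    using measurable_Pair[OF measurable_stop[OF s] measurable_shift[OF s]] g
    by (subst distr_distr) (auto simp: comp_def measurable_P)
  also have "distr P (path_space \<Otimes>\<^sub>M path_space) (\<lambda>x. (stop s x, shift s x)) = distr P path_space (stop s) \<Otimes>\<^sub>M distr P path_space (\<lambda>x. x)"
    by (simp add: distr_stop_shift[OF s] id)
  also have "\<dots> = distr (P \<Otimes>\<^sub>M P) (path_space \<Otimes>\<^sub>M path_space) (\<lambda>(y, z). (stop s y, z))"
    using measurable_stop[OF s] D.sigma_finite_measure_axioms
    by (intro pair_measure_distr) (auto simp: measurable_P)
  also have "distr \<dots> S g = distr (P \<Otimes>\<^sub>M P) S (\<lambda>(y, z). g (stop s y, z))"
  proof (subst distr_distr[OF g])
    have "sets (P \<Otimes>\<^sub>M P) = sets (path_space \<Otimes>\<^sub>M path_space)" by (intro sets_pair_measure_cong sets_P)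
    then show "(\<lambda>(y, z). (stop s y, z)) \<in> P \<Otimes>\<^sub>M P \<rightarrow>\<^sub>M path_space \<Otimes>\<^sub>M path_space"
      using measurable_stop[OF s] by (subst measurable_cong_sets[OF _ refl]) (auto simp: measurable_split_conv intro!: measurable_Pair measurable_compose[OF measurable_fst])
  qed (auto simp: comp_def case_prod_beta')
  finally show ?thesis .
qed

lemma distr_pair_map:
  assumes h: "h \<in> measurable path_space S" and g: "g \<in> measurable (S \<Otimes>\<^sub>M path_space) T"
  shows "distr (P \<Otimes>\<^sub>M P) T (\<lambda>(y, z). g (h y, z)) = distr (distr P S h \<Otimes>\<^sub>M P) T g"
proof -
  note sets_PP = sets_pair_measure_cong[OF sets_P sets_P]
  have id: "distr P path_space (\<lambda>x. x) = P" by (rule distr_id2[OF sets_P[symmetric]])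
  have "distr P S h \<Otimes>\<^sub>M distr P path_space (\<lambda>x. x) = distr (P \<Otimes>\<^sub>M P) (S \<Otimes>\<^sub>M path_space) (\<lambda>(y, z). (h y, z))"
    using h by (intro pair_measure_distr) (simp_all add: id measurable_P sigma_finite_measure_axioms)
  then have "distr (distr P S h \<Otimes>\<^sub>M P) T g
    = distr (distr (P \<Otimes>\<^sub>M P) (S \<Otimes>\<^sub>M path_space) (\<lambda>(y, z). (h y, z))) T g"
    by (simp add: id)
  also have "\<dots> = distr (P \<Otimes>\<^sub>M P) T (\<lambda>(y, z). g (h y, z))"
  proof (subst distr_distr[OF g])
    show "(\<lambda>(y, z). (h y, z)) \<in> P \<Otimes>\<^sub>M P \<rightarrow>\<^sub>M S \<Otimes>\<^sub>M path_space"
      unfolding measurable_cong_sets[OF sets_PP refl] case_prod_beta'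
      by (intro measurable_Pair measurable_compose[OF measurable_fst h] measurable_snd)
  qed (simp add: comp_def case_prod_beta')
  finally show ?thesis by simp
qed

lemma measurable_forward_backward:
  assumes step: "(\<lambda>(s, x). step s x) \<in> measurable (S \<Otimes>\<^sub>M path_space) S" and s0: "s0 \<in> space S"
  shows "forward step s0 n \<in> measurable path_space S" "backward step s0 n \<in> measurable path_space S"
proof -
  have comp: "(\<lambda>x. step (f x) (g x)) \<in> measurable path_space S"
    if "f \<in> measurable path_space S" "g \<in> measurable path_space path_space" for f g
    using measurable_compose[OF measurable_Pair[OF that] step] by simp
  show "forward step s0 n \<in> measurable path_space S"
  proof (induction n)
    case 0
    show ?case using s0 by (simp add: measurable_const)
  next
    case (Suc n)
    show ?case unfolding forward.simps[abs_def] by (rule comp[OF Suc measurable_shift]) simp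
  qed
  show "backward step s0 n \<in> measurable path_space S"
  proof (induction n)
    case 0
    show ?case using s0 by (simp add: measurable_const)
  next
    case (Suc n)
    have "(\<lambda>x. backward step s0 n (shift 1 x)) \<in> measurable path_space S"
      by (rule measurable_compose[OF measurable_shift Suc]) simp
    then show ?case unfolding backward.simps[abs_def] by (rule comp) simp
  qed
qed

lemma forward_stop:
  assumes local: "\<And>s x. x \<in> space path_space \<Longrightarrow> step s (stop 1 x) = step s x"
    and x: "x \<in> space path_space" and nt: "real n \<le> t"
  shows "forward step s0 n (stop t x) = forward step s0 n x"
  using nt
proof (induction n)
  case (Suc n)
  have t: "0 \<le> t" using Suc.prems by simp
  have "stop 1 (shift (real n) (stop t x)) = stop 1 (shift (real n) x)"
  proof -
    have "min t (real n + min 1 u) = real n + min 1 u" "min t (real n) = real n" for u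
      using Suc.prems by auto
    then show ?thesis by (auto simp: stop_def shift_def fun_eq_iff)
  qed
  then have "step s (shift (real n) (stop t x)) = step s (shift (real n) x)" for s
    using local[of "shift (real n) (stop t x)" s] local[of "shift (real n) x" s]
      shift_in_path_space stop_in_path_space x t by (metis of_nat_0_le_iff)
  then show ?case using Suc by simp
qed simp

text \<open>Forward iteration appends an independent block and backward iteration prepends one, so both
laws are images of the previous law, times the law of a path, under the same map.\<close>

lemma distr_forward_eq_backward:
  assumes step: "(\<lambda>(s, x). step s x) \<in> measurable (S \<Otimes>\<^sub>M path_space) S" and s0: "s0 \<in> space S"
    and local: "\<And>s x. x \<in> space path_space \<Longrightarrow> step s (stop 1 x) = step s x"
  shows "distr P S (forward step s0 n) = distr P S (backward step s0 n)"
proof (induction n)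
  case 0
  show ?case by (simp add: forward.simps(1)[abs_def] backward.simps(1)[abs_def])
next
  case (Suc n)
  interpret PP: pair_prob_space P P ..
  note meas = measurable_forward_backward[of step S, OF step s0, of n]
  note sets_PP = sets_pair_measure_cong[OF sets_P sets_P]
  have comp: "(\<lambda>(y, z). step (h y) z) \<in> measurable (path_space \<Otimes>\<^sub>M path_space) S"
    if "h \<in> measurable path_space S" for h
    using measurable_compose[OF measurable_Pair[OF measurable_compose[OF measurable_fst that] measurable_snd] step]
    by (simp add: case_prod_beta')
  have pair: "distr (P \<Otimes>\<^sub>M P) S (\<lambda>(y, z). step (h y) z) = distr (distr P S h \<Otimes>\<^sub>M P) S (\<lambda>(s, x). step s x)"
    if "h \<in> measurable path_space S" for h
    using distr_pair_map[OF that step] by simp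
  have "distr P S (forward step s0 (Suc n)) = distr P S (\<lambda>x. (\<lambda>(y, z). step (forward step s0 n y) z) (stop (real n) x, shift (real n) x))"
    using forward_stop[of step, OF local, of _ n "real n"]
    by (intro distr_cong) (auto simp: space_P)
  also have "\<dots> = distr (P \<Otimes>\<^sub>M P) S (\<lambda>(y, z). (\<lambda>(y, z). step (forward step s0 n y) z) (stop (real n) y, z))"
    by (rule distr_restart[OF _ comp[OF meas(1)]]) simp
  also have "\<dots> = distr (P \<Otimes>\<^sub>M P) S (\<lambda>(y, z). step (forward step s0 n y) z)"
    using forward_stop[of step, OF local, of _ n "real n"]
    by (intro distr_cong) (auto simp: space_pair_measure space_P)
  finally have fwd: "distr P S (forward step s0 (Suc n)) = distr (distr P S (forward step s0 n) \<Otimes>\<^sub>M P) S (\<lambda>(s, x). step s x)"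
    using pair[OF meas(1)] by simp
  let ?swap = "\<lambda>(y, z). (z, y)"
  have comp': "(\<lambda>(y, z). step (backward step s0 n z) y) \<in> measurable (path_space \<Otimes>\<^sub>M path_space) S"
    using measurable_compose[OF measurable_Pair[OF measurable_compose[OF measurable_snd meas(2)] measurable_fst] step]
    by (simp add: case_prod_beta')
  have "distr P S (backward step s0 (Suc n)) = distr P S (\<lambda>x. (\<lambda>(y, z). step (backward step s0 n z) y) (stop 1 x, shift 1 x))"
    by (intro distr_cong) (simp_all add: local space_P)
  also have "\<dots> = distr (P \<Otimes>\<^sub>M P) S (\<lambda>(y, z). (\<lambda>(y, z). step (backward step s0 n z) y) (stop 1 y, z))"
    by (rule distr_restart[OF _ comp']) simp
  also have "\<dots> = distr (P \<Otimes>\<^sub>M P) S (\<lambda>(y, z). step (backward step s0 n z) y)"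
    by (intro distr_cong) (auto simp: local space_P space_pair_measure)
  also have "\<dots> = distr (distr (P \<Otimes>\<^sub>M P) (P \<Otimes>\<^sub>M P) ?swap) S (\<lambda>(y, z). step (backward step s0 n z) y)"
    using PP.distr_pair_swap by simp
  also have "\<dots> = distr (P \<Otimes>\<^sub>M P) S (\<lambda>(y, z). step (backward step s0 n y) z)"
  proof (subst distr_distr)
    show "(\<lambda>(y, z). step (backward step s0 n z) y) \<in> measurable (P \<Otimes>\<^sub>M P) S"
      using comp' by (simp add: measurable_cong_sets[OF sets_PP refl])
    show "?swap \<in> measurable (P \<Otimes>\<^sub>M P) (P \<Otimes>\<^sub>M P)"
      unfolding case_prod_beta' by (intro measurable_Pair measurable_snd measurable_fst)
  qed (simp add: comp_def case_prod_beta')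
  finally have "distr P S (backward step s0 (Suc n)) = distr (distr P S (backward step s0 n) \<Otimes>\<^sub>M P) S (\<lambda>(s, x). step s x)"
    using pair[OF meas(2)] by simp
  then show ?case using fwd Suc.IH by (simp only:)
qed

end

section \<open>The workload of a single queue with negative drift\<close>

definition drifted :: "real^'n \<Rightarrow> real \<Rightarrow> (real \<Rightarrow> real^'n) \<Rightarrow> real \<Rightarrow> real" where
  "drifted l \<kappa> x t = l \<bullet> x t - \<kappa> * t"

text \<open>The one-dimensional reflected path driven by \<open>drifted l \<kappa> x\<close>, which is how far this path is above its
running minimum. It measures deviations of \<open>l \<bullet> x\<close> seen backwards from time \<open>t\<close>.\<close>

definition workload :: "real^'n \<Rightarrow> real \<Rightarrow> (real \<Rightarrow> real^'n) \<Rightarrow> real \<Rightarrow> real" where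
  "workload l \<kappa> x t = running_max (\<lambda>u. drifted l \<kappa> x t - drifted l \<kappa> x u) t"

definition workload_step :: "real^'n \<Rightarrow> real \<Rightarrow> real \<Rightarrow> (real \<Rightarrow> real^'n) \<Rightarrow> real" where
  "workload_step l \<kappa> c x = max (c + drifted l \<kappa> x 1) (workload l \<kappa> x 1)"

definition sup_norm1 :: "(real \<Rightarrow> real^'n) \<Rightarrow> real" where
  "sup_norm1 x = running_max (\<lambda>u. norm (x u)) 1"

lemma path_space_right_continuous:
  "x \<in> space path_space \<Longrightarrow> 0 \<le> t \<Longrightarrow> (x \<longlongrightarrow> x t) (at_right t)"
  by (simp add: space_path_space cadlag_def)

lemma path_space_0: "x \<in> space path_space \<Longrightarrow> x 0 = 0"
  by (simp add: space_path_space)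

lemma path_space_cadlag: "x \<in> space path_space \<Longrightarrow> cadlag x"
  by (simp add: space_path_space)

lemma path_space_bounded:
  fixes x :: "real \<Rightarrow> real^'n"
  assumes "x \<in> space path_space"
  shows "\<exists>B. \<forall>s\<in>{0..T}. norm (x s) \<le> B"
proof -
  obtain B where B: "0 \<le> B" "\<And>s i. s \<in> {0..T} \<Longrightarrow> \<bar>x s $ i\<bar> \<le> B"
    by (rule locally_boundedE[OF cadlag_locally_bounded[OF path_space_cadlag[OF assms]]]) (rule that)
  have "norm (x s) \<le> (\<Sum>i\<in>(UNIV :: 'n set). B)" if "s \<in> {0..T}" for s
    using norm_le_l1_cart[of "x s"] sum_mono[of UNIV "\<lambda>i. \<bar>x s $ i\<bar>" "\<lambda>_. B"] B(2)[OF that] by (meson order_trans)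
  then show ?thesis by blast
qed

lemma borel_measurable_norm_eval:
  "0 \<le> t \<Longrightarrow> (\<lambda>x :: real \<Rightarrow> real^'n. norm (x t)) \<in> borel_measurable path_space"
  by (rule measurable_compose[OF measurable_path_eval borel_measurable_norm])

lemma drifted_right_continuous:
  assumes "x \<in> space path_space" "0 \<le> t"
  shows "(drifted l \<kappa> x \<longlongrightarrow> drifted l \<kappa> x t) (at_right t)"
  unfolding drifted_def by (intro tendsto_intros path_space_right_continuous assms)

lemma drifted_bounded:
  assumes "x \<in> space path_space"
  shows "\<exists>B. \<forall>s\<in>{0..T}. \<bar>drifted l \<kappa> x s\<bar> \<le> B"
proof -
  obtain B where B: "\<And>s. s \<in> {0..T} \<Longrightarrow> norm (x s) \<le> B" using path_space_bounded[OF assms] by blast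
  have "\<bar>drifted l \<kappa> x s\<bar> \<le> norm l * B + \<bar>\<kappa>\<bar> * T" if s: "s \<in> {0..T}" for s
  proof -
    have "\<bar>l \<bullet> x s\<bar> \<le> norm l * B"
      using Cauchy_Schwarz_ineq2[of l "x s"] mult_left_mono[OF B[OF s], of "norm l"] by simp
    moreover have "\<bar>\<kappa> * s\<bar> \<le> \<bar>\<kappa>\<bar> * T" using s by (auto simp: abs_mult intro!: mult_left_mono)
    ultimately show ?thesis by (simp add: drifted_def)
  qed
  then show ?thesis by blast
qed

lemma drifted_shift: "0 \<le> s \<Longrightarrow> 0 \<le> t \<Longrightarrow> drifted l \<kappa> (shift s x) t = drifted l \<kappa> x (s + t) - drifted l \<kappa> x s"
  by (simp add: drifted_def shift_def inner_diff_right algebra_simps)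

lemma workload_le_iff:
  assumes x: "x \<in> space path_space" and t: "0 \<le> t"
  shows "workload l \<kappa> x t \<le> c \<longleftrightarrow> (\<forall>u\<in>{0..t}. drifted l \<kappa> x t - drifted l \<kappa> x u \<le> c)"
proof -
  obtain B where B: "\<And>s. s \<in> {0..t} \<Longrightarrow> \<bar>drifted l \<kappa> x s\<bar> \<le> B" using drifted_bounded[OF x] by blast
  have b: "drifted l \<kappa> x t - drifted l \<kappa> x u \<le> 2 * B" if "u \<in> {0..t}" for u
    using B[OF that] B[of t] t by simp
  have "\<exists>u\<in>{0..t}. drifted l \<kappa> x t - drifted l \<kappa> x u = 0" using t by (intro bexI[of _ t]) auto
  then show ?thesis
    unfolding workload_def
    using running_max_le_iff[of t "\<lambda>u. drifted l \<kappa> x t - drifted l \<kappa> x u" "2 * B" c, OF t b] by fastforce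
qed

lemma workload_ge:
  assumes "x \<in> space path_space" "0 \<le> t"
  shows "0 \<le> workload l \<kappa> x t" "u \<in> {0..t} \<Longrightarrow> drifted l \<kappa> x t - drifted l \<kappa> x u \<le> workload l \<kappa> x t"
proof -
  show *: "drifted l \<kappa> x t - drifted l \<kappa> x u \<le> workload l \<kappa> x t" if "u \<in> {0..t}" for u
    using workload_le_iff[OF assms, of l \<kappa> "workload l \<kappa> x t"] that by blast
  show "0 \<le> workload l \<kappa> x t" using *[of t] assms(2) by simp
qed

lemma borel_measurable_drifted:
  fixes l :: "real^'n"
  shows "0 \<le> t \<Longrightarrow> (\<lambda>x. drifted l \<kappa> x t) \<in> borel_measurable path_space"
  unfolding drifted_def
  by (intro borel_measurable_diff borel_measurable_inner borel_measurable_const measurable_path_eval)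

lemma borel_measurable_workload:
  fixes l :: "real^'n"
  assumes t: "0 \<le> t" shows "(\<lambda>x. workload l \<kappa> x t) \<in> borel_measurable path_space"
  unfolding workload_def
proof (rule borel_measurable_running_max[OF t])
  show "(\<lambda>x. drifted l \<kappa> x t - drifted l \<kappa> x u) \<in> borel_measurable path_space" if "0 \<le> u" for u
    by (intro borel_measurable_diff borel_measurable_drifted t that)
  fix x :: "real \<Rightarrow> real^'n" assume x: "x \<in> space path_space"
  obtain B where B: "\<And>s. s \<in> {0..t} \<Longrightarrow> \<bar>drifted l \<kappa> x s\<bar> \<le> B" using drifted_bounded[OF x] by blast
  have "drifted l \<kappa> x t - drifted l \<kappa> x u \<le> 2 * B" if "u \<in> {0..t}" for u
    using B[OF that] B[of t] t by simp
  then show "\<exists>B. \<forall>u\<in>{0..t}. drifted l \<kappa> x t - drifted l \<kappa> x u \<le> B" by blast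
  show "((\<lambda>u. drifted l \<kappa> x t - drifted l \<kappa> x u) \<longlongrightarrow> drifted l \<kappa> x t - drifted l \<kappa> x s) (at_right s)" if "0 \<le> s" for s
    by (intro tendsto_intros drifted_right_continuous x that)
qed

lemma borel_measurable_sup_norm1: "sup_norm1 \<in> borel_measurable (path_space :: (real \<Rightarrow> real^'n) measure)"
  unfolding sup_norm1_def
proof (rule borel_measurable_running_max)
  show "(\<lambda>x. norm (x u)) \<in> borel_measurable (path_space :: (real \<Rightarrow> real^'n) measure)" if "0 \<le> u" for u
    by (intro measurable_compose[OF _ borel_measurable_norm] measurable_path_eval that)
  show "\<exists>B. \<forall>u\<in>{0..1}. norm (x u) \<le> B" if "x \<in> space path_space" for x :: "real \<Rightarrow> real^'n"
    using path_space_bounded[OF that] .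
  show "((\<lambda>u. norm (x u)) \<longlongrightarrow> norm (x s)) (at_right s)" if "x \<in> space path_space" "0 \<le> s" for x :: "real \<Rightarrow> real^'n" and s
    by (intro tendsto_norm path_space_right_continuous that)
qed simp

lemma sup_norm1_ge:
  assumes "x \<in> space path_space"
  shows "0 \<le> sup_norm1 x" "u \<in> {0..1} \<Longrightarrow> norm (x u) \<le> sup_norm1 x"
proof -
  obtain B where "\<And>u. u \<in> {0..1} \<Longrightarrow> norm (x u) \<le> B" using path_space_bounded[OF assms] by blast
  from running_max_ge[of 1 "\<lambda>u. norm (x u)" B, OF _ this]
  show "0 \<le> sup_norm1 x" "u \<in> {0..1} \<Longrightarrow> norm (x u) \<le> sup_norm1 x" by (auto simp: sup_norm1_def)
qed

lemma sup_norm1_le_iff: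
  assumes "x \<in> space path_space" "0 \<le> c"
  shows "sup_norm1 x \<le> c \<longleftrightarrow> (\<forall>s\<in>insert 1 (\<rat> \<inter> {0..1}). norm (x s) \<le> c)"
proof -
  obtain B where "\<And>u. u \<in> {0..1} \<Longrightarrow> norm (x u) \<le> B" using path_space_bounded[OF assms(1)] by blast
  from running_max_le_iff_rational[of 1 "\<lambda>u. norm (x u)" B, OF _ this tendsto_norm[OF path_space_right_continuous[OF assms(1)]]] assms(2)
  show ?thesis by (simp add: sup_norm1_def)
qed

lemma workload_Suc:
  assumes x: "x \<in> space path_space"
  shows "workload l \<kappa> x (real (Suc n)) = workload_step l \<kappa> (workload l \<kappa> x (real n)) (shift (real n) x)"
proof -
  let ?y = "drifted l \<kappa> x"
  have sx: "shift (real n) x \<in> space path_space" by (rule shift_in_path_space[OF x]) simp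
  have "workload l \<kappa> x (real (Suc n)) \<le> c \<longleftrightarrow> workload_step l \<kappa> (workload l \<kappa> x (real n)) (shift (real n) x) \<le> c" for c
  proof -
    have "workload_step l \<kappa> (workload l \<kappa> x (real n)) (shift (real n) x) \<le> c \<longleftrightarrow>
        workload l \<kappa> x (real n) \<le> c - (?y (real n + 1) - ?y (real n)) \<and> workload l \<kappa> (shift (real n) x) 1 \<le> c"
      by (auto simp: workload_step_def drifted_shift)
    also have "\<dots> \<longleftrightarrow> (\<forall>u\<in>{0..real n}. ?y (real n + 1) - ?y u \<le> c) \<and> (\<forall>u\<in>{0..1}. ?y (real n + 1) - ?y (real n + u) \<le> c)"
      unfolding workload_le_iff[OF x of_nat_0_le_iff] workload_le_iff[OF sx zero_le_one]
      by (auto simp: drifted_shift)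
    also have "\<dots> \<longleftrightarrow> (\<forall>u\<in>{0..real n + 1}. ?y (real n + 1) - ?y u \<le> c)"
    proof (intro iffI conjI ballI)
      fix u assume *: "(\<forall>u\<in>{0..real n}. ?y (real n + 1) - ?y u \<le> c) \<and> (\<forall>u\<in>{0..1}. ?y (real n + 1) - ?y (real n + u) \<le> c)"
        and u: "u \<in> {0..real n + 1}"
      show "?y (real n + 1) - ?y u \<le> c"
      proof (cases "u \<le> real n")
        case True
        then show ?thesis using * u by simp
      next
        case False
        then show ?thesis using conjunct2[OF *, rule_format, of "u - real n"] u by simp
      qed
    qed auto
    also have "\<dots> \<longleftrightarrow> workload l \<kappa> x (real (Suc n)) \<le> c"
      unfolding workload_le_iff[OF x of_nat_0_le_iff] by (simp add: add.commute)
    finally show ?thesis by blast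
  qed
  then show ?thesis by (meson order.antisym order_refl)
qed

lemma forward_workload:
  assumes x: "x \<in> space path_space"
  shows "forward (workload_step l \<kappa>) 0 n x = workload l \<kappa> x (real n)"
proof (induction n)
  case 0
  have "workload l \<kappa> x 0 \<le> 0" unfolding workload_le_iff[OF x order_refl] by simp
  then show ?case using workload_ge(1)[OF x order_refl, of l \<kappa>] by simp
next
  case (Suc n)
  then show ?case by (simp only: forward.simps workload_Suc[OF x])
qed

lemma workload_step_stop: "workload_step l \<kappa> c (stop 1 x) = workload_step l \<kappa> c x"
proof -
  have eq: "drifted l \<kappa> (stop 1 x) u = drifted l \<kappa> x u" if "u \<in> {0..1}" for u
    using that by (simp add: drifted_def stop_def)
  then have "workload l \<kappa> (stop 1 x) 1 = workload l \<kappa> x 1"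
    unfolding workload_def running_max_def by (intro SUP_cong) auto
  then show ?thesis by (simp add: workload_step_def eq)
qed

lemma measurable_workload_step:
  "(\<lambda>(c, x). workload_step l \<kappa> c x) \<in> borel_measurable (borel \<Otimes>\<^sub>M path_space)"
  unfolding workload_step_def case_prod_beta'
  by (intro borel_measurable_max borel_measurable_add measurable_fst
      measurable_compose[OF measurable_snd borel_measurable_drifted]
      measurable_compose[OF measurable_snd borel_measurable_workload]) auto

lemma (in prob_space) nn_integral_layer_cake:
  assumes f: "f \<in> borel_measurable M" and nn: "\<And>x. x \<in> space M \<Longrightarrow> 0 \<le> f x"
  shows "(\<integral>\<^sup>+x. ennreal (f x) \<partial>M) = (\<integral>\<^sup>+r. emeasure M {x\<in>space M. r < f x} * indicator {0..} r \<partial>lborel)"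
proof -
  interpret pair_sigma_finite M lborel ..
  let ?h = "\<lambda>(x, r). indicator {0..} r * indicator {p \<in> space (M \<Otimes>\<^sub>M lborel). snd p < f (fst p)} (x, r) :: ennreal"
  have set: "{p \<in> space (M \<Otimes>\<^sub>M lborel). snd p < f (fst p)} \<in> sets (M \<Otimes>\<^sub>M lborel)"
    using f by measurable
  have h: "?h \<in> borel_measurable (M \<Otimes>\<^sub>M lborel)"
    unfolding case_prod_beta' using set
    by (intro borel_measurable_times_ennreal measurable_compose[OF measurable_snd] borel_measurable_indicator) auto
  have "(\<integral>\<^sup>+x. ennreal (f x) \<partial>M) = (\<integral>\<^sup>+x. (\<integral>\<^sup>+r. ?h (x, r) \<partial>lborel) \<partial>M)"
  proof (rule nn_integral_cong)
    fix x assume x: "x \<in> space M"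
    have "(\<integral>\<^sup>+r. ?h (x, r) \<partial>lborel) = (\<integral>\<^sup>+r. indicator {0..<f x} r \<partial>lborel)"
      using x by (intro nn_integral_cong) (auto simp: indicator_def space_pair_measure)
    also have "\<dots> = ennreal (f x)" using nn[OF x] by simp
    finally show "ennreal (f x) = (\<integral>\<^sup>+r. ?h (x, r) \<partial>lborel)" by simp
  qed
  also have "\<dots> = (\<integral>\<^sup>+r. (\<integral>\<^sup>+x. ?h (x, r) \<partial>M) \<partial>lborel)"
    using Fubini[OF h] by simp
  also have "\<dots> = (\<integral>\<^sup>+r. emeasure M {x\<in>space M. r < f x} * indicator {0..} r \<partial>lborel)"
  proof (rule nn_integral_cong)
    fix r :: real
    have "(\<integral>\<^sup>+x. ?h (x, r) \<partial>M) = (\<integral>\<^sup>+x. indicator {0..} r * indicator {x\<in>space M. r < f x} x \<partial>M)"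
      by (intro nn_integral_cong) (auto simp: indicator_def space_pair_measure)
    also have "\<dots> = indicator {0..} r * emeasure M {x\<in>space M. r < f x}"
      using f by (subst nn_integral_cmult) auto
    finally show "(\<integral>\<^sup>+x. ?h (x, r) \<partial>M) = emeasure M {x\<in>space M. r < f x} * indicator {0..} r"
      by (simp add: mult.commute)
  qed
  finally show ?thesis .
qed

text \<open>A sequence that is almost surely bounded has tight laws, by continuity of the measure.\<close>

lemma (in prob_space) tight_of_AE_bounded:
  fixes c :: "nat \<Rightarrow> 'a \<Rightarrow> real"
  assumes meas: "\<And>n. c n \<in> borel_measurable M" and bdd: "AE x in M. bdd_above (range (\<lambda>n. c n x))" and e: "0 < e"
  shows "\<exists>K. \<forall>n. prob {x\<in>space M. K < c n x} \<le> e"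
proof -
  define A where "A k = {x\<in>space M. \<exists>n. real k < c n x}" for k :: nat
  have A: "A k \<in> events" for k unfolding A_def using meas by measurable
  have "(\<lambda>k. prob (A k)) \<longlonglongrightarrow> prob (\<Inter>k. A k)"
  proof (rule finite_Lim_measure_decseq)
    have "A (Suc k) \<subseteq> A k" for k
    proof
      fix x assume "x \<in> A (Suc k)"
      then obtain n where "x \<in> space M" "real (Suc k) < c n x" by (auto simp: A_def)
      then have "x \<in> space M" "real k < c n x" by auto
      then show "x \<in> A k" by (auto simp: A_def)
    qed
    then show "decseq A" by (rule decseq_SucI)
  qed (use A in auto)
  moreover have "prob (\<Inter>k. A k) = 0"
  proof -
    have "AE x in M. x \<notin> (\<Inter>k. A k)"
    proof (rule AE_mp[OF bdd], intro AE_I2 impI)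
      fix x assume x: "x \<in> space M" "bdd_above (range (\<lambda>n. c n x))"
      then obtain B where B: "\<And>n. c n x \<le> B" by (auto simp: bdd_above_def)
      obtain k :: nat where "B \<le> real k" using real_arch_simple by blast
      then have "x \<notin> A k" using B by (auto simp: A_def not_less) (meson leD le_less_trans order_trans)
      then show "x \<notin> (\<Inter>k. A k)" by blast
    qed
    then show ?thesis using A by (intro prob_eq_0[THEN iffD2]) auto
  qed
  ultimately have "(\<lambda>k. prob (A k)) \<longlonglongrightarrow> 0" by simp
  then obtain k where k: "prob (A k) < e"
    using order_tendstoD(2)[of "\<lambda>k. prob (A k)" 0 sequentially e] e by (auto simp: eventually_sequentially)
  have "prob {x\<in>space M. real k < c n x} \<le> e" for n
  proof -
    have "prob {x\<in>space M. real k < c n x} \<le> prob (A k)"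
      by (rule finite_measure_mono[OF _ A]) (auto simp: A_def)
    then show ?thesis using k by simp
  qed
  then show ?thesis by blast
qed

context levy_path_law
begin

text \<open>Ottaviani's inequality. At the first time \<open>u\<close> in \<open>F\<close> at which \<open>|x|\<close> exceeds \<open>2a\<close>, the remaining
increment, which is independent of the past, is at most \<open>a\<close> with probability at least one half,
and then \<open>|x 1|\<close> exceeds \<open>a\<close>. The event \<open>A u\<close> says that \<open>u\<close> is that first time.\<close>

lemma ottaviani_finite:
  assumes F: "finite F" "F \<subseteq> {0..1}"
    and half: "\<And>s. s \<in> {0..1} \<Longrightarrow> 1 / 2 \<le> prob {x\<in>space P. norm (x 1 - x s) \<le> a}"
  shows "prob {x\<in>space P. \<exists>u\<in>F. 2 * a < norm (x u)} \<le> 2 * prob {x\<in>space P. a < norm (x 1)}"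
proof -
  define A where "A u = {x\<in>space P. 2 * a < norm (x u) \<and> (\<forall>w\<in>F. w < u \<longrightarrow> norm (x w) \<le> 2 * a)}" for u
  define B where "B u = {x\<in>space P. norm (x 1 - x u) \<le> a}" for u
  have indep: "prob (A u \<inter> B u) = prob (A u) * prob (B u) \<and> A u \<in> events \<and> B u \<in> events" if u: "u \<in> F" for u
  proof -
    have u01: "0 \<le> u" "u \<le> 1" using F u by auto
    let ?A = "{x\<in>space (path_space :: (real \<Rightarrow> real^'n) measure). 2 * a < norm (x u) \<and> (\<forall>w\<in>F. w < u \<longrightarrow> norm (x w) \<le> 2 * a)}"
    let ?B = "{x\<in>space (path_space :: (real \<Rightarrow> real^'n) measure). norm (x (1 - u)) \<le> a}"
    have nm: "(\<lambda>x :: real \<Rightarrow> real^'n. norm (x w)) \<in> borel_measurable path_space" if "w \<in> {0..1}" for w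
      using that by (intro borel_measurable_norm_eval) simp
    have A: "?A \<in> sets path_space"
    proof (intro sets.sets_Collect_conj sets.sets_Collect_countable_All' countable_finite F(1))
      show "{x \<in> space (path_space :: (real \<Rightarrow> real^'n) measure). 2 * a < norm (x u)} \<in> sets path_space"
        using nm[of u] u01 by (simp add: borel_measurable_iff_greater)
      fix w assume "w \<in> F"
      then have "{x \<in> space (path_space :: (real \<Rightarrow> real^'n) measure). norm (x w) \<le> 2 * a} \<in> sets path_space"
        using nm[of w] F by (auto simp: borel_measurable_iff_le)
      then show "{x \<in> space (path_space :: (real \<Rightarrow> real^'n) measure). w < u \<longrightarrow> norm (x w) \<le> 2 * a} \<in> sets path_space"
        by (cases "w < u") auto
    qed
    have B: "?B \<in> sets path_space" using nm[of "1 - u"] u01 by (simp add: borel_measurable_iff_le)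
    have A_eq: "stop u -` ?A \<inter> space P = A u"
      using stop_in_path_space[OF _ u01(1)] F u01 by (auto simp: A_def space_P stop_def min_def subset_eq)
    have B_eq: "shift u -` ?B \<inter> space P = B u"
      using shift_in_path_space[OF _ u01(1)] u01 by (auto simp: B_def space_P shift_def)
    have "(\<lambda>x. (stop u x, shift u x)) -` (?A \<times> ?B) \<inter> space P = A u \<inter> B u"
      using A_eq B_eq by blast
    moreover have "A u \<in> events" "B u \<in> events"
      using measurable_sets[of "stop u" P path_space, OF _ A] measurable_sets[of "shift u" P path_space, OF _ B]
      by (simp_all add: A_eq[symmetric] B_eq[symmetric] measurable_P measurable_stop measurable_shift u01 del: vimage_Collect_eq)
    ultimately show ?thesis
      using indep_varD[OF indep_stop_shift[OF u01(1)] A B] unfolding A_eq B_eq by simp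
  qed
  have disj: "disjoint_family_on A F"
    unfolding disjoint_family_on_def by (auto simp: A_def) (metis leD linorder_neqE_linordered_idom)
  have "{x\<in>space P. \<exists>u\<in>F. 2 * a < norm (x u)} = (\<Union>u\<in>F. A u)"
  proof (intro set_eqI iffI)
    fix x assume "x \<in> {x\<in>space P. \<exists>u\<in>F. 2 * a < norm (x u)}"
    then have x: "x \<in> space P" "{u\<in>F. 2 * a < norm (x u)} \<noteq> {}" by auto
    define m where "m = Min {u\<in>F. 2 * a < norm (x u)}"
    have "m \<in> {u\<in>F. 2 * a < norm (x u)}" unfolding m_def using x F by (intro Min_in) auto
    moreover have "norm (x w) \<le> 2 * a" if "w \<in> F" "w < m" for w
    proof (rule ccontr)
      assume "\<not> norm (x w) \<le> 2 * a"
      then have "m \<le> w" unfolding m_def using that F by (intro Min_le) auto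
      then show False using that by simp
    qed
    ultimately show "x \<in> (\<Union>u\<in>F. A u)" using x by (auto simp: A_def)
  qed (auto simp: A_def)
  then have "prob {x\<in>space P. \<exists>u\<in>F. 2 * a < norm (x u)} = (\<Sum>u\<in>F. prob (A u))"
    using finite_measure_finite_Union[OF F(1) _ disj] indep by auto
  also have "\<dots> \<le> (\<Sum>u\<in>F. 2 * prob (A u \<inter> B u))"
  proof (rule sum_mono)
    fix u assume u: "u \<in> F"
    have "prob (A u) * (1 / 2) \<le> prob (A u) * prob (B u)"
      using half[of u] F u by (intro mult_left_mono) (auto simp: B_def)
    then show "prob (A u) \<le> 2 * prob (A u \<inter> B u)" using indep[OF u] by simp
  qed
  also have "\<dots> = 2 * prob (\<Union>u\<in>F. A u \<inter> B u)"
  proof -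
    have "disjoint_family_on (\<lambda>u. A u \<inter> B u) F" using disj by (auto simp: disjoint_family_on_def)
    moreover have "(\<lambda>u. A u \<inter> B u) ` F \<subseteq> events" using indep by blast
    ultimately have "prob (\<Union>u\<in>F. A u \<inter> B u) = (\<Sum>u\<in>F. prob (A u \<inter> B u))"
      using finite_measure_finite_Union[OF F(1), of "\<lambda>u. A u \<inter> B u"] by blast
    then show ?thesis by (simp add: sum_distrib_left)
  qed
  also have "prob (\<Union>u\<in>F. A u \<inter> B u) \<le> prob {x\<in>space P. a < norm (x 1)}"
  proof (rule finite_measure_mono)
    show "(\<Union>u\<in>F. A u \<inter> B u) \<subseteq> {x\<in>space P. a < norm (x 1)}"
    proof
      fix x assume "x \<in> (\<Union>u\<in>F. A u \<inter> B u)"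
      then obtain u where u: "x \<in> space P" "2 * a < norm (x u)" "norm (x 1 - x u) \<le> a" by (auto simp: A_def B_def)
      have "norm (x u) \<le> norm (x 1) + norm (x 1 - x u)" by (metis norm_minus_commute norm_triangle_sub)
      then show "x \<in> {x\<in>space P. a < norm (x 1)}" using u by auto
    qed
    show "{x\<in>space P. a < norm (x 1)} \<in> events"
      using borel_measurable_norm_eval[where 'n='n, of 1] by (simp add: borel_measurable_iff_greater sets_P space_P)
  qed
  finally show ?thesis by simp
qed

lemma ottaviani:
  assumes a: "0 \<le> a" and half: "\<And>s. s \<in> {0..1} \<Longrightarrow> 1 / 2 \<le> prob {x\<in>space P. norm (x 1 - x s) \<le> a}"
  shows "prob {x\<in>space P. 2 * a < sup_norm1 x} \<le> 2 * prob {x\<in>space P. a < norm (x 1)}"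
proof -
  define D :: "real set" where "D = insert 1 (\<rat> \<inter> {0..1})"
  have D: "countable D" "D \<noteq> {}" "D \<subseteq> {0..1}"
    unfolding D_def by (auto intro!: countable_insert countable_Int1 countable_rat)
  define E where "E n = {x\<in>space P. \<exists>u\<in>from_nat_into D ` {..n}. 2 * a < norm (x u)}" for n :: nat
  have sub: "from_nat_into D ` {..n} \<subseteq> {0..1}" for n using from_nat_into[OF D(2)] D(3) by blast
  have E: "E n \<in> events" for n
  proof -
    have "{x\<in>space P. 2 * a < norm (x u)} \<in> events" if "u \<in> {0..1}" for u
      using borel_measurable_norm_eval[where 'n='n, of u] that
      by (simp add: borel_measurable_iff_greater sets_P space_P)
    then have "(\<Union>u\<in>from_nat_into D ` {..n}. {x\<in>space P. 2 * a < norm (x u)}) \<in> events"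
      using sub by (intro sets.finite_UN) blast+
    moreover have "(\<Union>u\<in>from_nat_into D ` {..n}. {x\<in>space P. 2 * a < norm (x u)}) = E n" by (auto simp: E_def)
    ultimately show ?thesis by simp
  qed
  have "(\<lambda>n. prob (E n)) \<longlonglongrightarrow> prob (\<Union>n. E n)"
  proof (rule finite_Lim_measure_incseq)
    show "incseq E" by (rule incseq_SucI) (auto simp: E_def)
  qed (use E in auto)
  moreover have "prob (E n) \<le> 2 * prob {x\<in>space P. a < norm (x 1)}" for n
    unfolding E_def by (rule ottaviani_finite[OF _ sub half]) auto
  ultimately have "prob (\<Union>n. E n) \<le> 2 * prob {x\<in>space P. a < norm (x 1)}"
    by (intro LIMSEQ_le_const2) auto
  moreover have "(\<Union>n. E n) = {x\<in>space P. 2 * a < sup_norm1 x}"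
  proof (intro set_eqI iffI)
    fix x assume "x \<in> (\<Union>n. E n)"
    then obtain u where u: "x \<in> space P" "u \<in> {0..1}" "2 * a < norm (x u)" unfolding E_def using sub by blast
    then show "x \<in> {x\<in>space P. 2 * a < sup_norm1 x}"
      using sup_norm1_ge(2)[of x u] by (auto simp: space_P)
  next
    fix x assume x: "x \<in> {x\<in>space P. 2 * a < sup_norm1 x}"
    then have "\<not> (\<forall>s\<in>D. norm (x s) \<le> 2 * a)"
      using sup_norm1_le_iff[of x "2 * a"] a unfolding D_def space_P by force
    then obtain s where s: "s \<in> D" "2 * a < norm (x s)" by (auto simp: not_le)
    obtain n where "from_nat_into D n = s" using from_nat_into_surj[OF D(1) s(1)] by blast
    then have "x \<in> E n" using x s(2) unfolding E_def by blast
    then show "x \<in> (\<Union>n. E n)" by blast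
  qed
  ultimately show ?thesis by simp
qed

text \<open>A Levy process that is integrable at time \<open>1\<close> has an integrable maximum over \<open>[0,1]\<close>: above the
level \<open>2b\<close>, where \<open>b\<close> is twice a median bound of the maximum, Ottaviani's inequality compares the
tails.\<close>

lemma integrable_sup_norm1:
  assumes int: "integrable P (\<lambda>x. norm (x 1))"
  shows "integrable P sup_norm1"
proof -
  have meas: "sup_norm1 \<in> borel_measurable P" by (simp add: measurable_P borel_measurable_sup_norm1)
  obtain K where K: "prob {x\<in>space P. K < sup_norm1 x} \<le> 1 / 2"
    using tight_of_AE_bounded[of "\<lambda>_. sup_norm1" "1/2"] meas by auto
  define b where "b = 2 * max 0 K"
  have b: "0 \<le> b" by (simp add: b_def)
  have ev: "(\<lambda>x. x u) \<in> borel_measurable P" if "u \<in> {0..1}" for u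
    using that by (simp add: measurable_P measurable_path_eval)
  have half: "1 / 2 \<le> prob {x\<in>space P. norm (x 1 - x s) \<le> a}" if a: "b \<le> a" and s: "s \<in> {0..1}" for a s
  proof -
    have "1 / 2 \<le> 1 - prob {x\<in>space P. K < sup_norm1 x}" using K by simp
    also have "\<dots> = prob (space P - {x\<in>space P. K < sup_norm1 x})"
      using meas by (intro prob_compl[symmetric]) (simp add: borel_measurable_iff_greater)
    also have "\<dots> \<le> prob {x\<in>space P. norm (x 1 - x s) \<le> a}"
    proof (rule finite_measure_mono)
      show "space P - {x\<in>space P. K < sup_norm1 x} \<subseteq> {x\<in>space P. norm (x 1 - x s) \<le> a}"
      proof
        fix x assume x: "x \<in> space P - {x\<in>space P. K < sup_norm1 x}"
        then have "norm (x 1) \<le> K" "norm (x s) \<le> K"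
          using sup_norm1_ge(2)[of x 1] sup_norm1_ge(2)[of x s] s by (auto simp: space_P)
        then have "norm (x 1 - x s) \<le> a"
          using norm_triangle_ineq4[of "x 1" "x s"] a by (simp add: b_def)
        then show "x \<in> {x\<in>space P. norm (x 1 - x s) \<le> a}" using x by simp
      qed
      have "(\<lambda>x. norm (x 1 - x s)) \<in> borel_measurable P" using ev[of 1] ev[OF s] by simp
      then show "{x\<in>space P. norm (x 1 - x s) \<le> a} \<in> events" by (simp add: borel_measurable_iff_le)
    qed
    finally show ?thesis .
  qed
  have tail: "emeasure P {x\<in>space P. r < sup_norm1 x} \<le> 2 * emeasure P {x\<in>space P. r < 2 * norm (x 1)}" if r: "2 * b \<le> r" for r
  proof -
    have "{x\<in>space P. r / 2 < norm (x 1)} = {x\<in>space P. r < 2 * norm (x 1)}" by auto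
    then have "prob {x\<in>space P. r < sup_norm1 x} \<le> 2 * prob {x\<in>space P. r < 2 * norm (x 1)}"
      using ottaviani[of "r / 2"] half[of "r / 2"] r b by simp
    then have "ennreal (prob {x\<in>space P. r < sup_norm1 x}) \<le> ennreal (2 * prob {x\<in>space P. r < 2 * norm (x 1)})"
      by (rule ennreal_leI)
    also have "\<dots> = 2 * ennreal (prob {x\<in>space P. r < 2 * norm (x 1)})"
      by (simp add: ennreal_mult)
    finally show ?thesis by (simp add: emeasure_eq_measure)
  qed
  have n1: "(\<lambda>x. 2 * norm (x 1)) \<in> borel_measurable P" using ev[of 1] by simp
  have "(\<integral>\<^sup>+x. ennreal (sup_norm1 x) \<partial>P) = (\<integral>\<^sup>+r. emeasure P {x\<in>space P. r < sup_norm1 x} * indicator {0..} r \<partial>lborel)"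
    using sup_norm1_ge(1) by (intro nn_integral_layer_cake meas) (auto simp: space_P)
  also have "\<dots> \<le> (\<integral>\<^sup>+r. indicator {0..2*b} r + 2 * (emeasure P {x\<in>space P. r < 2 * norm (x 1)} * indicator {0..} r) \<partial>lborel)"
  proof (rule nn_integral_mono)
    fix r :: real
    show "emeasure P {x\<in>space P. r < sup_norm1 x} * indicator {0..} r
      \<le> indicator {0..2*b} r + 2 * (emeasure P {x\<in>space P. r < 2 * norm (x 1)} * indicator {0..} r)"
      using tail[of r] emeasure_le_1[of "{x\<in>space P. r < sup_norm1 x}"]
      by (cases "2 * b \<le> r"; cases "0 \<le> r") (auto simp: indicator_def add_increasing2 intro: order_trans)
  qed
  also have "\<dots> = ennreal (2 * b) + 2 * (\<integral>\<^sup>+x. ennreal (2 * norm (x 1)) \<partial>P)"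
  proof -
    have m: "(\<lambda>r. emeasure P {x\<in>space P. r < 2 * norm (x 1)} * indicator {0..} r) \<in> borel_measurable lborel"
    proof -
      have "mono (\<lambda>r. - prob {x\<in>space P. r < 2 * norm (x 1)})"
        using n1 by (intro monoI le_imp_neg_le finite_measure_mono) (auto simp: borel_measurable_iff_greater)
      then have "(\<lambda>r. - prob {x\<in>space P. r < 2 * norm (x 1)}) \<in> borel_measurable borel"
        by (rule borel_measurable_mono)
      then have "(\<lambda>r. prob {x\<in>space P. r < 2 * norm (x 1)}) \<in> borel_measurable borel"
        using borel_measurable_uminus by fastforce
      then show ?thesis by (simp add: emeasure_eq_measure)
    qed
    have "(\<integral>\<^sup>+r. indicator {0..2*b} r + 2 * (emeasure P {x\<in>space P. r < 2 * norm (x 1)} * indicator {0..} r) \<partial>lborel)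
      = (\<integral>\<^sup>+r. indicator {0..2*b} r \<partial>lborel) + 2 * (\<integral>\<^sup>+r. emeasure P {x\<in>space P. r < 2 * norm (x 1)} * indicator {0..} r \<partial>lborel)"
      using m by (subst nn_integral_add) (auto simp: nn_integral_cmult)
    then show ?thesis using b nn_integral_layer_cake[OF n1] by simp
  qed
  also have "\<dots> < \<infinity>"
  proof -
    have "(\<integral>\<^sup>+x. ennreal (norm (2 * norm (x 1))) \<partial>P) < \<infinity>"
      using integrable_mult_right[OF int, of 2] unfolding integrable_iff_bounded by blast
    then show ?thesis by (simp add: ennreal_mult_less_top)
  qed
  finally have "(\<integral>\<^sup>+x. ennreal (sup_norm1 x) \<partial>P) < \<infinity>" .
  moreover have "(\<integral>\<^sup>+x. ennreal (norm (sup_norm1 x)) \<partial>P) = (\<integral>\<^sup>+x. ennreal (sup_norm1 x) \<partial>P)"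
    by (intro nn_integral_cong) (simp add: space_P abs_of_nonneg[OF sup_norm1_ge(1)])
  ultimately show ?thesis using meas by (simp add: integrable_iff_bounded)
qed

end

context levy_path_law
begin

lemma integral_shift:
  fixes f :: "(real \<Rightarrow> real^'n) \<Rightarrow> real"
  assumes f: "f \<in> borel_measurable P"
  shows "(\<integral>x. f (shift 1 x) \<partial>P) = (\<integral>x. f x \<partial>P)"
    and "integrable P (\<lambda>x. f (shift 1 x)) \<longleftrightarrow> integrable P f"
proof -
  have sh: "shift 1 \<in> measurable P P" using measurable_shift[of 1]
    by (simp add: measurable_P measurable_cong_sets[OF refl sets_P])
  have P: "distr P P (shift 1) = P"
    using distr_shift[of 1] by (simp add: distr_cong[OF refl sets_P])
  show "(\<integral>x. f (shift 1 x) \<partial>P) = (\<integral>x. f x \<partial>P)"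
    using integral_distr[OF sh f] by (simp add: P)
  show "integrable P (\<lambda>x. f (shift 1 x)) \<longleftrightarrow> integrable P f"
    using integrable_distr_eq[OF sh f] by (simp add: P)
qed

text \<open>This takes the place of the strong law of large numbers. Let \<open>c n\<close> be the backward iterates of the
workload, \<open>\<xi>\<close> the increment over \<open>[0,1]\<close>, and \<open>I\<close> the event that \<open>c n \<rightarrow> \<infinity>\<close>. The event \<open>I\<close> is
invariant under the shift, so stationarity and monotonicity in \<open>n\<close> give
\<open>E[c (n + 1) - c n \<circ> shift; I] = E[c (n + 1) - c n; I] \<ge> 0\<close>. On \<open>I\<close> the difference
\<open>c (n + 1) - c n \<circ> shift\<close> is eventually equal to \<open>\<xi>\<close>, because the reflection at zero is no longer
felt. Dominated convergence yields \<open>E[\<xi>; I] \<ge> 0\<close>. Being determined by the path after time \<open>1\<close>,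
\<open>I\<close> is independent of \<open>\<xi>\<close>; as \<open>E \<xi> < 0\<close>, it has probability zero.\<close>

lemma backward_workload_bounded:
  assumes int: "integrable P (\<lambda>x. norm (x 1))" and drift: "l \<bullet> (\<integral>x. x 1 \<partial>P) < \<kappa>"
  shows "AE x in P. bdd_above (range (\<lambda>n. backward (workload_step l \<kappa>) 0 n x))"
proof -
  define c where "c n = backward (workload_step l \<kappa>) 0 n" for n
  define \<xi> where "\<xi> x = drifted l \<kappa> x 1" for x
  define \<zeta> where "\<zeta> x = workload l \<kappa> x 1" for x
  define b where "b x = \<bar>\<xi> x\<bar> + \<zeta> x" for x
  have c_Suc: "c (Suc n) x = max (c n (shift 1 x) + \<xi> x) (\<zeta> x)" for n x
    by (simp add: c_def workload_step_def \<xi>_def \<zeta>_def)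
  have sh: "shift 1 x \<in> space P" if "x \<in> space P" for x
    using shift_in_path_space[of x 1] that by (simp add: space_P)
  have \<zeta>0: "0 \<le> \<zeta> x" if "x \<in> space P" for x using workload_ge(1)[of x 1] that by (simp add: \<zeta>_def space_P)
  have c0: "0 \<le> c n x" if "x \<in> space P" for n x
  proof (cases n)
    case 0 then show ?thesis by (simp add: c_def)
  next
    case (Suc m) then show ?thesis using \<zeta>0[OF that] by (simp add: c_Suc le_max_iff_disj)
  qed
  have c_mono: "c n x \<le> c (Suc n) x" if "x \<in> space P" for n x
    using that
  proof (induction n arbitrary: x)
    case 0
    show ?case using c0[OF 0, of "Suc 0"] by (simp add: c_def)
  next
    case (Suc n)
    show ?case using Suc.IH[OF sh[OF Suc.prems]] unfolding c_Suc[of "Suc n" x] c_Suc[of n x] by linarith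
  qed
  have c_meas: "c n \<in> borel_measurable P" for n
    using measurable_forward_backward(2)[OF measurable_workload_step, of 0 l \<kappa> n] by (simp add: c_def measurable_P)
  have \<xi>_meas: "\<xi> \<in> borel_measurable P" and \<zeta>_meas: "\<zeta> \<in> borel_measurable P"
    unfolding \<xi>_def[abs_def] \<zeta>_def[abs_def] measurable_P
    by (intro borel_measurable_drifted borel_measurable_workload; simp)+
  have sh_meas: "(\<lambda>x. f (shift 1 x)) \<in> borel_measurable P" if "f \<in> borel_measurable P" for f :: "_ \<Rightarrow> real"
    using measurable_compose[OF measurable_shift[of 1]] that by (simp add: measurable_P)
  have x1: "(\<lambda>x. x 1) \<in> borel_measurable P" by (simp add: measurable_P measurable_path_eval)
  have int_x1: "integrable P (\<lambda>x. x 1)" using int x1 by (simp add: integrable_norm_iff)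
  have int_\<xi>: "integrable P \<xi>"
    unfolding \<xi>_def[abs_def] drifted_def using int_x1 by simp
  have E\<xi>: "(\<integral>x. \<xi> x \<partial>P) < 0"
    using drift int_x1 by (simp add: \<xi>_def[abs_def] drifted_def prob_space)
  have int_\<zeta>: "integrable P \<zeta>"
  proof (rule Bochner_Integration.integrable_bound)
    show "integrable P (\<lambda>x. 2 * norm l * sup_norm1 x + 2 * \<bar>\<kappa>\<bar>)"
      using integrable_sup_norm1[OF int] by simp
    have "\<zeta> x \<le> 2 * norm l * sup_norm1 x + 2 * \<bar>\<kappa>\<bar>" if x: "x \<in> space P" for x
    proof -
      have x': "x \<in> space path_space" using x by (simp add: space_P)
      have le: "\<bar>drifted l \<kappa> x u\<bar> \<le> norm l * sup_norm1 x + \<bar>\<kappa>\<bar>" if u: "u \<in> {0..1}" for u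
      proof -
        have "\<bar>l \<bullet> x u\<bar> \<le> norm l * sup_norm1 x"
          using Cauchy_Schwarz_ineq2[of l "x u"] mult_left_mono[OF sup_norm1_ge(2)[OF x' u], of "norm l"] by simp
        moreover have "\<bar>\<kappa> * u\<bar> \<le> \<bar>\<kappa>\<bar>" using u by (simp add: abs_mult mult_left_le)
        ultimately show ?thesis by (simp add: drifted_def)
      qed
      show ?thesis unfolding \<zeta>_def workload_le_iff[OF x' zero_le_one]
      proof
        fix u :: real assume "u \<in> {0..1}"
        then show "drifted l \<kappa> x 1 - drifted l \<kappa> x u \<le> 2 * norm l * sup_norm1 x + 2 * \<bar>\<kappa>\<bar>"
          using le[of u] le[of 1] by (simp add: abs_le_iff)
      qed
    qed
    then show "AE x in P. norm (\<zeta> x) \<le> norm (2 * norm l * sup_norm1 x + 2 * \<bar>\<kappa>\<bar>)"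
      using \<zeta>0 by (intro AE_I2) force
  qed (rule \<zeta>_meas)
  have int_b: "integrable P b" unfolding b_def[abs_def] using int_\<xi> int_\<zeta> by simp
  have int_c: "integrable P (c n)" for n
  proof (induction n)
    case 0
    show ?case by (simp add: c_def)
  next
    case (Suc n)
    have "integrable P (\<lambda>x. c n (shift 1 x))" using Suc integral_shift(2)[OF c_meas] by simp
    then show ?case unfolding c_Suc[abs_def] using int_\<xi> int_\<zeta> by simp
  qed
  define I where "I = {x\<in>space P. \<forall>k::nat. \<exists>n. real k < c n x}"
  have I_set: "I \<in> events" unfolding I_def using c_meas by measurable
  have I_shift: "shift 1 x \<in> I \<longleftrightarrow> x \<in> I" if x: "x \<in> space P" for x
  proof
    assume s: "shift 1 x \<in> I"
    have "\<exists>n. real k < c n x" for k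
    proof -
      obtain j :: nat where j: "real k - \<xi> x \<le> real j" using real_arch_simple by blast
      obtain n where "real j < c n (shift 1 x)" using s unfolding I_def by blast
      then have "real k < c (Suc n) x" unfolding c_Suc using j by linarith
      then show ?thesis ..
    qed
    then show "x \<in> I" using x by (simp add: I_def)
  next
    assume s: "x \<in> I"
    have "\<exists>n. real k < c n (shift 1 x)" for k
    proof -
      obtain j :: nat where j: "real k + \<xi> x + \<zeta> x + \<bar>\<xi> x\<bar> + 1 \<le> real j" using real_arch_simple by blast
      obtain n where n: "real j < c n x" using s unfolding I_def by blast
      have "real j < c (Suc n) x" using n c_mono[OF x, of n] by linarith
      then have "real k < c n (shift 1 x)" unfolding c_Suc using j \<zeta>0[OF x] by (auto simp: max_def split: if_splits)
      then show ?thesis ..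
    qed
    then show "shift 1 x \<in> I" using sh[OF x] by (simp add: I_def)
  qed
  define J :: "(real \<Rightarrow> real^'n) \<Rightarrow> real" where "J = indicator I"
  have J_meas: "J \<in> borel_measurable P" unfolding J_def using I_set by simp
  have J_shift: "J (shift 1 x) = J x" if "x \<in> space P" for x
    using I_shift[OF that] by (simp add: J_def indicator_def)
  have J01: "0 \<le> J x" "J x \<le> 1" for x by (auto simp: J_def indicator_def)
  define \<Delta> where "\<Delta> n x = J x * (c (Suc n) x - c n (shift 1 x))" for n x
  have J_int: "integrable P (\<lambda>x. J x * f x)" if "integrable P f" for f
    using integrable_real_mult_indicator[OF I_set that] by (simp add: J_def mult.commute)
  have E\<Delta>: "0 \<le> (\<integral>x. \<Delta> n x \<partial>P)" for n
  proof -
    have Jc_meas: "(\<lambda>x. J x * c n x) \<in> borel_measurable P" using J_meas c_meas by simp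
    have i: "integrable P (\<lambda>x. J x * c n (shift 1 x))"
      by (intro J_int) (simp add: integral_shift(2)[OF c_meas] int_c)
    have "(\<integral>x. J x * c n x \<partial>P) = (\<integral>x. J (shift 1 x) * c n (shift 1 x) \<partial>P)"
      using integral_shift(1)[OF Jc_meas] by simp
    also have "\<dots> = (\<integral>x. J x * c n (shift 1 x) \<partial>P)"
      by (intro Bochner_Integration.integral_cong) (auto simp: J_shift)
    finally have "(\<integral>x. \<Delta> n x \<partial>P) = (\<integral>x. J x * c (Suc n) x \<partial>P) - (\<integral>x. J x * c n x \<partial>P)"
      unfolding \<Delta>_def right_diff_distrib using i J_int[OF int_c] by simp
    moreover have "(\<integral>x. J x * c n x \<partial>P) \<le> (\<integral>x. J x * c (Suc n) x \<partial>P)"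
      by (intro integral_mono_AE J_int int_c AE_I2 mult_left_mono c_mono J01(1))
    ultimately show ?thesis by simp
  qed
  \<comment> \<open>The domination uses \<open>\<xi> \<le> c (n + 1) - c n \<circ> shift \<le> max \<xi> \<zeta>\<close>.\<close>
  have "(\<lambda>n. \<integral>x. \<Delta> n x \<partial>P) \<longlonglongrightarrow> (\<integral>x. J x * \<xi> x \<partial>P)"
  proof (rule integral_dominated_convergence[where w=b])
    show "(\<lambda>x. J x * \<xi> x) \<in> borel_measurable P" using J_meas \<xi>_meas by simp
    show "\<Delta> n \<in> borel_measurable P" for n unfolding \<Delta>_def[abs_def] using J_meas c_meas sh_meas[OF c_meas] by simp
    show "integrable P b" by (rule int_b)
    show "AE x in P. (\<lambda>n. \<Delta> n x) \<longlonglongrightarrow> J x * \<xi> x"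
    proof (intro AE_I2)
      fix x assume x: "x \<in> space P"
      show "(\<lambda>n. \<Delta> n x) \<longlonglongrightarrow> J x * \<xi> x"
      proof (cases "x \<in> I")
        case False
        then show ?thesis by (simp add: \<Delta>_def J_def)
      next
        case True
        obtain k :: nat where k: "\<zeta> x - \<xi> x \<le> real k" using real_arch_simple by blast
        have "shift 1 x \<in> I" using True I_shift[OF x] by simp
        then obtain N where N: "real k < c N (shift 1 x)" unfolding I_def by blast
        have "\<Delta> n x = J x * \<xi> x" if n: "N \<le> n" for n
        proof -
          have "c N (shift 1 x) \<le> c n (shift 1 x)"
            by (rule lift_Suc_mono_le[of "\<lambda>n. c n (shift 1 x)", OF c_mono[OF sh[OF x]] n])
          then have "c (Suc n) x = c n (shift 1 x) + \<xi> x" unfolding c_Suc using N k by (simp add: max_def)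
          then show ?thesis by (simp add: \<Delta>_def)
        qed
        then show ?thesis by (intro tendsto_eventually) (auto simp: eventually_sequentially)
      qed
    qed
    show "AE x in P. norm (\<Delta> n x) \<le> b x" for n
    proof (intro AE_I2)
      fix x assume x: "x \<in> space P"
      have "\<bar>c (Suc n) x - c n (shift 1 x)\<bar> \<le> b x"
        using c0[OF sh[OF x], of n] \<zeta>0[OF x] by (auto simp: c_Suc b_def max_def)
      then have "J x * \<bar>c (Suc n) x - c n (shift 1 x)\<bar> \<le> 1 * b x" using J01[of x] by (intro mult_mono) auto
      then show "norm (\<Delta> n x) \<le> b x" using J01[of x] by (simp add: \<Delta>_def abs_mult)
    qed
  qed
  then have "0 \<le> (\<integral>x. J x * \<xi> x \<partial>P)" using E\<Delta> by (intro LIMSEQ_le_const) auto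
  also have "(\<integral>x. J x * \<xi> x \<partial>P) = (\<integral>x. J (shift 1 x) * \<xi> (stop 1 x) \<partial>P)"
    by (intro Bochner_Integration.integral_cong refl)
       (simp add: J_shift, simp add: \<xi>_def drifted_def stop_def)
  also have "\<dots> = (\<integral>x. J (shift 1 x) \<partial>P) * (\<integral>x. \<xi> (stop 1 x) \<partial>P)"
  proof -
    have "indep_var borel (\<xi> \<circ> stop 1) borel (J \<circ> shift 1)"
      using \<xi>_meas J_meas by (intro indep_var_compose[OF indep_stop_shift[of 1]]) (auto simp: measurable_P)
    moreover have "integrable P (\<xi> \<circ> stop 1)"
    proof -
      have "\<xi> \<circ> stop 1 = \<xi>" by (simp add: fun_eq_iff \<xi>_def drifted_def stop_def)
      then show ?thesis using int_\<xi> by simp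
    qed
    moreover have "integrable P (J \<circ> shift 1)"
      using integral_shift(2)[OF J_meas] J_int[of "\<lambda>_. 1"] by (simp add: comp_def)
    ultimately have "(\<integral>x. (\<xi> \<circ> stop 1) x * (J \<circ> shift 1) x \<partial>P) = (\<integral>x. (\<xi> \<circ> stop 1) x \<partial>P) * (\<integral>x. (J \<circ> shift 1) x \<partial>P)"
      by (rule indep_var_lebesgue_integral)
    then show ?thesis by (simp add: mult.commute)
  qed
  also have "(\<integral>x. J (shift 1 x) \<partial>P) = prob I"
    using integral_shift(1)[OF J_meas] I_set by (simp add: J_def)
  also have "(\<integral>x. \<xi> (stop 1 x) \<partial>P) = (\<integral>x. \<xi> x \<partial>P)" by (simp add: \<xi>_def drifted_def stop_def)
  finally have "prob I = 0" using E\<xi> measure_nonneg[of P I] by (auto simp: zero_le_mult_iff)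
  then have "AE x in P. x \<notin> I" using prob_eq_0[OF I_set] by simp
  then show ?thesis
  proof (rule AE_mp, intro AE_I2 impI)
    fix x assume x: "x \<in> space P" "x \<notin> I"
    then obtain k :: nat where "\<not> (\<exists>n. real k < c n x)" by (auto simp: I_def)
    then have "c n x \<le> real k" for n by (meson not_le)
    then show "bdd_above (range (\<lambda>n. backward (workload_step l \<kappa>) 0 n x))"
      unfolding c_def by (intro bdd_aboveI2)
  qed
qed

text \<open>The forward iterates have the laws of the backward ones, which are bounded almost surely.\<close>

lemma workload_tight:
  assumes int: "integrable P (\<lambda>x. norm (x 1))" and drift: "l \<bullet> (\<integral>x. x 1 \<partial>P) < \<kappa>" and e: "0 < e"
  shows "\<exists>K. \<forall>n. prob {x\<in>space P. K < workload l \<kappa> x (real n)} \<le> e"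
proof -
  note meas = measurable_forward_backward[OF measurable_workload_step, of 0 l \<kappa>]
  have "\<exists>K. \<forall>n. prob {x\<in>space P. K < backward (workload_step l \<kappa>) 0 n x} \<le> e"
    using meas(2) by (intro tight_of_AE_bounded backward_workload_bounded int drift e) (simp add: measurable_P)
  then obtain K where K: "\<And>n. prob {x\<in>space P. K < backward (workload_step l \<kappa>) 0 n x} \<le> e" by blast
  have "prob {x\<in>space P. K < workload l \<kappa> x (real n)} \<le> e" for n
  proof -
    have law: "measure (distr P borel f) {K<..} = prob {x\<in>space P. K < f x}" if "f \<in> borel_measurable P" for f
      using that by (subst measure_distr) (auto intro!: arg_cong[of _ _ prob])
    have "prob {x\<in>space P. K < workload l \<kappa> x (real n)} = prob {x\<in>space P. K < forward (workload_step l \<kappa>) 0 n x}"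
      by (intro arg_cong[of _ _ prob]) (auto simp: forward_workload space_P)
    also have "\<dots> = prob {x\<in>space P. K < backward (workload_step l \<kappa>) 0 n x}"
      using law[of "forward (workload_step l \<kappa>) 0 n"] law[of "backward (workload_step l \<kappa>) 0 n"] meas
        distr_forward_eq_backward[OF measurable_workload_step, of 0 l \<kappa> n] by (simp add: workload_step_stop measurable_P)
    finally show ?thesis using K[of n] by simp
  qed
  then show ?thesis by blast
qed

text \<open>The free path never exceeds the backward workload, which starts from zero and is pushed upwards
only.\<close>

lemma drifted_bounded_above:
  assumes int: "integrable P (\<lambda>x. norm (x 1))" and drift: "l \<bullet> (\<integral>x. x 1 \<partial>P) < \<kappa>"
  shows "AE x in P. bdd_above (range (\<lambda>n. drifted l \<kappa> x (real n)))"
proof (rule AE_mp[OF backward_workload_bounded[OF int drift]], intro AE_I2 impI)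
  fix x assume x: "x \<in> space P" and bdd: "bdd_above (range (\<lambda>n. backward (workload_step l \<kappa>) 0 n x))"
  have le: "drifted l \<kappa> x (real n) \<le> backward (workload_step l \<kappa>) 0 n x" if "x \<in> space path_space" for n x
    using that
  proof (induction n arbitrary: x)
    case 0
    then show ?case by (simp add: drifted_def path_space_0)
  next
    case (Suc n)
    have "drifted l \<kappa> (shift 1 x) (real n) \<le> backward (workload_step l \<kappa>) 0 n (shift 1 x)"
      by (rule Suc.IH[OF shift_in_path_space[OF Suc.prems]]) simp
    moreover have "backward (workload_step l \<kappa>) 0 n (shift 1 x) + drifted l \<kappa> x 1 \<le> backward (workload_step l \<kappa>) 0 (Suc n) x"
      unfolding backward.simps(2)[of "workload_step l \<kappa>" 0 n x]
        workload_step_def[of l \<kappa> "backward (workload_step l \<kappa>) 0 n (shift 1 x)" x] by simp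
    ultimately show ?case by (simp add: drifted_shift add.commute del: backward.simps)
  qed
  from bdd obtain B where "\<And>n. backward (workload_step l \<kappa>) 0 n x \<le> B" by (auto simp: bdd_above_def)
  then have "drifted l \<kappa> x (real n) \<le> B" for n using le[of x n] x by (auto simp: space_P intro: order_trans)
  then show "bdd_above (range (\<lambda>n. drifted l \<kappa> x (real n)))" by (intro bdd_aboveI2)
qed

end

section \<open>Convergence in law through uniformly continuous functions\<close>

text \<open>For these test functions, processes that approach each other almost surely have expectations that
approach each other; for test functions that are merely continuous this may fail if mass escapes to
infinity.\<close>

definition bounded_uniform :: "('b::metric_space \<Rightarrow> real) \<Rightarrow> bool" where
  "bounded_uniform u \<longleftrightarrow> uniformly_continuous_on UNIV u \<and> bounded (range u)"

lemma bounded_uniform_measurable: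
  fixes u :: "'b::euclidean_space \<Rightarrow> real"
  shows "bounded_uniform u \<Longrightarrow> u \<in> borel_measurable borel"
  unfolding bounded_uniform_def
  by (intro borel_measurable_continuous_onI uniformly_continuous_imp_continuous) simp

lemma bounded_uniform_isCont: "bounded_uniform u \<Longrightarrow> isCont u x"
  unfolding bounded_uniform_def
  using uniformly_continuous_imp_continuous[of UNIV u] by (simp add: continuous_on_eq_continuous_at)

lemma bounded_uniform_bound:
  assumes "bounded_uniform u" obtains B where "0 \<le> B" "\<And>x. \<bar>u x\<bar> \<le> B"
proof -
  obtain B where B: "\<And>x. \<bar>u x\<bar> \<le> B" using assms by (auto simp: bounded_uniform_def bounded_iff)
  show ?thesis using order_trans[OF abs_ge_zero B] B by (rule that)
qed

lemma bounded_uniform_lipschitz: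
  fixes g :: "'b::metric_space \<Rightarrow> real"
  assumes "\<And>x y. \<bar>g x - g y\<bar> \<le> C * dist x y" "0 \<le> C"
  shows "bounded_uniform (\<lambda>x. max 0 (min 1 (g x)))"
  unfolding bounded_uniform_def
proof
  show "uniformly_continuous_on UNIV (\<lambda>x. max 0 (min 1 (g x)))"
    unfolding uniformly_continuous_on_def
  proof (intro allI impI)
    fix e :: real assume e: "0 < e"
    have "dist (max 0 (min 1 (g y))) (max 0 (min 1 (g x))) < e" if "dist y x < e / (C + 1)" for x y
    proof -
      have "\<bar>max 0 (min 1 (g y)) - max 0 (min 1 (g x))\<bar> \<le> \<bar>g y - g x\<bar>" by (auto simp: max_def min_def)
      also have "\<dots> \<le> C * dist y x" by (rule assms(1))
      also have "\<dots> \<le> (C + 1) * dist y x" by (intro mult_right_mono) auto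
      also have "\<dots> < e" using that assms(2) by (simp add: field_simps)
      finally show ?thesis by (simp add: dist_real_def)
    qed
    then show "\<exists>d>0. \<forall>x\<in>UNIV. \<forall>x'\<in>UNIV. dist x' x < d \<longrightarrow> dist (max 0 (min 1 (g x'))) (max 0 (min 1 (g x))) < e"
      using e assms(2) by (intro exI[of _ "e / (C + 1)"]) auto
  qed
  show "bounded (range (\<lambda>x. max 0 (min 1 (g x))))" by (auto simp: bounded_iff intro!: exI[of _ 1])
qed

text \<open>The indicator of a closed set \<open>F\<close> is the decreasing limit of \<open>max 0 (1 - k dist(x,F))\<close>, and closed sets
form an intersection-stable generator of the Borel sets.\<close>

lemma prob_measure_eqI_bounded_uniform:
  fixes \<mu> \<nu> :: "('b::euclidean_space) measure"
  assumes \<mu>: "prob_space \<mu>" "sets \<mu> = sets borel" and \<nu>: "prob_space \<nu>" "sets \<nu> = sets borel"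
    and eq: "\<And>u. bounded_uniform u \<Longrightarrow> (\<integral>x. u x \<partial>\<mu>) = (\<integral>x. u x \<partial>\<nu>)"
  shows "\<mu> = \<nu>"
proof -
  have lim: "(\<lambda>k. \<integral>x. max 0 (min 1 (1 - real k * infdist x F)) \<partial>M) \<longlonglongrightarrow> measure M F"
    if F: "closed F" "F \<noteq> {}" and M: "prob_space M" "sets M = sets borel" for F and M :: "'b measure"
  proof -
    interpret prob_space M by fact
    have FM: "F \<in> sets M" using F(1) M(2) by simp
    have meas: "(\<lambda>x. max 0 (min 1 (1 - real k * infdist x F))) \<in> borel_measurable M" for k
      unfolding measurable_cong_sets[OF M(2) refl]
      by (intro borel_measurable_continuous_onI continuous_intros)
    have "(\<lambda>k. \<integral>x. max 0 (min 1 (1 - real k * infdist x F)) \<partial>M) \<longlonglongrightarrow> (\<integral>x. indicator F x \<partial>M)"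
    proof (rule integral_dominated_convergence[where w="\<lambda>_. 1"])
      show "AE x in M. (\<lambda>k. max 0 (min 1 (1 - real k * infdist x F))) \<longlonglongrightarrow> indicator F x"
      proof (intro AE_I2)
        fix x
        show "(\<lambda>k. max 0 (min 1 (1 - real k * infdist x F))) \<longlonglongrightarrow> indicator F x"
        proof (cases "x \<in> F")
          case True
          then have "infdist x F = 0" by simp
          then show ?thesis using True by simp
        next
          case False
          then have pos: "0 < infdist x F"
            using in_closed_iff_infdist_zero[OF F, of x] infdist_nonneg[of x F] by auto
          obtain N :: nat where N: "1 / infdist x F \<le> real N" using real_arch_simple by blast
          have "max 0 (min 1 (1 - real k * infdist x F)) = 0" if "N \<le> k" for k
          proof -
            have "1 / infdist x F \<le> real k" using N that by (meson of_nat_mono order_trans)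
            then have "1 \<le> real k * infdist x F" using pos by (simp add: pos_divide_le_eq)
            then show ?thesis by simp
          qed
          then show ?thesis using False by (intro tendsto_eventually) (auto simp: eventually_sequentially)
        qed
      qed
    qed (use meas FM in auto)
    then show ?thesis using FM by simp
  qed
  have closed_eq: "emeasure \<mu> F = emeasure \<nu> F" if F: "closed F" for F
  proof (cases "F = {}")
    case False
    have u: "bounded_uniform (\<lambda>x. max 0 (min 1 (1 - real k * infdist x F)))" for k
    proof (rule bounded_uniform_lipschitz[where C="real k"])
      fix x y
      have "\<bar>infdist x F - infdist y F\<bar> \<le> dist x y"
        using infdist_triangle_abs[of x F y] .
      then have "real k * \<bar>infdist x F - infdist y F\<bar> \<le> real k * dist x y" by (rule mult_left_mono) simp
      moreover have "1 - real k * infdist x F - (1 - real k * infdist y F) = - (real k * (infdist x F - infdist y F))"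
        by (simp add: algebra_simps)
      ultimately show "\<bar>1 - real k * infdist x F - (1 - real k * infdist y F)\<bar> \<le> real k * dist x y"
        by (simp only: abs_minus_cancel abs_mult abs_of_nat)
    qed simp
    have "measure \<mu> F = measure \<nu> F"
      using LIMSEQ_unique[OF lim[OF F False \<mu>] lim[OF F False \<nu>, folded eq[OF u]]] .
    then show ?thesis
      using \<mu>(1) \<nu>(1) by (simp add: finite_measure.emeasure_eq_measure prob_space.finite_measure)
  qed simp
  show ?thesis
  proof (rule measure_eqI_generator_eq[where E="Collect closed" and \<Omega>=UNIV and A="\<lambda>_. UNIV"])
    show "Int_stable (Collect closed :: 'b set set)" by (auto simp: Int_stable_def)
    show "sets \<mu> = sigma_sets UNIV (Collect closed)" "sets \<nu> = sigma_sets UNIV (Collect closed)"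
      by (simp_all add: \<mu>(2) \<nu>(2) borel_eq_closed)
    interpret \<mu>: prob_space \<mu> by fact
    show "emeasure \<mu> UNIV \<noteq> \<infinity>" by simp
  qed (use closed_eq in auto)
qed

lemma (in prob_space) integral_bounded_uniform_asymptotic:
  fixes Z Z' :: "real \<Rightarrow> 'a \<Rightarrow> 'b::euclidean_space"
  assumes u: "bounded_uniform u"
    and Z: "\<And>t. 0 \<le> t \<Longrightarrow> Z t \<in> borel_measurable M" and Z': "\<And>t. 0 \<le> t \<Longrightarrow> Z' t \<in> borel_measurable M"
    and lim: "AE \<omega> in M. ((\<lambda>t. Z t \<omega> - Z' t \<omega>) \<longlongrightarrow> 0) at_top"
  shows "((\<lambda>t. (\<integral>\<omega>. u (Z t \<omega>) \<partial>M) - (\<integral>\<omega>. u (Z' t \<omega>) \<partial>M)) \<longlongrightarrow> 0) at_top"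
proof -
  obtain B where B: "0 \<le> B" "\<And>x. \<bar>u x\<bar> \<le> B" using bounded_uniform_bound[OF u] by blast
  define s where "s t \<omega> = u (Z (max 0 t) \<omega>) - u (Z' (max 0 t) \<omega>)" for t \<omega>
  have uZ: "(\<lambda>\<omega>. u (Z t \<omega>)) \<in> borel_measurable M" "(\<lambda>\<omega>. u (Z' t \<omega>)) \<in> borel_measurable M" if "0 \<le> t" for t
    using Z[OF that] Z'[OF that] bounded_uniform_measurable[OF u] by (auto intro: measurable_compose)
  have int: "integrable M (\<lambda>\<omega>. u (Z t \<omega>))" "integrable M (\<lambda>\<omega>. u (Z' t \<omega>))" if "0 \<le> t" for t
    using B uZ[OF that] by (auto intro!: integrable_const_bound[where B=B])
  have "((\<lambda>t. \<integral>\<omega>. s t \<omega> \<partial>M) \<longlongrightarrow> (\<integral>\<omega>. 0 \<partial>M)) at_top"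
  proof (rule integral_dominated_convergence_at_top[where w="\<lambda>_. 2 * B"])
    show "s t \<in> borel_measurable M" for t
      unfolding s_def[abs_def] by (intro borel_measurable_diff uZ) auto
    show "AE \<omega> in M. ((\<lambda>t. s t \<omega>) \<longlongrightarrow> 0) at_top"
    proof (rule AE_mp[OF lim], intro AE_I2 impI tendstoI)
      fix \<omega> and e :: real assume l: "((\<lambda>t. Z t \<omega> - Z' t \<omega>) \<longlongrightarrow> 0) at_top" and e: "0 < e"
      obtain d where d: "0 < d" "\<And>x y. dist y x < d \<Longrightarrow> dist (u y) (u x) < e"
        using u e unfolding bounded_uniform_def uniformly_continuous_on_def by (metis UNIV_I)
      have "\<forall>\<^sub>F t in at_top. dist (Z t \<omega> - Z' t \<omega>) 0 < d" using tendstoD[OF l d(1)] .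
      then show "\<forall>\<^sub>F t in at_top. dist (s t \<omega>) 0 < e"
        using eventually_ge_at_top[of 0]
      proof eventually_elim
        case (elim t)
        then show ?case using d(2)[of "Z t \<omega>" "Z' t \<omega>"] by (simp add: s_def dist_norm)
      qed
    qed
    show "\<forall>\<^sub>F t in at_top. AE \<omega> in M. norm (s t \<omega>) \<le> 2 * B"
    proof (intro always_eventually allI AE_I2)
      fix t \<omega>
      have "\<bar>s t \<omega>\<bar> \<le> \<bar>u (Z (max 0 t) \<omega>)\<bar> + \<bar>u (Z' (max 0 t) \<omega>)\<bar>" unfolding s_def by (rule abs_triangle_ineq4)
      also have "\<dots> \<le> 2 * B" using B(2)[of "Z (max 0 t) \<omega>"] B(2)[of "Z' (max 0 t) \<omega>"] by simp
      finally show "norm (s t \<omega>) \<le> 2 * B" by simp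
    qed
  qed auto
  moreover have "\<forall>\<^sub>F t in at_top. (\<integral>\<omega>. s t \<omega> \<partial>M) = (\<integral>\<omega>. u (Z t \<omega>) \<partial>M) - (\<integral>\<omega>. u (Z' t \<omega>) \<partial>M)"
    using eventually_ge_at_top[of 0] by eventually_elim (simp add: s_def int)
  ultimately show ?thesis by (simp add: tendsto_cong)
qed

lemma uniformly_continuous_compact_support:
  fixes g :: "'b::euclidean_space \<Rightarrow> real"
  assumes g: "continuous_on UNIV g" and supp: "\<And>x. K \<le> norm x \<Longrightarrow> g x = 0"
  shows "uniformly_continuous_on UNIV g"
  unfolding uniformly_continuous_on_def
proof (intro allI impI)
  fix e :: real assume e: "0 < e"
  have "uniformly_continuous_on (cball 0 (K + 1)) g"
    by (intro compact_uniformly_continuous continuous_on_subset[OF g]) auto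
  then obtain d where d: "0 < d" "\<And>x y. x \<in> cball 0 (K + 1) \<Longrightarrow> y \<in> cball 0 (K + 1) \<Longrightarrow> dist y x < d \<Longrightarrow> dist (g y) (g x) < e"
    using e unfolding uniformly_continuous_on_def by blast
  have "dist (g y) (g x) < e" if xy: "dist y x < min d 1" for x y
  proof (cases "x \<in> cball 0 (K + 1) \<and> y \<in> cball 0 (K + 1)")
    case True
    then show ?thesis using d(2) xy by simp
  next
    case False
    then have "K + 1 < norm x \<or> K + 1 < norm y" by auto
    moreover have "\<bar>norm y - norm x\<bar> < 1" using norm_triangle_ineq3[of y x] xy by (simp add: dist_norm)
    ultimately have "K \<le> norm x" "K \<le> norm y" by auto
    then show ?thesis using supp e by simp
  qed
  then show "\<exists>d>0. \<forall>x\<in>UNIV. \<forall>x'\<in>UNIV. dist x' x < d \<longrightarrow> dist (g x') (g x) < e"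
    using d(1) by (intro exI[of _ "min d 1"]) auto
qed

text \<open>The half of the portmanteau theorem that passes from uniformly continuous to all bounded continuous
functions \<open>f\<close>: multiply \<open>f\<close> by a cut-off \<open>\<eta> K\<close>. The product has compact support, hence is uniformly
continuous, and the error is controlled by the expectation of \<open>1 - \<eta> K\<close>, which converges as well.\<close>

lemma (in prob_space) converges_in_distributionI:
  fixes Z :: "real \<Rightarrow> 'a \<Rightarrow> 'b::euclidean_space"
  assumes Z: "\<And>t. 0 \<le> t \<Longrightarrow> Z t \<in> borel_measurable M"
    and \<mu>: "prob_space \<mu>" "sets \<mu> = sets borel"
    and lim: "\<And>u. bounded_uniform u \<Longrightarrow> ((\<lambda>t. \<integral>\<omega>. u (Z t \<omega>) \<partial>M) \<longlongrightarrow> (\<integral>x. u x \<partial>\<mu>)) at_top"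
  shows "converges_in_distribution M Z \<mu>"
  unfolding converges_in_distribution_def
proof (intro conjI allI impI Z)
  fix f :: "'b \<Rightarrow> real" assume f: "continuous_on UNIV f" and bdd: "bounded (range f)"
  interpret \<mu>: prob_space \<mu> by fact
  obtain B where B: "\<And>x. \<bar>f x\<bar> \<le> B" using bdd by (auto simp: bounded_iff)
  have B0: "0 \<le> B" by (rule order_trans[OF abs_ge_zero B])
  define \<eta> where "\<eta> K x = max 0 (min 1 (K + 1 - norm x))" for K :: real and x :: 'b
  have \<eta>01: "0 \<le> \<eta> K x" "\<eta> K x \<le> 1" for K x by (auto simp: \<eta>_def)
  have \<eta>_cont: "continuous_on UNIV (\<eta> K)" for K unfolding \<eta>_def by (intro continuous_intros)
  have meas: "h \<in> borel_measurable \<mu>" if "continuous_on UNIV h" for h :: "'b \<Rightarrow> real"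
    unfolding measurable_cong_sets[OF \<mu>(2) refl] using that by (rule borel_measurable_continuous_onI)
  have measZ: "(\<lambda>\<omega>. h (Z t \<omega>)) \<in> borel_measurable M" if "continuous_on UNIV h" "0 \<le> t" for h :: "'b \<Rightarrow> real" and t
    by (rule measurable_compose[OF Z[OF that(2)] borel_measurable_continuous_onI[OF that(1)]])
  have int: "integrable \<mu> h" if "continuous_on UNIV h" "\<And>x. \<bar>h x\<bar> \<le> B'" for h :: "'b \<Rightarrow> real" and B'
    using that meas by (intro \<mu>.integrable_const_bound[where B=B']) auto
  have intZ: "integrable M (\<lambda>\<omega>. h (Z t \<omega>))" if "continuous_on UNIV h" "\<And>x. \<bar>h x\<bar> \<le> B'" "0 \<le> t" for h :: "'b \<Rightarrow> real" and B' t
    using that measZ by (intro integrable_const_bound[where B=B']) auto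
  show "((\<lambda>t. \<integral>\<omega>. f (Z t \<omega>) \<partial>M) \<longlongrightarrow> (\<integral>x. f x \<partial>\<mu>)) at_top"
  proof (rule tendstoI)
    fix e :: real assume e: "0 < e"
    have "(\<lambda>k. \<integral>x. 1 - \<eta> (real k) x \<partial>\<mu>) \<longlonglongrightarrow> (\<integral>x. 0 \<partial>\<mu>)"
    proof (rule integral_dominated_convergence[where w="\<lambda>_. 1"])
      show "(\<lambda>x. 1 - \<eta> (real k) x) \<in> borel_measurable \<mu>" for k
        by (intro meas continuous_intros \<eta>_cont)
      show "AE x in \<mu>. (\<lambda>k. 1 - \<eta> (real k) x) \<longlonglongrightarrow> 0"
      proof (intro AE_I2)
        fix x :: 'b
        obtain N :: nat where N: "norm x \<le> real N" using real_arch_simple by blast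
        have "1 - \<eta> (real k) x = 0" if "N \<le> k" for k
        proof -
          have "norm x \<le> real k" using N that by (meson of_nat_mono order_trans)
          then show ?thesis by (simp add: \<eta>_def)
        qed
        then show "(\<lambda>k. 1 - \<eta> (real k) x) \<longlonglongrightarrow> 0"
          by (intro tendsto_eventually) (auto simp: eventually_sequentially)
      qed
      show "AE x in \<mu>. norm (1 - \<eta> (real k) x) \<le> 1" for k using \<eta>01 by simp
    qed auto
    moreover define \<delta> where "\<delta> = e / (4 * (B + 1))"
    have \<delta>: "0 < \<delta>" "B * \<delta> < e / 4"
    proof -
      show "0 < \<delta>" using e B0 by (simp add: \<delta>_def)
      then have "B * \<delta> < (B + 1) * \<delta>" by simp
      also have "(B + 1) * \<delta> = e / 4" using B0 by (simp add: \<delta>_def field_simps)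
      finally show "B * \<delta> < e / 4" .
    qed
    ultimately have "\<forall>\<^sub>F k in sequentially. (\<integral>x. 1 - \<eta> (real k) x \<partial>\<mu>) < \<delta>"
      using order_tendstoD(2) by fastforce
    then obtain k where k: "(\<integral>x. 1 - \<eta> (real k) x \<partial>\<mu>) < \<delta>" by (auto simp: eventually_sequentially)
    define h where "h x = 1 - \<eta> (real k) x" for x
    define g where "g x = f x * \<eta> (real k) x" for x
    have h_cont: "continuous_on UNIV h" unfolding h_def by (intro continuous_intros \<eta>_cont)
    have h01: "\<bar>h x\<bar> \<le> 1" "0 \<le> h x" for x using \<eta>01[of "real k" x] by (auto simp: h_def)
    have g_cont: "continuous_on UNIV g" unfolding g_def by (intro continuous_intros f \<eta>_cont)
    have g_le: "\<bar>g x\<bar> \<le> B" for x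
    proof -
      have "\<bar>g x\<bar> \<le> B * 1" unfolding g_def abs_mult using B[of x] \<eta>01[of "real k" x] B0 by (intro mult_mono) auto
      then show ?thesis by simp
    qed
    have fg: "\<bar>f x - g x\<bar> \<le> B * h x" for x
    proof -
      have "f x - g x = f x * h x" by (simp add: g_def h_def algebra_simps)
      then show ?thesis using mult_right_mono[OF B[of x] h01(2)[of x]] h01(2)[of x] by (simp add: abs_mult)
    qed
    have g_unif: "bounded_uniform g"
      unfolding bounded_uniform_def
    proof
      show "uniformly_continuous_on UNIV g"
        by (rule uniformly_continuous_compact_support[OF g_cont, of "real k + 1"]) (simp add: g_def \<eta>_def)
      show "bounded (range g)" using g_le by (auto simp: bounded_iff)
    qed
    have \<eta>_unif: "bounded_uniform (\<eta> (real k))"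
      unfolding \<eta>_def
    proof (rule bounded_uniform_lipschitz[where C=1])
      show "\<bar>real k + 1 - norm x - (real k + 1 - norm y)\<bar> \<le> 1 * dist x y" for x y :: 'b
        using norm_triangle_ineq3[of y x] by (simp add: dist_norm norm_minus_commute)
    qed simp
    have h_unif: "bounded_uniform h"
      using \<eta>_unif unfolding bounded_uniform_def h_def
      by (auto intro!: uniformly_continuous_on_diff uniformly_continuous_on_const boundedI[of _ 1] simp: h01(1)[unfolded h_def])
    have ev1: "\<forall>\<^sub>F t in at_top. \<bar>(\<integral>\<omega>. g (Z t \<omega>) \<partial>M) - (\<integral>x. g x \<partial>\<mu>)\<bar> < e / 4"
      using tendstoD[OF lim[OF g_unif], of "e / 4"] e by (simp add: dist_real_def)
    have ev2: "\<forall>\<^sub>F t in at_top. (\<integral>\<omega>. h (Z t \<omega>) \<partial>M) < \<delta>"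
      using order_tendstoD(2)[OF lim[OF h_unif], of \<delta>] k by (simp add: h_def)
    have \<mu>_fg: "\<bar>(\<integral>x. f x \<partial>\<mu>) - (\<integral>x. g x \<partial>\<mu>)\<bar> \<le> B * (\<integral>x. h x \<partial>\<mu>)"
    proof -
      have "(\<integral>x. f x \<partial>\<mu>) - (\<integral>x. g x \<partial>\<mu>) = (\<integral>x. f x - g x \<partial>\<mu>)"
        using int[OF f B] int[OF g_cont g_le] by simp
      also have "\<bar>\<dots>\<bar> \<le> (\<integral>x. \<bar>f x - g x\<bar> \<partial>\<mu>)" by (rule integral_abs_bound)
      also have "\<dots> \<le> (\<integral>x. B * h x \<partial>\<mu>)"
        using int[OF f B] int[OF g_cont g_le] int[OF h_cont h01(1)] fg by (intro integral_mono) auto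
      finally show ?thesis by simp
    qed
    from ev1 ev2 eventually_ge_at_top[of 0]
    show "\<forall>\<^sub>F t in at_top. dist (\<integral>\<omega>. f (Z t \<omega>) \<partial>M) (\<integral>x. f x \<partial>\<mu>) < e"
    proof eventually_elim
      case (elim t)
      have "(\<integral>\<omega>. f (Z t \<omega>) \<partial>M) - (\<integral>\<omega>. g (Z t \<omega>) \<partial>M) = (\<integral>\<omega>. f (Z t \<omega>) - g (Z t \<omega>) \<partial>M)"
        using intZ[OF f B elim(3)] intZ[OF g_cont g_le elim(3)] by simp
      also have "\<bar>\<dots>\<bar> \<le> (\<integral>\<omega>. \<bar>f (Z t \<omega>) - g (Z t \<omega>)\<bar> \<partial>M)" by (rule integral_abs_bound)
      also have "\<dots> \<le> (\<integral>\<omega>. B * h (Z t \<omega>) \<partial>M)"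
        using intZ[OF f B elim(3)] intZ[OF g_cont g_le elim(3)] intZ[OF h_cont h01(1) elim(3)] fg by (intro integral_mono) auto
      also have "\<dots> = B * (\<integral>\<omega>. h (Z t \<omega>) \<partial>M)" by simp
      finally have 1: "\<bar>(\<integral>\<omega>. f (Z t \<omega>) \<partial>M) - (\<integral>\<omega>. g (Z t \<omega>) \<partial>M)\<bar> \<le> B * (\<integral>\<omega>. h (Z t \<omega>) \<partial>M)" .
      have "B * (\<integral>\<omega>. h (Z t \<omega>) \<partial>M) \<le> B * \<delta>" "B * (\<integral>x. h x \<partial>\<mu>) \<le> B * \<delta>"
        using elim(2) k B0 by (auto intro!: mult_left_mono simp: h_def)
      then show ?case unfolding dist_real_def using 1 \<mu>_fg elim(1) \<delta>(2) by linarith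
    qed
  qed
qed

text \<open>For increasing sequences tightness of the laws is the same as almost sure boundedness.\<close>

lemma (in prob_space) AE_bounded_of_tight:
  fixes c :: "nat \<Rightarrow> 'a \<Rightarrow> real"
  assumes meas: "\<And>n. c n \<in> borel_measurable M" and mono: "\<And>n x. x \<in> space M \<Longrightarrow> c n x \<le> c (Suc n) x"
    and tight: "\<And>e. 0 < e \<Longrightarrow> \<exists>K. \<forall>n. prob {x\<in>space M. K < c n x} \<le> e"
  shows "AE x in M. bdd_above (range (\<lambda>n. c n x))"
proof -
  define I where "I = {x\<in>space M. \<forall>k::nat. \<exists>n. real k < c n x}"
  have I: "I \<in> events" unfolding I_def using meas by measurable
  have "prob I \<le> e" if e: "0 < e" for e
  proof -
    obtain K where K: "\<And>n. prob {x\<in>space M. K < c n x} \<le> e" using tight[OF e] by blast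
    define A where "A n = {x\<in>space M. K < c n x}" for n
    have A: "A n \<in> events" for n unfolding A_def using meas by measurable
    have "(\<lambda>n. prob (A n)) \<longlonglongrightarrow> prob (\<Union>n. A n)"
    proof (rule finite_Lim_measure_incseq)
      show "incseq A" using mono by (intro incseq_SucI) (auto simp: A_def intro: less_le_trans)
    qed (use A in auto)
    then have "prob (\<Union>n. A n) \<le> e" using K by (intro LIMSEQ_le_const2) (auto simp: A_def)
    moreover have "prob I \<le> prob (\<Union>n. A n)"
    proof (rule finite_measure_mono)
      show "I \<subseteq> (\<Union>n. A n)"
      proof
        fix x assume x: "x \<in> I"
        obtain k :: nat where k: "K \<le> real k" using real_arch_simple by blast
        obtain n where "real k < c n x" using x unfolding I_def by blast
        then show "x \<in> (\<Union>n. A n)" using x k by (auto simp: I_def A_def intro!: exI[of _ n])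
      qed
    qed (use A in auto)
    ultimately show ?thesis by simp
  qed
  then have "prob I \<le> 0" by (rule_tac field_le_epsilon) simp
  then have "AE x in M. x \<notin> I" using prob_eq_0[OF I] measure_nonneg[of M I] by (auto intro: antisym)
  then show ?thesis
  proof (rule AE_mp, intro AE_I2 impI)
    fix x assume x: "x \<in> space M" "x \<notin> I"
    then obtain k :: nat where "\<not> (\<exists>n. real k < c n x)" by (auto simp: I_def)
    then have "c n x \<le> real k" for n by (meson not_le)
    then show "bdd_above (range (\<lambda>n. c n x))" by (intro bdd_aboveI2)
  qed
qed

context reflection
begin

section \<open>The stationary law\<close>

lemma iterate_cong:
  assumes "\<And>u. 0 \<le> u \<Longrightarrow> u \<le> t \<Longrightarrow> Y u = Y' u"
  shows "iterate Y k t = iterate Y' k t"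
  using assms
proof (induction k arbitrary: t)
  case (Suc k)
  have "(A *v iterate Y k s - Y s) $ i = (A *v iterate Y' k s - Y' s) $ i" if "s \<in> {0..t}" for s i
  proof -
    have "iterate Y k s = iterate Y' k s" using that Suc.prems by (intro Suc.IH) auto
    then show ?thesis using Suc.prems[of s] that by simp
  qed
  then have "running_max (\<lambda>s. (A *v iterate Y k s - Y s) $ i) t = running_max (\<lambda>s. (A *v iterate Y' k s - Y' s) $ i) t" for i
    unfolding running_max_def by (intro SUP_cong) simp_all
  then show ?case by simp
qed simp

lemma reflect_cong:
  assumes "\<And>u. 0 \<le> u \<Longrightarrow> u \<le> t \<Longrightarrow> Y u = Y' u" "0 \<le> t"
  shows "reflect Y t = reflect Y' t"
proof -
  have "regulator Y t = regulator Y' t"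
    unfolding regulator_def using iterate_cong[of t Y Y'] assms by simp
  then show ?thesis using assms by (simp add: reflect_def)
qed

lemma reflect_restart:
  assumes x: "x \<in> space path_space" and s: "0 \<le> s" and u: "0 \<le> u"
  shows "reflect (\<lambda>r. a + x r) (s + u) = reflect (\<lambda>r. reflect (\<lambda>r. a + x r) s + shift s x r) u"
proof -
  have lb: "locally_bounded (\<lambda>r. a + x r)"
    by (intro locally_bounded_add_const cadlag_locally_bounded path_space_cadlag x)
  show ?thesis
    using regulator_restart(3)[OF lb s u, of "\<lambda>r. reflect (\<lambda>r. a + x r) s + shift s x r"]
    by (simp add: shift_def)
qed

lemma reflect_mono_initial:
  assumes Y: "locally_bounded Y" and w: "w \<le> w'" and t: "0 \<le> t"
  shows "reflect (\<lambda>r. w + Y r) t \<le> reflect (\<lambda>r. w' + Y r) t"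
    and "\<bar>reflect (\<lambda>r. w' + Y r) t $ i - reflect (\<lambda>r. w + Y r) t $ i\<bar> \<le> 2 * v $ i * norm (w' - w)"
proof -
  have lb: "locally_bounded (\<lambda>r. w + Y r)" by (rule locally_bounded_add_const[OF Y])
  have d: "0 \<le> w' - w" using w by simp
  have eq: "(\<lambda>r. (w' - w) + (w + Y r)) = (\<lambda>r. w' + Y r)" by (simp add: fun_eq_iff)
  show "reflect (\<lambda>r. w + Y r) t \<le> reflect (\<lambda>r. w' + Y r) t"
    using reflection_monotone(3)[OF lb d t order_refl] by (simp only: eq)
  show "\<bar>reflect (\<lambda>r. w' + Y r) t $ i - reflect (\<lambda>r. w + Y r) t $ i\<bar> \<le> 2 * v $ i * norm (w' - w)"
    using reflect_initial_lipschitz[OF lb d t, of i] by (simp only: eq)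
qed

definition reflect_step :: "real^'n \<Rightarrow> (real \<Rightarrow> real^'n) \<Rightarrow> real^'n" where
  "reflect_step w x = reflect (\<lambda>r. w + x r) 1"

lemma borel_measurable_reflect_path:
  assumes t: "0 \<le> t"
  shows "(\<lambda>(w, x). reflect (\<lambda>r. w + x r) t) \<in> borel_measurable (borel \<Otimes>\<^sub>M path_space)"
  unfolding case_prod_beta'
proof (rule borel_measurable_reflect[OF _ _ t])
  show "(\<lambda>p. fst p + snd p u) \<in> borel_measurable (borel \<Otimes>\<^sub>M path_space)" if "0 \<le> u" for u
    by (intro borel_measurable_add measurable_fst measurable_compose[OF measurable_snd measurable_path_eval[OF that]])
  show "cadlag (\<lambda>u. fst p + snd p u)" if "p \<in> space (borel \<Otimes>\<^sub>M path_space)" for p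
    using that by (intro cadlag_const_add path_space_cadlag) (auto simp: space_pair_measure)
qed

lemma reflect_step_stop: "reflect_step w (stop 1 x) = reflect_step w x"
  unfolding reflect_step_def by (rule reflect_cong) (auto simp: stop_def)

lemma forward_reflect_step:
  assumes x: "x \<in> space path_space"
  shows "forward reflect_step 0 n x = reflect x (real n)"
proof (induction n)
  case 0
  have lb: "locally_bounded (\<lambda>_. 0 :: real^'n)" by (auto simp: locally_bounded_def intro: exI[of _ 0])
  have "is_regulator (\<lambda>_. 0) (\<lambda>_. 0)" by (auto simp: is_regulator_def)
  then have "reflect (\<lambda>_. 0) 0 = 0" using regulator_eqI[OF lb] by (simp add: reflect_def)
  moreover have "reflect x 0 = reflect (\<lambda>_. 0) 0"
    by (rule reflect_cong) (use path_space_0[OF x] in \<open>auto dest: order.antisym\<close>)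
  ultimately show ?case by simp
next
  case (Suc n)
  have "reflect x (real n + 1) = reflect (\<lambda>r. reflect x (real n) + shift (real n) x r) 1"
    using reflect_restart[OF x, of "real n" 1 0] by simp
  then show ?case using Suc by (simp add: reflect_step_def add.commute)
qed

end

text \<open>The matrix \<open>B\<close> is \<open>(I - A)\<inverse>\<close>.\<close>

locale stable_reflected_levy = levy_path_law P + reflection A v
  for P :: "(real \<Rightarrow> real^'n) measure" and A :: "real^'n^'n" and v :: "real^'n" +
  fixes B :: "real^'n^'n"
  assumes integrable_x1: "integrable P (\<lambda>x. norm (x 1))"
    and B_inverse: "B *v y - A *v (B *v y) = y"
    and drift: "(B *v (\<integral>x. x 1 \<partial>P)) $ i < 0"
begin

definition mean_rate :: "'n \<Rightarrow> real" where "mean_rate i = B $ i \<bullet> (\<integral>x. x 1 \<partial>P)"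

lemma mean_rate_neg: "mean_rate i < 0"
  using drift[of i] by (simp add: mean_rate_def matrix_vector_mul_component)

lemma path_locally_bounded: "x \<in> space P \<Longrightarrow> locally_bounded x"
  by (intro cadlag_locally_bounded path_space_cadlag) (simp add: space_P)

text \<open>Since \<open>(I - A)\<inverse>W = B x + L\<close> is nonnegative, \<open>L \<ge> - B x\<close>, and along the integers the coordinates of
\<open>B x\<close> tend to \<open>-\<infinity>\<close>.\<close>

lemma regulator_unbounded: "AE x in P. \<forall>i K. \<exists>t\<ge>0. K \<le> regulator x t $ i"
proof -
  have "AE x in P. bdd_above (range (\<lambda>n. drifted (B $ i) (mean_rate i / 2) x (real n)))" for i
    using mean_rate_neg[of i] by (intro drifted_bounded_above integrable_x1) (simp add: mean_rate_def)
  then have "AE x in P. \<forall>i. bdd_above (range (\<lambda>n. drifted (B $ i) (mean_rate i / 2) x (real n)))"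
    by (subst AE_all_countable) blast
  then show ?thesis
  proof (rule AE_mp, intro AE_I2 impI allI)
    fix x i K assume x: "x \<in> space P" and bdd: "\<forall>i. bdd_above (range (\<lambda>n. drifted (B $ i) (mean_rate i / 2) x (real n)))"
    obtain b where b: "\<And>n. drifted (B $ i) (mean_rate i / 2) x (real n) \<le> b"
      using spec[OF bdd, of i] by (auto simp: bdd_above_def)
    obtain n :: nat where n: "(K + b) / (- mean_rate i / 2) \<le> real n" using real_arch_simple by blast
    then have n': "K + b \<le> real n * (- mean_rate i / 2)"
      using mean_rate_neg[of i] by (subst (asm) pos_divide_le_eq) auto
    define D where "D = B *v x (real n) + regulator x (real n)"
    have "D - A *v D = reflect x (real n)"
      using B_inverse[of "x (real n)"] by (simp add: D_def reflect_def matrix_vector_right_distrib algebra_simps)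
    moreover have "0 \<le> reflect x (real n)" by (rule reflect_nonneg[OF path_locally_bounded[OF x]]) simp
    ultimately have "A *v D \<le> D" by (metis diff_ge_0_iff_ge)
    from inverse_positive[OF this] have "0 \<le> (B *v x (real n)) $ i + regulator x (real n) $ i"
      by (simp add: less_eq_vec_def D_def)
    moreover have "(B *v x (real n)) $ i \<le> b + mean_rate i / 2 * real n"
      using b[of n] by (simp add: drifted_def matrix_vector_mul_component)
    ultimately have "K \<le> regulator x (real n) $ i" using n' by (simp add: algebra_simps)
    then show "\<exists>t\<ge>0. K \<le> regulator x t $ i" by (intro exI[of _ "real n"]) simp
  qed
qed

text \<open>The deviations required by the Lyapunov bound are workloads: the two signs of the absolute value lead
to the one-dimensional problems for \<open>B $ i\<close> and \<open>- B $ i\<close>, each with drift \<open>-\<epsilon>\<close>.\<close>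

lemma reflect_tight:
  assumes e: "0 < e"
  shows "\<exists>K. \<forall>n i. prob {x\<in>space P. K < reflect x (real n) $ i} \<le> e"
proof -
  define S where "S = (\<Sum>i\<in>UNIV. v $ i)"
  have v_le: "v $ i \<le> S" for i
    unfolding S_def using v_nonneg by (intro member_le_sum) (auto simp: less_eq_vec_def)
  have S1: "1 \<le> S" using v_le v_ge_1 order_trans by blast
  \<comment> \<open>As \<open>v\<^sub>i \<le> S\<close>, this is at least \<open>1 - 1 / v\<^sub>i\<close> for every \<open>i\<close>.\<close>
  define \<rho> where "\<rho> = 1 - 1 / S"
  have \<rho>: "0 \<le> \<rho>" "\<rho> < 1" "v $ i - 1 \<le> \<rho> * v $ i" for i
    using S1 v_le[of i] v_ge_1[of i] by (auto simp: \<rho>_def field_simps)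
  define c where "c = Min (range (\<lambda>i. - mean_rate i / v $ i))"
  have vpos: "0 < v $ i" for i using v_ge_1[of i] by simp
  have c: "0 < c" "c * v $ i \<le> - mean_rate i" for i
  proof -
    have "c \<in> range (\<lambda>i. - mean_rate i / v $ i)" unfolding c_def by (rule Min_in) auto
    then show "0 < c" using mean_rate_neg vpos by (auto intro!: divide_neg_pos)
    have "c \<le> - mean_rate i / v $ i" unfolding c_def by (rule Min_le) auto
    from mult_right_mono[OF this, of "v $ i"] show "c * v $ i \<le> - mean_rate i" using vpos[of i] by simp
  qed
  define \<epsilon> where "\<epsilon> = (1 - \<rho>) * c / 4"
  have \<epsilon>: "0 < \<epsilon>" using \<rho>(2) c(1) by (simp add: \<epsilon>_def)
  define N where "N = real CARD('n)"
  have N: "0 < N" by (simp add: N_def)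
  have "\<exists>K. \<forall>n. prob {x\<in>space P. K < workload (B $ i) (mean_rate i + \<epsilon>) x (real n)} \<le> e / (2 * N)" for i
    using \<epsilon> e N by (intro workload_tight integrable_x1) (auto simp: mean_rate_def)
  then obtain K1 where "\<forall>i n. prob {x\<in>space P. K1 i < workload (B $ i) (mean_rate i + \<epsilon>) x (real n)} \<le> e / (2 * N)"
    using choice[of "\<lambda>i K. \<forall>n. prob {x\<in>space P. K < workload (B $ i) (mean_rate i + \<epsilon>) x (real n)} \<le> e / (2 * N)"] by blast
  then have K1: "prob {x\<in>space P. K1 i < workload (B $ i) (mean_rate i + \<epsilon>) x (real n)} \<le> e / (2 * N)" for i n by blast
  have "\<exists>K. \<forall>n. prob {x\<in>space P. K < workload (- B $ i) (- mean_rate i + \<epsilon>) x (real n)} \<le> e / (2 * N)" for i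
    using \<epsilon> e N by (intro workload_tight integrable_x1) (auto simp: mean_rate_def)
  then obtain K2 where "\<forall>i n. prob {x\<in>space P. K2 i < workload (- B $ i) (- mean_rate i + \<epsilon>) x (real n)} \<le> e / (2 * N)"
    using choice[of "\<lambda>i K. \<forall>n. prob {x\<in>space P. K < workload (- B $ i) (- mean_rate i + \<epsilon>) x (real n)} \<le> e / (2 * N)"] by blast
  then have K2: "prob {x\<in>space P. K2 i < workload (- B $ i) (- mean_rate i + \<epsilon>) x (real n)} \<le> e / (2 * N)" for i n by blast
  define C where "C = (\<Sum>i\<in>UNIV. \<bar>K1 i\<bar> + \<bar>K2 i\<bar>)"
  have C: "0 \<le> C" "K1 i \<le> C" "K2 i \<le> C" for i
  proof -
    have "\<bar>K1 i\<bar> + \<bar>K2 i\<bar> \<le> C" unfolding C_def by (rule member_le_sum) auto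
    then show "K1 i \<le> C" "K2 i \<le> C" by auto
    show "0 \<le> C" unfolding C_def by (intro sum_nonneg) auto
  qed
  define K where "K = S * (2 * C / (1 - \<rho>))"
  define E where "E n j = {x\<in>space P. K1 j < workload (B $ j) (mean_rate j + \<epsilon>) x (real n)} \<union>
    {x\<in>space P. K2 j < workload (- B $ j) (- mean_rate j + \<epsilon>) x (real n)}" for n j
  have wl: "(\<lambda>x. workload l \<kappa> x (real n)) \<in> borel_measurable P" for l \<kappa> n
    by (simp add: measurable_P borel_measurable_workload)
  have ev: "{x\<in>space P. k < workload l \<kappa> x (real n)} \<in> events" for l \<kappa> n k
    using wl[of l \<kappa> n] by (simp add: borel_measurable_iff_greater)
  have "prob {x\<in>space P. K < reflect x (real n) $ i} \<le> e" for n i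
  proof -
    have "{x\<in>space P. K < reflect x (real n) $ i} \<subseteq> (\<Union>j. E n j)"
    proof
      fix x assume x: "x \<in> {x\<in>space P. K < reflect x (real n) $ i}"
      then have xP: "x \<in> space P" and xs: "x \<in> space path_space" by (auto simp: space_P)
      show "x \<in> (\<Union>j. E n j)"
      proof (rule ccontr)
        assume "x \<notin> (\<Union>j. E n j)"
        then have small: "workload (B $ j) (mean_rate j + \<epsilon>) x (real n) \<le> C" "workload (- B $ j) (- mean_rate j + \<epsilon>) x (real n) \<le> C" for j
          using C(2,3)[of j] xP by (auto simp: E_def not_less intro: order_trans)
        have "reflect x (real n) $ i \<le> v $ i * (2 * C / (1 - \<rho>))"
        proof (rule reflect_drift_bound[where V="\<lambda>s. B *v x s" and d="\<chi> i. - mean_rate i" and c=c])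
          show "x s = B *v x s - A *v (B *v x s)" for s by (simp add: B_inverse)
          show "B *v x 0 = 0" using path_space_0[OF xs] by simp
          fix j s assume s: "s \<in> {0..real n}"
          have "drifted (B $ j) (mean_rate j + \<epsilon>) x (real n) - drifted (B $ j) (mean_rate j + \<epsilon>) x s \<le> C"
            using small(1)[of j] s unfolding workload_le_iff[OF xs of_nat_0_le_iff] by blast
          moreover have "drifted (- B $ j) (- mean_rate j + \<epsilon>) x (real n) - drifted (- B $ j) (- mean_rate j + \<epsilon>) x s \<le> C"
            using small(2)[of j] s unfolding workload_le_iff[OF xs of_nat_0_le_iff] by blast
          ultimately have "\<bar>(B *v x (real n)) $ j - (B *v x s) $ j + - mean_rate j * (real n - s)\<bar> \<le> \<epsilon> * (real n - s) + C"
            by (simp add: drifted_def matrix_vector_mul_component abs_le_iff algebra_simps)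
          then show "\<bar>(B *v x (real n)) $ j - (B *v x s) $ j + (\<chi> i. - mean_rate i) $ j * (real n - s)\<bar> \<le> (1 - \<rho>) * c / 4 * (real n - s) + C"
            by (simp add: \<epsilon>_def)
        qed (use path_locally_bounded[OF xP] c \<rho> C(1) in auto)
        also have "\<dots> \<le> K" unfolding K_def using v_le[of i] C(1) \<rho>(2) by (intro mult_right_mono) auto
        finally show False using x by simp
      qed
    qed
    moreover have "(\<Union>j. E n j) \<in> events" unfolding E_def by (intro sets.finite_UN sets.Un ev) auto
    ultimately have "prob {x\<in>space P. K < reflect x (real n) $ i} \<le> prob (\<Union>j. E n j)"
      by (rule finite_measure_mono)
    also have "\<dots> \<le> (\<Sum>j\<in>UNIV. prob (E n j))"
      by (rule finite_measure_subadditive_finite) (auto simp: E_def ev)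
    also have "\<dots> \<le> (\<Sum>j\<in>(UNIV::'n set). e / N)"
    proof (rule sum_mono)
      fix j
      have "prob (E n j) \<le> e / (2 * N) + e / (2 * N)"
        unfolding E_def by (rule order_trans[OF measure_Un_le[OF ev ev] add_mono[OF K1 K2]])
      then show "prob (E n j) \<le> e / N" by simp
    qed
    also have "\<dots> = e" using N by (simp add: N_def)
    finally show ?thesis .
  qed
  then show ?thesis by blast
qed

abbreviation loynes :: "nat \<Rightarrow> (real \<Rightarrow> real^'n) \<Rightarrow> real^'n" where
  "loynes \<equiv> backward reflect_step 0"

lemma measurable_reflect_step: "(\<lambda>(w, x). reflect_step w x) \<in> borel_measurable (borel \<Otimes>\<^sub>M path_space)"
  unfolding reflect_step_def by (rule borel_measurable_reflect_path) simp

lemma measurable_loynes: "loynes n \<in> borel_measurable path_space"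
  by (rule measurable_forward_backward(2)[OF measurable_reflect_step]) simp

lemma measurable_forward: "forward reflect_step 0 n \<in> borel_measurable path_space"
  by (rule measurable_forward_backward(1)[OF measurable_reflect_step]) simp

lemma distr_forward_loynes: "distr P borel (forward reflect_step 0 n) = distr P borel (loynes n)"
  by (rule distr_forward_eq_backward[OF measurable_reflect_step _ reflect_step_stop]) simp

lemma measurable_reflect_path: "0 \<le> t \<Longrightarrow> (\<lambda>x. reflect x t) \<in> borel_measurable path_space"
  by (intro borel_measurable_reflect measurable_path_eval path_space_cadlag)

lemma integral_reflect_loynes:
  fixes h :: "real^'n \<Rightarrow> real"
  assumes h: "h \<in> borel_measurable borel"
  shows "(\<integral>x. h (reflect x (real n)) \<partial>P) = (\<integral>x. h (loynes n x) \<partial>P)"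
proof -
  have "(\<integral>x. h (reflect x (real n)) \<partial>P) = (\<integral>x. h (forward reflect_step 0 n x) \<partial>P)"
    by (intro Bochner_Integration.integral_cong refl) (simp add: forward_reflect_step space_P)
  also have "\<dots> = (\<integral>w. h w \<partial>distr P borel (forward reflect_step 0 n))"
    using measurable_forward by (intro integral_distr[symmetric] h) (simp add: measurable_P)
  also have "\<dots> = (\<integral>x. h (loynes n x) \<partial>P)"
    unfolding distr_forward_loynes using measurable_loynes by (intro integral_distr h) (simp add: measurable_P)
  finally show ?thesis .
qed

text \<open>The first iterate is nonnegative, and prepending a block preserves the order because a reflected
path is monotone in its starting point.\<close>

lemma loynes_mono: "x \<in> space path_space \<Longrightarrow> loynes n x \<le> loynes (Suc n) x"
proof (induction n arbitrary: x)
  case 0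
  have "locally_bounded (\<lambda>r. 0 + x r)"
    using cadlag_locally_bounded[OF path_space_cadlag[OF 0]] by (rule locally_bounded_add_const)
  then show ?case using reflect_nonneg[of "\<lambda>r. 0 + x r" 1] by (simp add: reflect_step_def)
next
  case (Suc n)
  have "loynes n (shift 1 x) \<le> loynes (Suc n) (shift 1 x)"
    by (intro Suc.IH shift_in_path_space Suc.prems) simp
  then have "reflect_step (loynes n (shift 1 x)) x \<le> reflect_step (loynes (Suc n) (shift 1 x)) x"
    unfolding reflect_step_def
    by (intro reflect_mono_initial(1) cadlag_locally_bounded path_space_cadlag Suc.prems) simp_all
  then show ?case by simp
qed

lemma loynes_nonneg:
  assumes "x \<in> space path_space" shows "0 \<le> loynes n x"
proof (induction n)
  case (Suc n)
  then show ?case using loynes_mono[OF assms, of n] by (rule order_trans)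
qed simp

definition loynes_limit :: "(real \<Rightarrow> real^'n) \<Rightarrow> real^'n" where
  "loynes_limit x = lim (\<lambda>n. loynes n x)"

lemma measurable_loynes_limit: "loynes_limit \<in> borel_measurable path_space"
  unfolding loynes_limit_def[abs_def] by (intro borel_measurable_lim_metric measurable_loynes)

text \<open>The iterates increase and are tight, having the laws of the reflected path from \<open>0\<close> at integer
times; so they converge to a finite limit almost surely.\<close>

lemma loynes_tendsto:
  "AE x in P. (\<lambda>n. loynes n x) \<longlonglongrightarrow> loynes_limit x \<and> (\<forall>n. loynes n x \<le> loynes_limit x)"
proof -
  have "AE x in P. bdd_above (range (\<lambda>n. loynes n x $ i))" for i
  proof (rule AE_bounded_of_tight)
    show meas: "(\<lambda>x. loynes n x $ i) \<in> borel_measurable P" for n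
      using borel_measurable_vec_nth[OF measurable_loynes] by (simp add: measurable_P)
    show "loynes n x $ i \<le> loynes (Suc n) x $ i" if "x \<in> space P" for n x
      using loynes_mono[of x n] that by (simp add: space_P less_eq_vec_def del: backward.simps)
    fix e :: real assume "0 < e"
    then obtain K where K: "\<And>n i. prob {x\<in>space P. K < reflect x (real n) $ i} \<le> e" using reflect_tight by blast
    have "prob {x\<in>space P. K < loynes n x $ i} = prob {x\<in>space P. K < reflect x (real n) $ i}" for n
    proof -
      have "{w :: real^'n. K < w $ i} \<in> sets borel"
        by (intro borel_open open_Collect_less continuous_intros)
      then have h: "indicator {w. K < w $ i} \<in> borel_measurable (borel :: (real^'n) measure)" by simp
      have ev: "{x\<in>space P. K < f x $ i} \<in> events" if "f \<in> borel_measurable path_space" for f :: "_ \<Rightarrow> real^'n"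
        using borel_measurable_vec_nth[OF that, of i] by (simp add: borel_measurable_iff_greater sets_P space_P)
      have "(\<integral>x. indicat_real {w. K < w $ i} (f x) \<partial>P) = prob {x\<in>space P. K < f x $ i}"
        if "f \<in> borel_measurable path_space" for f :: "_ \<Rightarrow> real^'n"
      proof -
        have "(\<integral>x. indicat_real {w. K < w $ i} (f x) \<partial>P) = (\<integral>x. indicator {x\<in>space P. K < f x $ i} x \<partial>P)"
          by (intro Bochner_Integration.integral_cong) (auto simp: indicator_def)
        then show ?thesis using ev[OF that] by simp
      qed
      note eq = this
      show ?thesis
        using integral_reflect_loynes[OF h, of n] eq[OF measurable_loynes, of n] eq[OF measurable_reflect_path, of "real n"] by simp
    qed
    then have "prob {x\<in>space P. K < loynes n x $ i} \<le> e" for n by (rule ord_eq_le_trans[OF _ K])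
    then show "\<exists>K. \<forall>n. prob {x\<in>space P. K < loynes n x $ i} \<le> e" by blast
  qed
  then have "AE x in P. \<forall>i. bdd_above (range (\<lambda>n. loynes n x $ i))" by (subst AE_all_countable) blast
  then show ?thesis
  proof (rule AE_mp, intro AE_I2 impI)
    fix x assume x: "x \<in> space P" and bdd: "\<forall>i. bdd_above (range (\<lambda>n. loynes n x $ i))"
    define l where "l = (\<chi> i. SUP n. loynes n x $ i)"
    have "(\<lambda>n. loynes n x $ i) \<longlonglongrightarrow> l $ i" for i
      unfolding l_def using bdd loynes_mono[of x] x
      by (auto intro!: LIMSEQ_incseq_SUP incseq_SucI simp: space_P less_eq_vec_def simp del: backward.simps)
    then have "(\<lambda>n. loynes n x) \<longlonglongrightarrow> l" by (rule vec_tendstoI)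
    moreover from this have "loynes_limit x = l" unfolding loynes_limit_def by (rule limI)
    moreover have "loynes n x \<le> l" for n
      unfolding l_def less_eq_vec_def using bdd by (auto intro!: cSUP_upper simp del: backward.simps)
    ultimately show "(\<lambda>n. loynes n x) \<longlonglongrightarrow> loynes_limit x \<and> (\<forall>n. loynes n x \<le> loynes_limit x)" by simp
  qed
qed

definition stationary_law :: "(real^'n) measure" where
  "stationary_law = distr P borel loynes_limit"

lemma prob_space_stationary_law: "prob_space stationary_law"
  unfolding stationary_law_def using measurable_loynes_limit by (intro prob_space_distr) (simp add: measurable_P)

lemma sets_stationary_law: "sets stationary_law = sets borel"
  by (simp add: stationary_law_def)

lemma stationary_law_nonneg: "AE w in stationary_law. \<forall>i. 0 \<le> w $ i"
proof -
  have "AE x in P. \<forall>i. 0 \<le> loynes_limit x $ i"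
  proof (rule AE_mp[OF loynes_tendsto], intro AE_I2 impI)
    fix x assume x: "x \<in> space P" and l: "(\<lambda>n. loynes n x) \<longlonglongrightarrow> loynes_limit x \<and> (\<forall>n. loynes n x \<le> loynes_limit x)"
    have "0 \<le> loynes 0 x" using x by (intro loynes_nonneg) (simp add: space_P)
    also have "loynes 0 x \<le> loynes_limit x" using l by blast
    finally have "0 \<le> loynes_limit x" .
    then show "\<forall>i. 0 \<le> loynes_limit x $ i" by (simp add: less_eq_vec_def)
  qed
  moreover have "{w :: real^'n. \<forall>i. 0 \<le> w $ i} \<in> sets borel"
    by (intro borel_closed closed_Collect_all closed_Collect_le continuous_intros)
  ultimately show ?thesis
    unfolding stationary_law_def using measurable_loynes_limit by (subst AE_distr_iff) (auto simp: measurable_P)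
qed

text \<open>Restarting the reflected path at time \<open>s\<close> from \<open>0\<close> instead of its actual position is forgotten
eventually, and the restarted path at integer times has the law of the increasing iterates.\<close>

lemma integral_restart_tendsto:
  assumes u: "bounded_uniform u" and s: "0 \<le> s"
  shows "(\<lambda>n. \<integral>x. u (reflect x (s + real n)) \<partial>P) \<longlonglongrightarrow> (\<integral>w. u w \<partial>stationary_law)"
proof -
  obtain b where b: "0 \<le> b" "\<And>x. \<bar>u x\<bar> \<le> b" using bounded_uniform_bound[OF u] by blast
  note u_meas = bounded_uniform_measurable[OF u]
  have sh: "shift s \<in> measurable P path_space" by (simp add: measurable_P measurable_shift s)
  have unb: "AE x in P. \<forall>i K. \<exists>t\<ge>0. K \<le> regulator (shift s x) t $ i"
    by (rule AE_distrD[OF sh]) (unfold distr_shift[OF s], rule regulator_unbounded)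
  have "((\<lambda>t. (\<integral>x. u (reflect x (s + t)) \<partial>P) - (\<integral>x. u (reflect (shift s x) t) \<partial>P)) \<longlongrightarrow> 0) at_top"
  proof (rule integral_bounded_uniform_asymptotic[OF u])
    show "(\<lambda>x. reflect x (s + t)) \<in> borel_measurable P" if "0 \<le> t" for t
      using measurable_reflect_path[of "s + t"] that s by (simp add: measurable_P)
    show "(\<lambda>x. reflect (shift s x) t) \<in> borel_measurable P" if "0 \<le> t" for t
      by (rule measurable_compose[OF sh measurable_reflect_path[OF that]])
    show "AE x in P. ((\<lambda>t. reflect x (s + t) - reflect (shift s x) t) \<longlongrightarrow> 0) at_top"
    proof (rule AE_mp[OF unb], intro AE_I2 impI)
      fix x assume x: "x \<in> space P" and unb: "\<forall>i K. \<exists>t\<ge>0. K \<le> regulator (shift s x) t $ i"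
      have x': "x \<in> space path_space" using x by (simp add: space_P)
      have lb: "locally_bounded (shift s x)"
        by (intro cadlag_locally_bounded path_space_cadlag shift_in_path_space x' s)
      have a: "0 \<le> reflect x s" by (rule reflect_nonneg[OF path_locally_bounded[OF x] s])
      have "((\<lambda>t. reflect (\<lambda>r. reflect x s + shift s x r) t - reflect (shift s x) t) \<longlongrightarrow> 0) at_top"
        by (rule reflect_forgets_initial_condition[OF lb a]) (use unb in blast)
      moreover have "\<forall>\<^sub>F t in at_top. reflect (\<lambda>r. reflect x s + shift s x r) t - reflect (shift s x) t = reflect x (s + t) - reflect (shift s x) t"
        using eventually_ge_at_top[of 0]
      proof eventually_elim
        case (elim t)
        then show ?case using reflect_restart[OF x' s elim, of 0] by simp
      qed
      ultimately show "((\<lambda>t. reflect x (s + t) - reflect (shift s x) t) \<longlongrightarrow> 0) at_top"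
        by (rule Lim_transform_eventually)
    qed
  qed
  then have "(\<lambda>n. (\<integral>x. u (reflect x (s + real n)) \<partial>P) - (\<integral>x. u (reflect (shift s x) (real n)) \<partial>P)) \<longlonglongrightarrow> 0"
    by (rule filterlim_compose[OF _ filterlim_real_sequentially])
  moreover have "(\<integral>x. u (reflect (shift s x) (real n)) \<partial>P) = (\<integral>x. u (loynes n x) \<partial>P)" for n
  proof -
    have "(\<integral>x. u (reflect (shift s x) (real n)) \<partial>P) = (\<integral>x. u (reflect x (real n)) \<partial>distr P path_space (shift s))"
      by (intro integral_distr[symmetric] sh measurable_compose[OF measurable_reflect_path u_meas]) simp
    then show ?thesis using integral_reflect_loynes[OF u_meas] by (simp add: distr_shift[OF s])
  qed
  moreover have "(\<lambda>n. \<integral>x. u (loynes n x) \<partial>P) \<longlonglongrightarrow> (\<integral>x. u (loynes_limit x) \<partial>P)"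
  proof (rule integral_dominated_convergence[where w="\<lambda>_. b"])
    show "(\<lambda>x. u (loynes_limit x)) \<in> borel_measurable P" "(\<lambda>x. u (loynes n x)) \<in> borel_measurable P" for n
      using measurable_compose[OF measurable_loynes_limit u_meas] measurable_compose[OF measurable_loynes u_meas] by (simp_all add: measurable_P)
    show "AE x in P. (\<lambda>n. u (loynes n x)) \<longlonglongrightarrow> u (loynes_limit x)"
      by (rule AE_mp[OF loynes_tendsto], intro AE_I2 impI isCont_tendsto_compose[OF bounded_uniform_isCont[OF u]]) blast
  qed (use b in auto)
  moreover have "(\<integral>x. u (loynes_limit x) \<partial>P) = (\<integral>w. u w \<partial>stationary_law)"
    unfolding stationary_law_def using measurable_loynes_limit by (intro integral_distr[symmetric] u_meas) (simp add: measurable_P)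
  ultimately have "(\<lambda>n. (\<integral>x. u (reflect x (s + real n)) \<partial>P) - (\<integral>x. u (loynes n x) \<partial>P)) \<longlonglongrightarrow> 0"
    and "(\<lambda>n. \<integral>x. u (loynes n x) \<partial>P) \<longlonglongrightarrow> (\<integral>w. u w \<partial>stationary_law)" by (simp_all only:)
  from tendsto_add[OF this] show ?thesis by (simp only: diff_add_cancel add_0)
qed

lemma distr_loynes_restart:
  assumes t: "0 \<le> t"
  shows "distr (P \<Otimes>\<^sub>M P) borel (\<lambda>(z, x). reflect (\<lambda>r. loynes n z + x r) t) = distr P borel (\<lambda>x. reflect x (t + real n))"
proof -
  let ?f = "forward reflect_step 0 n"
  let ?g = "\<lambda>(w, x). reflect (\<lambda>r. w + x r) t"
  note g = borel_measurable_reflect_path[OF t]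
  have comp: "(\<lambda>(y, z). ?g (?f y, z)) \<in> borel_measurable (path_space \<Otimes>\<^sub>M path_space)"
    using measurable_compose[OF measurable_Pair[OF measurable_compose[OF measurable_fst measurable_forward] measurable_snd] g]
    by (simp add: case_prod_beta')
  have stop: "?f (stop (real n) y) = ?f y" if "y \<in> space P" for y
    using forward_stop[of reflect_step, OF reflect_step_stop, of y n "real n"] that by (simp add: space_P)
  have "distr (P \<Otimes>\<^sub>M P) borel (\<lambda>(z, x). ?g (loynes n z, x)) = distr (P \<Otimes>\<^sub>M P) borel (\<lambda>(z, x). ?g (?f z, x))"
    using distr_pair_map[OF measurable_loynes g, of n] distr_pair_map[OF measurable_forward g, of n] by (simp add: distr_forward_loynes)
  also have "\<dots> = distr (P \<Otimes>\<^sub>M P) borel (\<lambda>(z, x). (\<lambda>(y, z). ?g (?f y, z)) (stop (real n) z, x))"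
    by (intro distr_cong) (auto simp: space_pair_measure stop)
  also have "\<dots> = distr P borel (\<lambda>x. (\<lambda>(y, z). ?g (?f y, z)) (stop (real n) x, shift (real n) x))"
    by (rule distr_restart[OF _ comp, symmetric]) simp
  also have "\<dots> = distr P borel (\<lambda>x. reflect x (t + real n))"
  proof (rule distr_cong)
    fix x assume x: "x \<in> space P"
    then have x': "x \<in> space path_space" by (simp add: space_P)
    show "(\<lambda>(y, z). ?g (?f y, z)) (stop (real n) x, shift (real n) x) = reflect x (t + real n)"
      using reflect_restart[OF x' _ t, of "real n" 0] by (simp add: stop[OF x] forward_reflect_step[OF x'] add.commute)
  qed simp_all
  finally show ?thesis by simp
qed

text \<open>Let the initial position be the \<open>n\<close>-th iterate, independent of the path. Then the reflected path at time
\<open>t\<close> has the law of the reflected path from \<open>0\<close> at time \<open>t + n\<close>, which tends to the stationary law as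
\<open>n\<close> grows. On the other hand the iterates tend to their limit, and the reflected path at time \<open>t\<close> is a
continuous function of its starting point, uniformly in the driving path.\<close>

lemma distr_stationary_law:
  assumes t: "0 \<le> t"
  shows "distr (stationary_law \<Otimes>\<^sub>M P) borel (\<lambda>(w, x). reflect (\<lambda>r. w + x r) t) = stationary_law"
proof (rule prob_measure_eqI_bounded_uniform)
  interpret PP: pair_prob_space P P ..
  interpret S: prob_space stationary_law by (rule prob_space_stationary_law)
  interpret SP: pair_prob_space stationary_law P ..
  let ?g = "\<lambda>(w, x). reflect (\<lambda>r. w + x r) t"
  note g = borel_measurable_reflect_path[OF t]
  note sets_PP = sets_pair_measure_cong[OF sets_P sets_P]
  note sets_SP = sets_pair_measure_cong[OF sets_stationary_law sets_P]
  show "prob_space (distr (stationary_law \<Otimes>\<^sub>M P) borel ?g)"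
    using g by (intro SP.prob_space_distr) (simp add: measurable_cong_sets[OF sets_SP refl])
  show "prob_space stationary_law" by (rule prob_space_stationary_law)
  show "sets stationary_law = sets borel" by (rule sets_stationary_law)
  fix u :: "real^'n \<Rightarrow> real" assume u: "bounded_uniform u"
  obtain b where b: "0 \<le> b" "\<And>x. \<bar>u x\<bar> \<le> b" using bounded_uniform_bound[OF u] by blast
  note u_meas = bounded_uniform_measurable[OF u]
  have comp: "(\<lambda>(z, x). ?g (h z, x)) \<in> borel_measurable (P \<Otimes>\<^sub>M P)" if "h \<in> borel_measurable path_space" for h
    using measurable_compose[OF measurable_Pair[OF measurable_compose[OF measurable_fst that] measurable_snd] g]
    by (simp add: case_prod_beta' measurable_cong_sets[OF sets_PP refl])
  have ucomp: "(\<lambda>p. u (?g (h (fst p), snd p))) \<in> borel_measurable (P \<Otimes>\<^sub>M P)" if "h \<in> borel_measurable path_space" for h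
    using measurable_compose[OF comp[OF that] u_meas] by (simp add: case_prod_beta')
  have fst: "AE p in P \<Otimes>\<^sub>M P. (\<lambda>n. loynes n (fst p)) \<longlonglongrightarrow> loynes_limit (fst p) \<and> (\<forall>n. loynes n (fst p) \<le> loynes_limit (fst p))"
    by (rule AE_distrD[OF measurable_fst]) (simp only: distr_pair_fst loynes_tendsto)
  have "(\<integral>w. u w \<partial>distr (stationary_law \<Otimes>\<^sub>M P) borel ?g) = (\<integral>w. u w \<partial>distr (P \<Otimes>\<^sub>M P) borel (\<lambda>(z, x). ?g (loynes_limit z, x)))"
    using distr_pair_map[OF measurable_loynes_limit g] by (simp add: stationary_law_def)
  also have "\<dots> = (\<integral>p. u (?g (loynes_limit (fst p), snd p)) \<partial>(P \<Otimes>\<^sub>M P))"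
    using integral_distr[OF comp[OF measurable_loynes_limit] u_meas] by (simp add: case_prod_beta')
  finally have lhs: "(\<integral>w. u w \<partial>distr (stationary_law \<Otimes>\<^sub>M P) borel ?g) = (\<integral>p. u (?g (loynes_limit (fst p), snd p)) \<partial>(P \<Otimes>\<^sub>M P))" .
  have "(\<lambda>n. \<integral>p. u (?g (loynes n (fst p), snd p)) \<partial>(P \<Otimes>\<^sub>M P)) \<longlonglongrightarrow> (\<integral>p. u (?g (loynes_limit (fst p), snd p)) \<partial>(P \<Otimes>\<^sub>M P))"
  proof (rule integral_dominated_convergence[where w="\<lambda>_. b"])
    have cont: "isCont u w" for w
      by (rule bounded_uniform_isCont[OF u])
    show "AE p in P \<Otimes>\<^sub>M P. (\<lambda>n. u (?g (loynes n (fst p), snd p))) \<longlonglongrightarrow> u (?g (loynes_limit (fst p), snd p))"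
    proof (rule AE_mp[OF fst], intro AE_I2 impI isCont_tendsto_compose[OF cont])
      fix p assume p: "p \<in> space (P \<Otimes>\<^sub>M P)" and l: "(\<lambda>n. loynes n (fst p)) \<longlonglongrightarrow> loynes_limit (fst p) \<and> (\<forall>n. loynes n (fst p) \<le> loynes_limit (fst p))"
      have lb: "locally_bounded (snd p)" using p by (intro path_locally_bounded) (auto simp: space_pair_measure)
      show "(\<lambda>n. ?g (loynes n (fst p), snd p)) \<longlonglongrightarrow> ?g (loynes_limit (fst p), snd p)"
      proof (rule vec_tendstoI)
        fix i
        have "(\<lambda>n. 2 * v $ i * norm (loynes_limit (fst p) - loynes n (fst p))) \<longlonglongrightarrow> 2 * v $ i * norm (loynes_limit (fst p) - loynes_limit (fst p))"
          using l by (intro tendsto_intros) blast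
        then have z: "(\<lambda>n. 2 * v $ i * norm (loynes_limit (fst p) - loynes n (fst p))) \<longlonglongrightarrow> 0" by simp
        have "(\<lambda>n. ?g (loynes_limit (fst p), snd p) $ i - ?g (loynes n (fst p), snd p) $ i) \<longlonglongrightarrow> 0"
        proof (rule Lim_null_comparison[OF _ z], intro always_eventually allI)
          fix n
          show "norm (?g (loynes_limit (fst p), snd p) $ i - ?g (loynes n (fst p), snd p) $ i) \<le> 2 * v $ i * norm (loynes_limit (fst p) - loynes n (fst p))"
            using reflect_mono_initial(2)[OF lb _ t, of "loynes n (fst p)" "loynes_limit (fst p)" i] l by simp
        qed
        then have "(\<lambda>n. ?g (loynes_limit (fst p), snd p) $ i - (?g (loynes_limit (fst p), snd p) $ i - ?g (loynes n (fst p), snd p) $ i))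
          \<longlonglongrightarrow> ?g (loynes_limit (fst p), snd p) $ i - 0" by (intro tendsto_intros)
        then show "(\<lambda>n. ?g (loynes n (fst p), snd p) $ i) \<longlonglongrightarrow> ?g (loynes_limit (fst p), snd p) $ i" by simp
      qed
    qed
  qed (use b ucomp measurable_loynes measurable_loynes_limit in auto)
  moreover have "(\<integral>p. u (?g (loynes n (fst p), snd p)) \<partial>(P \<Otimes>\<^sub>M P)) = (\<integral>x. u (reflect x (t + real n)) \<partial>P)" for n
  proof -
    have "(\<integral>p. u (?g (loynes n (fst p), snd p)) \<partial>(P \<Otimes>\<^sub>M P)) = (\<integral>w. u w \<partial>distr (P \<Otimes>\<^sub>M P) borel (\<lambda>(z, x). ?g (loynes n z, x)))"
      using integral_distr[OF comp[OF measurable_loynes] u_meas] by (simp add: case_prod_beta')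
    also have "\<dots> = (\<integral>w. u w \<partial>distr P borel (\<lambda>x. reflect x (t + real n)))"
      using distr_loynes_restart[OF t, of n] by simp
    also have "\<dots> = (\<integral>x. u (reflect x (t + real n)) \<partial>P)"
      using measurable_reflect_path[of "t + real n"] t by (intro integral_distr u_meas) (simp add: measurable_P)
    finally show ?thesis .
  qed
  ultimately show "(\<integral>w. u w \<partial>distr (stationary_law \<Otimes>\<^sub>M P) borel ?g) = (\<integral>w. u w \<partial>stationary_law)"
    unfolding lhs using integral_restart_tendsto[OF u t] by (intro LIMSEQ_unique) auto
qed simp

end

section \<open>Uniqueness and convergence\<close>

locale reflected_levy_process = levy_process M X + reflection A v
  for M :: "'a measure" and X :: "real \<Rightarrow> 'a \<Rightarrow> real^'n" and A :: "real^'n^'n" and v :: "real^'n"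
begin

abbreviation reflected_from :: "(real^'n) \<Rightarrow> real \<Rightarrow> 'a \<Rightarrow> real^'n" where
  "reflected_from a t \<omega> \<equiv> reflected (mat 1 - A) (\<lambda>s. a + X s \<omega>) t"

lemma reflected_from_eq: "\<omega> \<in> space M \<Longrightarrow> 0 \<le> t \<Longrightarrow> reflected_from a t \<omega> = reflect (\<lambda>s. a + X s \<omega>) t"
  by (intro reflected_eq_reflect cadlag_const_add cadlag_paths)

lemma borel_measurable_reflected_from:
  assumes \<eta>: "\<eta> \<in> borel_measurable N" and pr: "pr \<in> measurable N M" and t: "0 \<le> t"
  shows "(\<lambda>p. reflected_from (\<eta> p) t (pr p)) \<in> borel_measurable N"
proof -
  have "(\<lambda>p. reflect (\<lambda>s. \<eta> p + X s (pr p)) t) \<in> borel_measurable N"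
  proof (rule borel_measurable_reflect[OF _ _ t])
    show "(\<lambda>p. \<eta> p + X u (pr p)) \<in> borel_measurable N" if "0 \<le> u" for u
      by (intro borel_measurable_add \<eta> measurable_compose[OF pr random_vector[OF that]])
    show "cadlag (\<lambda>u. \<eta> p + X u (pr p))" if "p \<in> space N" for p
      by (intro cadlag_const_add cadlag_paths measurable_space[OF pr that])
  qed
  then show ?thesis
    by (subst measurable_cong[where g="\<lambda>p. reflect (\<lambda>s. \<eta> p + X s (pr p)) t"]) (simp_all add: reflected_from_eq t measurable_space[OF pr])
qed

lemma reflected_from_eq_path: "AE \<omega> in M. \<forall>a. \<forall>t\<ge>0. reflected_from a t \<omega> = reflect (\<lambda>s. a + path \<omega> s) t"
proof (rule AE_mp[OF start_zero], intro AE_I2 impI allI)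
  fix \<omega> a and t :: real assume \<omega>: "\<omega> \<in> space M" and 0: "X 0 \<omega> = 0" and t: "0 \<le> t"
  have "reflect (\<lambda>s. a + X s \<omega>) t = reflect (\<lambda>s. a + path \<omega> s) t"
    by (rule reflect_cong) (simp_all add: path_def 0 t)
  then show "reflected_from a t \<omega> = reflect (\<lambda>s. a + path \<omega> s) t" by (simp add: reflected_from_eq \<omega> t)
qed

text \<open>The space \<open>N\<close> is either \<open>M\<close> itself, with an initial condition that may depend on \<open>X\<close>, or the product
of \<open>M\<close> with an independent initial law.\<close>

lemma integral_forgets_initial:
  assumes unb: "AE \<omega> in M. \<forall>i K. \<exists>t\<ge>0. K \<le> regulator (path \<omega>) t $ i"
    and N: "prob_space N" and pr: "pr \<in> measurable N M" "distr N M pr = M"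
    and \<eta>: "\<eta> \<in> borel_measurable N" "AE p in N. \<forall>i. 0 \<le> \<eta> p $ i"
    and u: "bounded_uniform u"
  shows "((\<lambda>t. (\<integral>p. u (reflected_from (\<eta> p) t (pr p)) \<partial>N) - (\<integral>\<omega>. u (reflected_from 0 t \<omega>) \<partial>M)) \<longlongrightarrow> 0) at_top"
proof -
  interpret N: prob_space N by fact
  have "((\<lambda>t. (\<integral>p. u (reflected_from (\<eta> p) t (pr p)) \<partial>N) - (\<integral>p. u (reflected_from 0 t (pr p)) \<partial>N)) \<longlongrightarrow> 0) at_top"
  proof (rule N.integral_bounded_uniform_asymptotic[OF u])
    show "(\<lambda>p. reflected_from (\<eta> p) t (pr p)) \<in> borel_measurable N" if "0 \<le> t" for t
      by (rule borel_measurable_reflected_from[OF \<eta>(1) pr(1) that])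
    show "(\<lambda>p. reflected_from 0 t (pr p)) \<in> borel_measurable N" if "0 \<le> t" for t
      by (rule borel_measurable_reflected_from[OF borel_measurable_const pr(1) that])
    have 1: "AE p in N. \<forall>a. \<forall>t\<ge>0. reflected_from a t (pr p) = reflect (\<lambda>s. a + path (pr p) s) t"
      by (rule AE_distrD[OF pr(1)]) (unfold pr(2), rule reflected_from_eq_path)
    have 2: "AE p in N. \<forall>i K. \<exists>t\<ge>0. K \<le> regulator (path (pr p)) t $ i"
      by (rule AE_distrD[OF pr(1)]) (unfold pr(2), rule unb)
    from 1 2 \<eta>(2) AE_space
    show "AE p in N. ((\<lambda>t. reflected_from (\<eta> p) t (pr p) - reflected_from 0 t (pr p)) \<longlongrightarrow> 0) at_top"
    proof eventually_elim
      case (elim p)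
      have lb: "locally_bounded (path (pr p))"
        by (intro cadlag_locally_bounded path_space_cadlag measurable_space[OF measurable_path] measurable_space[OF pr(1)] elim(4))
      have a: "0 \<le> \<eta> p" using elim(3) by (simp add: less_eq_vec_def)
      have "((\<lambda>t. reflect (\<lambda>s. \<eta> p + path (pr p) s) t - reflect (path (pr p)) t) \<longlongrightarrow> 0) at_top"
        by (rule reflect_forgets_initial_condition[OF lb a]) (use elim(2) in blast)
      moreover have "\<forall>\<^sub>F t in at_top. reflect (\<lambda>s. \<eta> p + path (pr p) s) t - reflect (path (pr p)) t = reflected_from (\<eta> p) t (pr p) - reflected_from 0 t (pr p)"
        using eventually_ge_at_top[of 0]
      proof (rule eventually_mono)
        fix t :: real assume "0 \<le> t"
        then show "reflect (\<lambda>s. \<eta> p + path (pr p) s) t - reflect (path (pr p)) t = reflected_from (\<eta> p) t (pr p) - reflected_from 0 t (pr p)"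
          using elim(1)[rule_format, of t "\<eta> p"] elim(1)[rule_format, of t 0] by simp
      qed
      ultimately show ?case by (rule Lim_transform_eventually)
    qed
  qed
  moreover have "\<forall>\<^sub>F t in at_top. (\<integral>p. u (reflected_from (\<eta> p) t (pr p)) \<partial>N) - (\<integral>p. u (reflected_from 0 t (pr p)) \<partial>N)
      = (\<integral>p. u (reflected_from (\<eta> p) t (pr p)) \<partial>N) - (\<integral>\<omega>. u (reflected_from 0 t \<omega>) \<partial>M)"
    using eventually_ge_at_top[of 0]
  proof eventually_elim
    case (elim t)
    have "(\<lambda>\<omega>. reflected_from 0 t \<omega>) \<in> borel_measurable M"
      by (rule borel_measurable_reflected_from[OF borel_measurable_const measurable_ident_sets[OF refl] elim])
    then have "(\<integral>\<omega>. u (reflected_from 0 t \<omega>) \<partial>distr N M pr) = (\<integral>p. u (reflected_from 0 t (pr p)) \<partial>N)"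
      by (intro integral_distr pr measurable_compose[OF _ bounded_uniform_measurable[OF u]])
    then show ?case by (simp add: pr(2))
  qed
  ultimately show ?thesis by (rule Lim_transform_eventually)
qed

text \<open>Started from a stationary law the expectations are constant in time, so this constant is the limit for
the process started from \<open>0\<close>. As the limit does not depend on the stationary law, there is at most one.\<close>

lemma stationary_integral_limit:
  assumes unb: "AE \<omega> in M. \<forall>i K. \<exists>t\<ge>0. K \<le> regulator (path \<omega>) t $ i"
    and \<nu>: "stationary_distribution (mat 1 - A) M X \<nu>" and u: "bounded_uniform u"
  shows "((\<lambda>t. \<integral>\<omega>. u (reflected_from 0 t \<omega>) \<partial>M) \<longlongrightarrow> (\<integral>w. u w \<partial>\<nu>)) at_top"
proof -
  have N: "prob_space \<nu>" and sets: "sets \<nu> = sets borel" and nn: "AE w in \<nu>. \<forall>i. 0 \<le> w $ i"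
    and law: "\<And>t. 0 \<le> t \<Longrightarrow> has_law (\<nu> \<Otimes>\<^sub>M M) (\<lambda>(\<eta>, \<omega>). reflected_from \<eta> t \<omega>) \<nu>"
    using \<nu> by (auto simp: stationary_distribution_def)
  have M: "prob_space M" "sigma_finite_measure M" by (rule prob_space_axioms, rule sigma_finite_measure_axioms)
  interpret \<nu>: prob_space \<nu> by fact
  interpret pair_prob_space \<nu> M ..
  have nn': "AE p in \<nu> \<Otimes>\<^sub>M M. \<forall>i. 0 \<le> fst p $ i"
    by (rule AE_distrD[OF measurable_fst]) (unfold prob_space.distr_pair_fst[OF M(1)], rule nn)
  have fst: "fst \<in> borel_measurable (\<nu> \<Otimes>\<^sub>M M)"
    using measurable_fst[of \<nu> M] by (simp add: measurable_cong_sets[OF refl sets])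
  have "((\<lambda>t. (\<integral>p. u (reflected_from (fst p) t (snd p)) \<partial>(\<nu> \<Otimes>\<^sub>M M)) - (\<integral>\<omega>. u (reflected_from 0 t \<omega>) \<partial>M)) \<longlongrightarrow> 0) at_top"
    by (intro integral_forgets_initial unb P.prob_space_axioms measurable_snd distr_pair_snd N
        M(2) fst nn' u)
  moreover have "\<forall>\<^sub>F t in at_top. (\<integral>p. u (reflected_from (fst p) t (snd p)) \<partial>(\<nu> \<Otimes>\<^sub>M M)) - (\<integral>\<omega>. u (reflected_from 0 t \<omega>) \<partial>M)
      = (\<integral>w. u w \<partial>\<nu>) - (\<integral>\<omega>. u (reflected_from 0 t \<omega>) \<partial>M)"
    using eventually_ge_at_top[of 0]
  proof eventually_elim
    case (elim t)
    from law[OF elim] have m: "(\<lambda>(\<eta>, \<omega>). reflected_from \<eta> t \<omega>) \<in> borel_measurable (\<nu> \<Otimes>\<^sub>M M)"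
      and d: "distr (\<nu> \<Otimes>\<^sub>M M) borel (\<lambda>(\<eta>, \<omega>). reflected_from \<eta> t \<omega>) = \<nu>" by (auto simp: has_law_def)
    have "(\<integral>w. u w \<partial>\<nu>) = (\<integral>w. u w \<partial>distr (\<nu> \<Otimes>\<^sub>M M) borel (\<lambda>(\<eta>, \<omega>). reflected_from \<eta> t \<omega>))" by (simp only: d)
    also have "\<dots> = (\<integral>p. u (reflected_from (fst p) t (snd p)) \<partial>(\<nu> \<Otimes>\<^sub>M M))"
      using integral_distr[OF m bounded_uniform_measurable[OF u]] by (simp add: case_prod_beta')
    finally show ?case by simp
  qed
  ultimately have "((\<lambda>t. (\<integral>w. u w \<partial>\<nu>) - (\<integral>\<omega>. u (reflected_from 0 t \<omega>) \<partial>M)) \<longlongrightarrow> 0) at_top"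
    by (rule Lim_transform_eventually)
  from tendsto_diff[OF tendsto_const[of "\<integral>w. u w \<partial>\<nu>"] this] show ?thesis by simp
qed

end

theorem corollary2p11:
  fixes P R :: "real^'n^'n"
    and M :: "'a measure"
    and X :: "real \<Rightarrow> 'a \<Rightarrow> real^'n"
  assumes P_nonneg: "\<And>i j. 0 \<le> P $ i $ j"
    and P_radius: "matrix_spectral_radius P < 1"
    and R_eq: "R = mat 1 - transpose P"
    and levy: "levy_process M X"
    and integrable: "integrable M (\<lambda>\<omega>. norm (X 1 \<omega>))"
    and drift: "\<And>i. (matrix_inv R *v (\<integral>\<omega>. X 1 \<omega> \<partial>M)) $ i < 0"
  shows "\<exists>\<mu>. stationary_distribution R M X \<mu> \<and>
           (\<forall>\<nu>. stationary_distribution R M X \<nu> \<longrightarrow> \<nu> = \<mu>) \<and>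
           (\<forall>\<eta>. \<eta> \<in> borel_measurable M \<longrightarrow> (AE \<omega> in M. \<forall>i. 0 \<le> \<eta> \<omega> $ i) \<longrightarrow>
              converges_in_distribution M (\<lambda>t \<omega>. reflected R (\<lambda>s. \<eta> \<omega> + X s \<omega>) t) \<mu>)"
proof -
  define A where "A = transpose P"
  have R: "R = mat 1 - A" by (simp add: R_eq A_def)
  obtain v where v: "0 \<le> v" "v = 1 + A *v v"
    using positive_solution_of_spectral_radius[OF P_nonneg P_radius] unfolding A_def by blast
  interpret levy_process M X by (rule levy)
  interpret reflected_levy_process M X A v
    by unfold_locales (use P_nonneg v in \<open>auto simp: A_def transpose_def\<close>)
  have M: "prob_space M" "sigma_finite_measure M" by (rule prob_space_axioms, rule sigma_finite_measure_axioms)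
  let ?P = "distr M path_space path"
  have "invertible R"
    unfolding invertible_left_inverse matrix_left_invertible_ker
  proof (intro allI impI)
    fix y assume "R *v y = 0"
    then have y: "A *v y = y" by (simp add: R matrix_vector_mult_diff_rdistrib)
    then have "0 \<le> y" "0 \<le> - y" using inverse_positive[of y] inverse_positive[of "- y"] by (simp_all add: vec.neg)
    then show "y = 0" by (simp add: order.antisym)
  qed
  then have "R ** matrix_inv R = mat 1"
    unfolding invertible_def matrix_inv_def by (rule someI2_ex) blast
  then have inv: "matrix_inv R *v y - A *v (matrix_inv R *v y) = y" for y
    by (metis R matrix_vector_mul_assoc matrix_vector_mul_lid matrix_vector_mult_diff_rdistrib)
  have path1: "AE \<omega> in M. path \<omega> 1 = X 1 \<omega>"
    by (rule AE_mp[OF start_zero]) (simp add: path_def)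
  have path1_meas: "(\<lambda>\<omega>. path \<omega> 1) \<in> borel_measurable M"
    by (rule measurable_compose[OF measurable_path measurable_path_eval]) simp
  have X1_meas: "X 1 \<in> borel_measurable M" by (simp add: random_vector)
  have "integrable M (\<lambda>\<omega>. norm (path \<omega> 1))"
    by (rule integrable_cong_AE_imp[OF integrable]) (use path1_meas path1 in auto)
  then have int: "integrable ?P (\<lambda>x. norm (x 1))"
    by (subst integrable_distr_eq[OF measurable_path]) (simp_all add: borel_measurable_norm_eval)
  have mean: "(\<integral>x. x 1 \<partial>?P) = (\<integral>\<omega>. X 1 \<omega> \<partial>M)"
  proof -
    have "(\<integral>x. x 1 \<partial>?P) = (\<integral>\<omega>. path \<omega> 1 \<partial>M)"
      by (intro integral_distr measurable_path measurable_path_eval) simp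
    also have "\<dots> = (\<integral>\<omega>. X 1 \<omega> \<partial>M)" by (rule integral_cong_AE[OF path1_meas X1_meas path1])
    finally show ?thesis .
  qed
  interpret LP: levy_path_law ?P by (rule levy_path_law_distr_path[OF levy])
  interpret S: stable_reflected_levy ?P A v "matrix_inv R"
    by unfold_locales (use int inv drift mean in auto)
  define \<mu> where "\<mu> = S.stationary_law"
  have unb: "AE \<omega> in M. \<forall>i K. \<exists>t\<ge>0. K \<le> regulator (path \<omega>) t $ i"
    by (rule AE_distrD[OF measurable_path S.regulator_unbounded])
  have \<mu>: "prob_space \<mu>" "sets \<mu> = sets borel"
    unfolding \<mu>_def by (rule S.prob_space_stationary_law, rule S.sets_stationary_law)
  interpret \<mu>: prob_space \<mu> by (rule \<mu>)
  interpret \<mu>M: pair_prob_space \<mu> M ..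
  have stationary: "stationary_distribution R M X \<mu>"
    unfolding stationary_distribution_def
  proof (intro conjI allI impI \<mu>)
    show "AE w in \<mu>. \<forall>i. 0 \<le> w $ i" unfolding \<mu>_def by (rule S.stationary_law_nonneg)
    fix t :: real assume t: "0 \<le> t"
    have fst: "fst \<in> borel_measurable (\<mu> \<Otimes>\<^sub>M M)"
      using measurable_fst[of \<mu> M] by (simp add: measurable_cong_sets[OF refl \<mu>(2)])
    have meas: "(\<lambda>(\<eta>, \<omega>). reflected_from \<eta> t \<omega>) \<in> borel_measurable (\<mu> \<Otimes>\<^sub>M M)"
      using borel_measurable_reflected_from[OF fst measurable_snd t] by (simp add: case_prod_beta')
    let ?g = "\<lambda>(w, x). reflect (\<lambda>r. w + x r) t"
    have g: "?g \<in> borel_measurable (borel \<Otimes>\<^sub>M path_space)" by (rule borel_measurable_reflect_path[OF t])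
    have pair: "(\<lambda>(w, \<omega>). (w, path \<omega>)) \<in> measurable (\<mu> \<Otimes>\<^sub>M M) (borel \<Otimes>\<^sub>M path_space)"
      unfolding case_prod_beta' by (intro measurable_Pair fst measurable_compose[OF measurable_snd measurable_path])
    have "AE p in \<mu> \<Otimes>\<^sub>M M. \<forall>a. \<forall>t\<ge>0. reflected_from a t (snd p) = reflect (\<lambda>s. a + path (snd p) s) t"
      by (rule AE_distrD[OF measurable_snd]) (simp only: distr_pair_snd[OF \<mu>(1) M(2)] reflected_from_eq_path)
    then have "AE p in \<mu> \<Otimes>\<^sub>M M. (\<lambda>(\<eta>, \<omega>). reflected_from \<eta> t \<omega>) p = (\<lambda>(w, \<omega>). ?g (w, path \<omega>)) p"
      by (rule AE_mp) (auto intro!: AE_I2 simp: t)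
    then have "distr (\<mu> \<Otimes>\<^sub>M M) borel (\<lambda>(\<eta>, \<omega>). reflected_from \<eta> t \<omega>) = distr (\<mu> \<Otimes>\<^sub>M M) borel (\<lambda>(w, \<omega>). ?g (w, path \<omega>))"
      using measurable_compose[OF pair g] by (intro distr_cong_AE meas) (simp_all add: case_prod_beta')
    also have "\<dots> = distr (distr (\<mu> \<Otimes>\<^sub>M M) (borel \<Otimes>\<^sub>M path_space) (\<lambda>(w, \<omega>). (w, path \<omega>))) borel ?g"
      by (subst distr_distr[OF g pair]) (simp add: comp_def case_prod_beta')
    also have "distr (\<mu> \<Otimes>\<^sub>M M) (borel \<Otimes>\<^sub>M path_space) (\<lambda>(w, \<omega>). (w, path \<omega>)) = distr \<mu> borel (\<lambda>w. w) \<Otimes>\<^sub>M ?P"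
      by (rule pair_measure_distr[symmetric])
        (simp_all add: measurable_path LP.sigma_finite_measure_axioms measurable_cong_sets[OF \<mu>(2) refl])
    also have "distr \<mu> borel (\<lambda>w. w) = \<mu>" by (rule distr_id2[OF \<mu>(2)[symmetric]])
    also have "distr (\<mu> \<Otimes>\<^sub>M ?P) borel ?g = \<mu>"
      unfolding \<mu>_def by (rule S.distr_stationary_law[OF t])
    finally show "has_law (\<mu> \<Otimes>\<^sub>M M) (\<lambda>(\<eta>, \<omega>). reflected R (\<lambda>s. \<eta> + X s \<omega>) t) \<mu>"
      using meas by (simp add: has_law_def R)
  qed
  note limit = stationary_integral_limit[OF unb]
  have unique: "\<nu> = \<mu>" if \<nu>: "stationary_distribution R M X \<nu>" for \<nu>
  proof (rule prob_measure_eqI_bounded_uniform)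
    show "prob_space \<nu>" "sets \<nu> = sets borel" using \<nu> by (auto simp: stationary_distribution_def)
    show "(\<integral>w. u w \<partial>\<nu>) = (\<integral>w. u w \<partial>\<mu>)" if u: "bounded_uniform u" for u
      by (rule tendsto_unique[OF _ limit[OF \<nu>[unfolded R] u] limit[OF stationary[unfolded R] u]]) simp
  qed (rule \<mu>)+
  have converges: "converges_in_distribution M (\<lambda>t \<omega>. reflected R (\<lambda>s. \<eta> \<omega> + X s \<omega>) t) \<mu>"
    if \<eta>: "\<eta> \<in> borel_measurable M" "AE \<omega> in M. \<forall>i. 0 \<le> \<eta> \<omega> $ i" for \<eta>
    unfolding R
  proof (rule converges_in_distributionI[OF _ \<mu>])
    have id: "(\<lambda>\<omega>. \<omega>) \<in> measurable M M" "distr M M (\<lambda>\<omega>. \<omega>) = M" by simp_all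
    show "(\<lambda>\<omega>. reflected_from (\<eta> \<omega>) t \<omega>) \<in> borel_measurable M" if "0 \<le> t" for t
      by (rule borel_measurable_reflected_from[OF \<eta>(1) id(1) that])
    fix u :: "real^'n \<Rightarrow> real" assume u: "bounded_uniform u"
    from tendsto_add[OF integral_forgets_initial[OF unb M(1) id \<eta> u] limit[OF stationary[unfolded R] u]]
    show "((\<lambda>t. \<integral>\<omega>. u (reflected_from (\<eta> \<omega>) t \<omega>) \<partial>M) \<longlongrightarrow> (\<integral>w. u w \<partial>\<mu>)) at_top" by simp
  qed
  show ?thesis using stationary unique converges by blast
qed

end
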